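(* Let $\psi$ be a modified ruin probability for the mixed-Poisson Cramér-Lundberg model described in the context. Assume that $\ell_1<c/\mu$, that the integrated tail distribution $F_I$ is subexponential, and that $$\lim_{y\to-\infty}\psi(y)=1.$$ Then, as $u\to\infty$, $$\psi(u)\sim\psi_{\rm cl}(u)\sim\mathbb{E}\left[\frac{\Lambda\mu}{c-\Lambda\mu}\right]\bar F_I(u).$$
   Context: Model. For initial capital $u$ and premium rate $c>0$, let $U_t=u+ct-\sum_{i=1}^{N_t}X_i$, $t\ge0$, under the probability $\mathbb{P}_u$. The claim sizes $X_1,X_2,\dots$ are i.i.d. positive random variables with distribution function $F$, tail $\bar F=1-F$ and finite mean $\mu=\mathbb{E}[X_1]$. The claim number process $(N_t)_{t\ge0}$ is a mixed Poisson process with nonnegative mixing variable $\Lambda$ having distribution function $G$ (conditionally on $\Lambda=\ell$, it is a homogeneous Poisson process of rate $\ell$), and it is independent of the claim sizes. Put $\ell_1:=\inf\{\ell\ge0:G(\ell)=1\}$. Classical ruin. The ruin time is $T:=\inf\{t>0:U_t<0\}$. For fixed intensity $\ell$, $\psi_{\rm cl}(u,\ell):=\mathbb{P}_u(T<\infty\mid\Lambda=\ell)$, with the convention $\psi_{\rm cl}(u,\ell)=1$ when $\ell\mu\ge c$; here conditioning on $\Lambda=\ell$ means that the claim number process is Poisson with rate $\ell$. The mixed-Poisson classical ruin probability is $\psi_{\rm cl}(u):=\int_{[0,\infty)}\psi_{\rm cl}(u,\ell)\,G(\mathrm{d}\ell)$. Modified ruin. A modified ruin probability is a measurable function $\psi:\mathbb{R}\to[0,1]$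 such that $$\psi(u)=\int_{(-\infty,0)}\psi(y)\,\mathbb{P}_u(U_T\in \mathrm{d}y,\,T<\infty),\qquad u\ge0.$$ Integrated tail. $F_I(x):=\frac1\mu\int_0^x\bar F(y)\,\mathrm{d}y$ for $x\ge0$, and $\bar F_I=1-F_I$. A distribution $H$ on $[0,\infty)$ with tail $\bar H=1-H$ is subexponential if $\bar H(x)>0$ for all $x$ and $\overline{H*H}(x)/\bar H(x)\to2$ as $x\to\infty$. Notation. $f(u)\sim g(u)$ as $u\to\infty$ means $f(u)=(1+o(1))g(u)$. *)

theory Defs
  imports "HOL-Probability.Probability" "HOL-Library.Landau_Symbols"
begin

section \<open>Claim numbers and claim sizes\<close>

(* Only time points t >= 0 matter; the values of N at negative times are unconstrained. *)
definition counting_process :: "'a measure \<Rightarrow> (real \<Rightarrow> 'a \<Rightarrow> nat) \<Rightarrow> bool" where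
  "counting_process P N \<longleftrightarrow>
     (\<forall>t\<ge>0. N t \<in> measurable P (count_space UNIV)) \<and>
     (\<forall>\<omega>\<in>space P.
        N 0 \<omega> = 0 \<and>
        (\<forall>s t. 0 \<le> s \<and> s \<le> t \<longrightarrow> N s \<omega> \<le> N t \<omega>) \<and>
        (\<forall>t\<ge>0. continuous (at_right t) (\<lambda>s. N s \<omega>)))"

(* The Poisson weights are written out because poisson_pmf is specified for positive rates only,
   while the rate l = 0 (no claims) is allowed here; 0 ^ 0 = 1 gives the right weights then.
   Paths are nondecreasing, so the truncated subtraction on nat is the true increment. *)
definition poisson_process :: "'a measure \<Rightarrow> real \<Rightarrow> (real \<Rightarrow> 'a \<Rightarrow> nat) \<Rightarrow> bool" where
  "poisson_process P l N \<longleftrightarrow>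
     counting_process P N \<and>
     (\<forall>s t k. 0 \<le> s \<and> s \<le> t \<longrightarrow>
        measure P {\<omega>\<in>space P. N t \<omega> - N s \<omega> = k}
          = exp (- (l * (t - s))) * (l * (t - s)) ^ k / fact k) \<and>
     (\<forall>(\<tau>::nat \<Rightarrow> real) n. 0 \<le> \<tau> 0 \<and> mono \<tau> \<longrightarrow>
        prob_space.indep_vars P (\<lambda>_. count_space UNIV)
          (\<lambda>i \<omega>. N (\<tau> (Suc i)) \<omega> - N (\<tau> i) \<omega>) {..<n})"

(* The claim sizes are numbered X 0, X 1, ...; D is their common law. *)
definition iid_claims :: "'a measure \<Rightarrow> (nat \<Rightarrow> 'a \<Rightarrow> real) \<Rightarrow> real measure \<Rightarrow> bool" where
  "iid_claims P X D \<longleftrightarrow>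
     prob_space.indep_vars P (\<lambda>_. borel) X UNIV \<and> (\<forall>i. distr P borel (X i) = D)"

definition independent_of_claims ::
    "'a measure \<Rightarrow> (real \<Rightarrow> 'a \<Rightarrow> nat) \<Rightarrow> (nat \<Rightarrow> 'a \<Rightarrow> real) \<Rightarrow> bool" where
  "independent_of_claims P N X \<longleftrightarrow>
     prob_space.indep_var P
       (PiM {0..} (\<lambda>_. count_space UNIV)) (\<lambda>\<omega>. \<lambda>t\<in>{0..}. N t \<omega>)
       (PiM UNIV (\<lambda>_. borel)) (\<lambda>\<omega> i. X i \<omega>)"

definition claim_size_law :: "real measure \<Rightarrow> bool" where
  "claim_size_law D \<longleftrightarrow> real_distribution D \<and> (AE x in D. 0 < x) \<and> integrable D (\<lambda>x. x)"

definition mean :: "real measure \<Rightarrow> real" where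
  "mean D = (LINT x|D. x)"

section \<open>The mixed Poisson model\<close>

definition regular_conditional_probability ::
    "'a measure \<Rightarrow> ('a \<Rightarrow> real) \<Rightarrow> (real \<Rightarrow> 'a measure) \<Rightarrow> bool" where
  "regular_conditional_probability M \<Lambda> K \<longleftrightarrow>
     K \<in> measurable borel (prob_algebra M) \<and>
     (\<forall>A\<in>sets M. \<forall>B\<in>sets borel.
        measure M {\<omega>\<in>A. \<Lambda> \<omega> \<in> B} = (LINT l:B|distr M borel \<Lambda>. measure (K l) A))"

(* K l is the law given \<Lambda> = l. Under every K l with l >= 0 the claim number process is
   Poisson with rate l, the claims are i.i.d. with law D, and both are independent; integrating
   over l gives the same statements about the claims, and their independence of N, under M.
   The values of K at negative arguments are irrelevant, as \<Lambda> is nonnegative. *)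
definition mixed_poisson_risk_model ::
    "'a measure \<Rightarrow> ('a \<Rightarrow> real) \<Rightarrow> (real \<Rightarrow> 'a measure) \<Rightarrow> (real \<Rightarrow> 'a \<Rightarrow> nat)
       \<Rightarrow> (nat \<Rightarrow> 'a \<Rightarrow> real) \<Rightarrow> real measure \<Rightarrow> bool" where
  "mixed_poisson_risk_model M \<Lambda> K N X D \<longleftrightarrow>
     prob_space M \<and>
     claim_size_law D \<and>
     \<Lambda> \<in> borel_measurable M \<and> (AE \<omega> in M. 0 \<le> \<Lambda> \<omega>) \<and>
     regular_conditional_probability M \<Lambda> K \<and>
     (\<forall>l\<ge>0. poisson_process (K l) l N \<and> iid_claims (K l) X D \<and>
        independent_of_claims (K l) N X)"

(* ell_1; ereal makes the infimum of the empty set (unbounded \<Lambda>) equal to infinity. *)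
definition max_intensity :: "real measure \<Rightarrow> ereal" where
  "max_intensity G = Inf (ereal ` {l. 0 \<le> l \<and> cdf G l = 1})"

section \<open>Surplus, ruin time and ruin probabilities\<close>

definition surplus ::
    "real \<Rightarrow> (real \<Rightarrow> 'a \<Rightarrow> nat) \<Rightarrow> (nat \<Rightarrow> 'a \<Rightarrow> real) \<Rightarrow> real \<Rightarrow> real \<Rightarrow> 'a \<Rightarrow> real" where
  "surplus c N X u t \<omega> = u + c * t - (\<Sum>i<N t \<omega>. X i \<omega>)"

definition ruin_time ::
    "real \<Rightarrow> (real \<Rightarrow> 'a \<Rightarrow> nat) \<Rightarrow> (nat \<Rightarrow> 'a \<Rightarrow> real) \<Rightarrow> real \<Rightarrow> 'a \<Rightarrow> ereal" where
  "ruin_time c N X u \<omega> = Inf (ereal ` {t. 0 < t \<and> surplus c N X u t \<omega> < 0})"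

definition ruin_event ::
    "'a measure \<Rightarrow> real \<Rightarrow> (real \<Rightarrow> 'a \<Rightarrow> nat) \<Rightarrow> (nat \<Rightarrow> 'a \<Rightarrow> real) \<Rightarrow> real \<Rightarrow> 'a set" where
  "ruin_event M c N X u = {\<omega>\<in>space M. ruin_time c N X u \<omega> < \<infinity>}"

(* The measure P_u(U_T \<in> dy, T < \<infinity>); its total mass is the ruin probability. *)
definition surplus_at_ruin_law ::
    "'a measure \<Rightarrow> real \<Rightarrow> (real \<Rightarrow> 'a \<Rightarrow> nat) \<Rightarrow> (nat \<Rightarrow> 'a \<Rightarrow> real) \<Rightarrow> real \<Rightarrow> real measure" where
  "surplus_at_ruin_law M c N X u =
     distr (restrict_space M (ruin_event M c N X u)) borel
       (\<lambda>\<omega>. surplus c N X u (real_of_ereal (ruin_time c N X u \<omega>)) \<omega>)"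

definition psi_cl_fixed ::
    "(real \<Rightarrow> 'a measure) \<Rightarrow> (real \<Rightarrow> 'a \<Rightarrow> nat) \<Rightarrow> (nat \<Rightarrow> 'a \<Rightarrow> real) \<Rightarrow> real measure
       \<Rightarrow> real \<Rightarrow> real \<Rightarrow> real \<Rightarrow> real" where
  "psi_cl_fixed K N X D c u l =
     (if c \<le> l * mean D then 1 else measure (K l) (ruin_event (K l) c N X u))"

definition psi_cl ::
    "'a measure \<Rightarrow> ('a \<Rightarrow> real) \<Rightarrow> (real \<Rightarrow> 'a measure) \<Rightarrow> (real \<Rightarrow> 'a \<Rightarrow> nat)
       \<Rightarrow> (nat \<Rightarrow> 'a \<Rightarrow> real) \<Rightarrow> real measure \<Rightarrow> real \<Rightarrow> real \<Rightarrow> real" where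
  "psi_cl M \<Lambda> K N X D c u =
     (LINT l:{0..}|distr M borel \<Lambda>. psi_cl_fixed K N X D c u l)"

definition modified_ruin_probability ::
    "'a measure \<Rightarrow> (real \<Rightarrow> 'a \<Rightarrow> nat) \<Rightarrow> (nat \<Rightarrow> 'a \<Rightarrow> real) \<Rightarrow> real \<Rightarrow> (real \<Rightarrow> real) \<Rightarrow> bool" where
  "modified_ruin_probability M N X c \<psi> \<longleftrightarrow>
     \<psi> \<in> borel_measurable borel \<and> (\<forall>y. 0 \<le> \<psi> y \<and> \<psi> y \<le> 1) \<and>
     (\<forall>u\<ge>0. \<psi> u = (LINT y:{..<0}|surplus_at_ruin_law M c N X u. \<psi> y))"

section \<open>Integrated tail and subexponentiality\<close>

(* For x < 0 the range of integration is empty and the value is 0, so this is a distribution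
   function on the whole line. *)
definition integrated_tail :: "real measure \<Rightarrow> real \<Rightarrow> real" where
  "integrated_tail D x = (1 / mean D) * (LBINT y:{0..x}. 1 - cdf D y)"

definition subexponential :: "real measure \<Rightarrow> bool" where
  "subexponential H \<longleftrightarrow>
     real_distribution H \<and> measure H {..<0} = 0 \<and>
     (\<forall>x. 0 < 1 - cdf H x) \<and>
     ((\<lambda>x. (1 - cdf (H \<star> H) x) / (1 - cdf H x)) \<longlongrightarrow> 2) at_top"

end

(* For a fixed rate l with rho = l mu / c < 1 and claims independent of the claim number process, observe
   the surplus on the grid of mesh 2^-k. Integrating the one-step equation of the resulting random walk
   over [u, infinity) and letting k tend to infinity gives the ladder equation
   psi(u) = rho * integral of psi(u - y) F_I(dy), with psi = 1 on the negative half-line. If F_I is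
   subexponential, the error psi - rho/(1-rho) tail(F_I) satisfies a defective renewal inequality whose
   forcing term is o(tail(F_I)), so the error is o(tail(F_I)), uniformly for rho bounded away from 1;
   this yields the asymptotics after integration over Lambda.
   For a modified ruin probability it remains to see that the deficit at ruin is large with high
   conditional probability: after a small deficit the surplus stays above a fixed level with
   probability bounded below, so small deficits at ruin have probability at most a constant times
   psi(u - c) - psi(u + const), which is o(tail(F_I)) because F_I is long-tailed.
   The hypothesis only makes the claims independent of the counts at integer times. Ruin between
   integer times shifts the level by at most c, to which long tails are insensitive, so everything is
   reduced to the integer skeleton. *)

theory Submission
  imports Defs
begin

section \<open>Subexponential tails and the renewal equation\<close>

text \<open>The constant rho/(1-rho) is the root kappa of kappa = rho (1 + kappa): put psi = kappa
  tail on [0, infinity) and psi = 1 below into the ladder equation and use that the convolution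
  square of F_I has tail ~ 2 tail(F_I). Two obstacles shape the proof. The ladder equation needs
  ever finer grids, while independence is available at integer times only. It is therefore proved
  for an auxiliary process on a product space whose integer skeleton has the same law. The deficit
  at ruin, however, belongs to the original path and cannot be moved to that copy. It is compared
  with the skeleton by asking that no further claim arrives in the period in which the level first
  becomes low, which costs a factor exp l. The ladder equation is obtained without any smoothness of
  psi: a step shifts an interval, so the integrated one-step equation leaves boundary terms only,
  and on mesh h more than one claim in a step contributes O(h^2). Integrating over Lambda requires
  thresholds that do not depend on l, so the estimates are stated for whole families with rho <=
  rho1 < 1.\<close>

definition ccdf :: "real measure \<Rightarrow> real \<Rightarrow> real" where
  "ccdf H x = 1 - cdf H x"

lemma (in real_distribution) ccdf_eq_measure: "ccdf M x = measure M {x<..}"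
proof -
  have "measure M (space M - {..x}) = 1 - measure M {..x}"
    by (rule prob_compl) simp
  moreover have "space M - {..x} = {x<..}" by auto
  ultimately show ?thesis by (simp add: ccdf_def cdf_def)
qed

lemma (in real_distribution) ccdf_bounds: "0 \<le> ccdf M x" "ccdf M x \<le> 1"
  by (simp_all add: ccdf_eq_measure)

lemma (in real_distribution) ccdf_antimono: "x \<le> y \<Longrightarrow> ccdf M y \<le> ccdf M x"
  by (simp add: ccdf_def cdf_nondecreasing)

lemma (in real_distribution) ccdf_measurable [measurable]: "ccdf M \<in> borel_measurable borel"
proof -
  have "mono (cdf M)" by (simp add: mono_def cdf_nondecreasing)
  then have "cdf M \<in> borel_measurable borel" by (rule borel_measurable_mono)
  then show ?thesis unfolding ccdf_def by measurable
qed

lemma (in real_distribution) ccdf_neg: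
  assumes "measure M {..<0} = 0" "x < 0"
  shows "ccdf M x = 1"
proof -
  have "measure M {..x} \<le> measure M {..<0}"
    using assms by (intro finite_measure_mono) auto
  with assms show ?thesis by (simp add: ccdf_def cdf_def measure_le_0_iff)
qed

lemma (in real_distribution) AE_nonneg_of_measure:
  assumes "measure M {..<0} = 0"
  shows "AE y in M. 0 \<le> y"
proof -
  have "{..<0} \<in> null_sets M" using assms by (simp add: null_sets_def emeasure_eq_measure)
  then show ?thesis by (rule AE_I') (auto simp: not_le)
qed

lemma (in real_distribution) integrable_bounded_shift:
  fixes f :: "real \<Rightarrow> real"
  assumes [measurable]: "f \<in> borel_measurable borel" and b: "\<And>x. \<bar>f x\<bar> \<le> B"
  shows "integrable M (\<lambda>y. f (u - y))"
  by (rule integrable_const_bound[where B=B]) (auto simp: b)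

lemma (in real_distribution) integrable_ccdf_shift: "integrable M (\<lambda>y. ccdf M (u - y))"
  using ccdf_bounds
  by (intro integrable_bounded_shift[where B=1]) (auto simp: abs_le_iff intro: order_trans[OF _ zero_le_one])

lemma ccdf_convolution:
  assumes "real_distribution H"
  shows "ccdf (H \<star> H) x = (LINT y|H. ccdf H (x - y))"
proof -
  interpret real_distribution H by fact
  have fin: "finite_measure H" by unfold_locales
  interpret P: pair_prob_space H H ..
  have sp: "space (H \<star> H) = UNIV" by (simp add: convolution_def)
  have se: "sets (H \<star> H) = sets borel" by (simp add: convolution_def)
  have pr: "prob_space (H \<star> H)"
    unfolding convolution_def by (rule P.prob_space_distr) measurable
  interpret C: real_distribution "H \<star> H"
    using pr se by (simp add: real_distribution_def real_distribution_axioms_def)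
  have "emeasure (H \<star> H) {x<..} = (\<integral>\<^sup>+y. emeasure H {a. a + y \<in> {x<..}} \<partial>H)"
    by (rule convolution_emeasure) (auto simp: fin)
  also have "\<dots> = (\<integral>\<^sup>+y. ennreal (ccdf H (x - y)) \<partial>H)"
  proof (rule nn_integral_cong)
    fix y
    have "{a. a + y \<in> {x<..}} = {x - y<..}" by auto
    then show "emeasure H {a. a + y \<in> {x<..}} = ennreal (ccdf H (x - y))"
      by (simp add: emeasure_eq_measure ccdf_eq_measure)
  qed
  also have "\<dots> = ennreal (LINT y|H. ccdf H (x - y))"
    by (intro nn_integral_eq_integral integrable_bounded_shift[where B=1])
       (use ccdf_bounds in \<open>auto simp: abs_le_iff intro: order_trans[OF _ zero_le_one]\<close>)
  finally show ?thesis
    using ccdf_bounds by (simp add: C.emeasure_eq_measure C.ccdf_eq_measure integral_nonneg_AE)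
qed

text \<open>Split the convolution tail at x by the size y of one summand: y > x contributes
  \<open>ccdf H x\<close>, y <= A at least \<open>ccdf H x\<close> times the mass up to A, and A < y
  <= x at least \<open>ccdf H (x - A)\<close> times the mass there. The total is about twice
  \<open>ccdf H x\<close>, so in the limit the ratio cannot exceed (2 - 1 - cdf H A) / (1 - cdf H A)
  = 1.\<close>

lemma subexponential_long_tailed:
  assumes H: "subexponential H" and A: "0 \<le> A"
  shows "((\<lambda>x. ccdf H (x - A) / ccdf H x) \<longlongrightarrow> 1) at_top"
proof -
  interpret real_distribution H using H by (simp add: subexponential_def)
  have H0: "measure H {..<0} = 0" and pos: "\<And>x. 0 < ccdf H x"
    and lim: "((\<lambda>x. ccdf (H \<star> H) x / ccdf H x) \<longlongrightarrow> 2) at_top"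
    using H by (simp_all add: subexponential_def ccdf_def)
  have cdfA: "cdf H A < 1" using pos[of A] by (simp add: ccdf_def)
  let ?r = "\<lambda>x. ccdf (H \<star> H) x / ccdf H x"
  have bound: "ccdf H (x - A) / ccdf H x \<le> (?r x - 1 - cdf H A) / (cdf H x - cdf H A)"
    if x: "A \<le> x" "cdf H A < cdf H x" for x
  proof -
    have "A < x" using x by (cases "A = x") auto
    then have Ax: "measure H {A<..x} = cdf H x - cdf H A" by (simp add: cdf_diff_eq)
    have "ccdf H x + ccdf H x * cdf H A + ccdf H (x - A) * (cdf H x - cdf H A)
        = (LINT y|H. indicator {x<..} y + ccdf H x * indicator {..A} y
             + ccdf H (x - A) * indicator {A<..x} y)"
      using x by (subst Bochner_Integration.integral_add Bochner_Integration.integral_mult_right,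
           (auto intro!: integrable_real_indicator Bochner_Integration.integrable_add integrable_mult_right simp: less_top[symmetric])[2])+
         (simp add: ccdf_eq_measure[of x] cdf_def2[symmetric] Ax emeasure_eq_measure less_top[symmetric])
    also have "\<dots> \<le> (LINT y|H. ccdf H (x - y))"
    proof (rule integral_mono_AE)
      show "AE y in H. indicator {x<..} y + ccdf H x * indicator {..A} y
             + ccdf H (x - A) * indicator {A<..x} y \<le> ccdf H (x - y)"
        using AE_nonneg_of_measure[OF H0]
      proof eventually_elim
        case (elim y)
        then show ?case using x A ccdf_neg[OF H0, of "x - y"]
            ccdf_antimono[of "x - y" x] ccdf_antimono[of "x - y" "x - A"]
          by (auto split: split_indicator)
      qed
      show "integrable H (\<lambda>y. ccdf H (x - y))" by (rule integrable_ccdf_shift)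
    qed (auto intro!: integrable_real_indicator Bochner_Integration.integrable_add integrable_mult_right simp: emeasure_eq_measure less_top[symmetric])
    also have "\<dots> = ccdf (H \<star> H) x"
      by (rule ccdf_convolution[symmetric]) unfold_locales
    finally have "ccdf H (x - A) * (cdf H x - cdf H A) \<le> ccdf (H \<star> H) x - ccdf H x - ccdf H x * cdf H A"
      by simp
    then have "ccdf H (x - A) * (cdf H x - cdf H A) / ccdf H x
        \<le> (ccdf (H \<star> H) x - ccdf H x - ccdf H x * cdf H A) / ccdf H x"
      using pos[of x] by (intro divide_right_mono) auto
    then show ?thesis using x pos[of x] by (simp add: field_simps)
  qed
  have ev: "eventually (\<lambda>x. A \<le> x \<and> cdf H A < cdf H x) at_top"
    using eventually_ge_at_top[of A] order_tendstoD(1)[OF cdf_lim_at_top_prob cdfA]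
    by eventually_elim auto
  have "((\<lambda>x. (?r x - 1 - cdf H A) / (cdf H x - cdf H A)) \<longlongrightarrow> (2 - 1 - cdf H A) / (1 - cdf H A)) at_top"
    using cdfA by (intro tendsto_intros lim cdf_lim_at_top_prob) auto
  then have up: "((\<lambda>x. (?r x - 1 - cdf H A) / (cdf H x - cdf H A)) \<longlongrightarrow> 1) at_top"
    using cdfA by simp
  show ?thesis
  proof (rule tendsto_sandwich[OF _ _ tendsto_const up])
    show "\<forall>\<^sub>F x in at_top. 1 \<le> ccdf H (x - A) / ccdf H x"
      using A pos ccdf_antimono by (intro always_eventually allI) (simp add: le_divide_eq)
    show "\<forall>\<^sub>F x in at_top. ccdf H (x - A) / ccdf H x \<le> (?r x - 1 - cdf H A) / (cdf H x - cdf H A)"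
      using ev by eventually_elim (use bound in auto)
  qed
qed

text \<open>A whole set of error functions, so that the constants and thresholds below serve all
  intensities at once. The forcing term is the defect in the subexponential limit and is o of the
  tail by \<open>subexponential_eventually_convolution\<close>.\<close>

definition renewal_error_class :: "real measure \<Rightarrow> real \<Rightarrow> real \<Rightarrow> real \<Rightarrow> (real \<Rightarrow> real) set" where
  "renewal_error_class H \<rho> \<kappa> B = {g. g \<in> borel_measurable borel \<and> (\<forall>u. 0 \<le> g u \<and> g u \<le> B) \<and>
     (\<forall>u<0. g u = 0) \<and>
     (\<forall>u\<ge>0. g u \<le> \<rho> * (LINT y|H. g (u - y)) + \<kappa> * \<bar>ccdf (H \<star> H) u - 2 * ccdf H u\<bar>)}"

lemma subexponential_eventually_convolution:
  assumes H: "subexponential H" and e: "0 < e"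
  shows "\<forall>\<^sub>F u in at_top. \<bar>ccdf (H \<star> H) u - 2 * ccdf H u\<bar> \<le> e * ccdf H u"
proof -
  have pos: "\<And>x. 0 < ccdf H x"
    and lim: "((\<lambda>x. ccdf (H \<star> H) x / ccdf H x) \<longlongrightarrow> 2) at_top"
    using H by (simp_all add: subexponential_def ccdf_def)
  from tendstoD[OF lim e] show ?thesis
  proof eventually_elim
    case (elim u)
    have "ccdf (H \<star> H) u - 2 * ccdf H u = (ccdf (H \<star> H) u / ccdf H u - 2) * ccdf H u"
      using pos[of u] by (simp add: field_simps)
    then show ?case using elim pos[of u]
      by (simp add: abs_mult dist_real_def mult_right_mono)
  qed
qed

text \<open>This is the part of the convolution seen by functions that vanish on the negative
  half-line. Dropping y > u, where the integrand is 1, removes exactly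
  \<open>ccdf M u\<close>.\<close>

lemma (in real_distribution) integral_ccdf_split:
  assumes H0: "measure M {..<0} = 0"
  shows "(LINT y|M. ccdf M (u - y) * indicator {..u} y) = ccdf (M \<star> M) u - ccdf M u"
    and "integrable M (\<lambda>y. ccdf M (u - y) * indicator {..u} y)"
proof -
  have i1: "integrable M (\<lambda>y. ccdf M (u - y))" by (rule integrable_ccdf_shift)
  have eq: "ccdf M (u - y) * indicator {..u} y = ccdf M (u - y) - indicator {u<..} y" for y
    using ccdf_neg[OF H0, of "u - y"] by (auto split: split_indicator)
  have i2: "integrable M (indicator {u<..} :: real \<Rightarrow> real)"
    by (intro integrable_real_indicator) (auto simp: emeasure_eq_measure less_top[symmetric])
  show "(LINT y|M. ccdf M (u - y) * indicator {..u} y) = ccdf (M \<star> M) u - ccdf M u"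
    unfolding eq using i1 i2
    by (simp add: ccdf_convolution[OF real_distribution_axioms] ccdf_eq_measure[of u])
  show "integrable M (\<lambda>y. ccdf M (u - y) * indicator {..u} y)"
    unfolding eq using i1 i2 by auto
qed

text \<open>Bootstrap for the largest ratio s of g to the tail on [0, u]: beyond A the inequality
  returns at most rho2 s + kappa e with rho2 < 1, and up to A the ratio is at most B / ccdf H A.
  Hence s <= C with C independent of g and u.\<close>

lemma renewal_error_bounded:
  assumes H: "subexponential H" and \<rho>: "0 \<le> \<rho>" "\<rho> < 1" and \<kappa>: "0 \<le> \<kappa>" and B: "0 \<le> B"
  shows "\<exists>C\<ge>0. \<forall>g\<in>renewal_error_class H \<rho> \<kappa> B. \<forall>u\<ge>0. g u \<le> C * ccdf H u"
proof -
  interpret real_distribution H using H by (simp add: subexponential_def)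
  have H0: "measure H {..<0} = 0" and pos: "\<And>x. 0 < ccdf H x"
    using H by (simp_all add: subexponential_def ccdf_def)
  \<comment> \<open>With e = (1 - rho) / 2 one has rho (1 + e) <= rho + e = rho2 < 1, where e is the
    relative error allowed in the convolution tail.\<close>
  define \<rho>2 where "\<rho>2 = (1 + \<rho>) / 2"
  define e where "e = (1 - \<rho>) / 2"
  have e: "0 < e" and \<rho>2: "\<rho> * (1 + e) \<le> \<rho>2" "\<rho>2 < 1" "0 \<le> \<rho>2"
    using \<rho> mult_left_le_one_le[of e \<rho>] by (auto simp: e_def \<rho>2_def field_simps)
  obtain A0 where A0: "\<And>u. u \<ge> A0 \<Longrightarrow> \<bar>ccdf (H \<star> H) u - 2 * ccdf H u\<bar> \<le> e * ccdf H u"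
    using subexponential_eventually_convolution[OF H e] by (auto simp: eventually_at_top_linorder)
  define A where "A = max 0 A0"
  define C where "C = max (B / ccdf H A) (\<kappa> * e / (1 - \<rho>2))"
  have C0: "0 \<le> C" using B pos[of A] by (auto simp: C_def le_max_iff_disj)
  have "g u \<le> C * ccdf H u" if g: "g \<in> renewal_error_class H \<rho> \<kappa> B" and u: "0 \<le> u" for g u
  proof -
    have [measurable]: "g \<in> borel_measurable borel"
      and g0: "\<And>x. 0 \<le> g x" and gB: "\<And>x. g x \<le> B" and gneg: "\<And>x. x < 0 \<Longrightarrow> g x = 0"
      and ren: "\<And>x. 0 \<le> x \<Longrightarrow> g x \<le> \<rho> * (LINT y|H. g (x - y)) + \<kappa> * \<bar>ccdf (H \<star> H) x - 2 * ccdf H x\<bar>"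
      using g by (auto simp: renewal_error_class_def)
    \<comment> \<open>On [0, u] the supremum is finite because the tail is at least
      \<open>ccdf H u\<close> there; over all arguments it could be infinite a priori.\<close>
    define s where "s = (SUP x\<in>{0..u}. g x / ccdf H x)"
    have bdd: "bdd_above ((\<lambda>x. g x / ccdf H x) ` {0..u})"
    proof (rule bdd_aboveI2)
      fix x assume "x \<in> {0..u}"
      then show "g x / ccdf H x \<le> B / ccdf H u"
        using g0 gB B pos ccdf_antimono[of x u] by (intro frac_le) auto
    qed
    have sx: "g x / ccdf H x \<le> s" if "0 \<le> x" "x \<le> u" for x
      unfolding s_def using that by (intro cSUP_upper bdd) auto
    have s0: "0 \<le> s" using order_trans[OF _ sx[of 0]] u g0 pos[of 0] by auto
    have "s \<le> max (B / ccdf H A) (\<rho>2 * s + \<kappa> * e)"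
      unfolding s_def
    proof (rule cSUP_least)
      fix x assume x: "x \<in> {0..u}"
      show "g x / ccdf H x \<le> max (B / ccdf H A) (\<rho>2 * (SUP x\<in>{0..u}. g x / ccdf H x) + \<kappa> * e)"
        unfolding s_def[symmetric]
      proof (cases "x \<le> A")
        case True
        have "g x / ccdf H x \<le> B / ccdf H A"
          using g0 gB B pos ccdf_antimono[of x A] True by (intro frac_le) auto
        then show "g x / ccdf H x \<le> max (B / ccdf H A) (\<rho>2 * s + \<kappa> * e)" by simp
      next
        case False
        have d: "\<bar>ccdf (H \<star> H) x - 2 * ccdf H x\<bar> \<le> e * ccdf H x" using False A0 by (auto simp: A_def)
        have "(LINT y|H. g (x - y)) \<le> (LINT y|H. s * (ccdf H (x - y) * indicator {..x} y))"
        proof (rule integral_mono_AE)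
          show "integrable H (\<lambda>y. g (x - y))"
            using g0 gB by (intro integrable_bounded_shift[where B=B]) auto
          show "integrable H (\<lambda>y. s * (ccdf H (x - y) * indicator {..x} y))"
            by (intro integrable_mult_right integral_ccdf_split H0)
          show "AE y in H. g (x - y) \<le> s * (ccdf H (x - y) * indicator {..x} y)"
            using AE_nonneg_of_measure[OF H0]
          proof eventually_elim
            case (elim y)
            show ?case
            proof (cases "y \<le> x")
              case True
              then show ?thesis using sx[of "x - y"] elim x pos[of "x - y"] by (auto simp: field_simps)
            qed (use gneg in auto)
          qed
        qed
        also have "\<dots> = s * (ccdf (H \<star> H) x - ccdf H x)"
          using integral_ccdf_split[OF H0] by simp
        also have "\<dots> \<le> s * ((1 + e) * ccdf H x)"
          using d s0 by (intro mult_left_mono) (auto simp: algebra_simps)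
        finally have "\<rho> * (LINT y|H. g (x - y)) \<le> \<rho> * (s * ((1 + e) * ccdf H x))"
          using \<rho> by (intro mult_left_mono)
        also have "\<dots> = (\<rho> * (1 + e)) * (s * ccdf H x)" by simp
        also have "\<dots> \<le> \<rho>2 * (s * ccdf H x)"
          using \<rho>2 s0 pos[of x] by (intro mult_right_mono) auto
        finally have 1: "\<rho> * (LINT y|H. g (x - y)) \<le> \<rho>2 * s * ccdf H x" by simp
        have 2: "\<kappa> * \<bar>ccdf (H \<star> H) x - 2 * ccdf H x\<bar> \<le> \<kappa> * (e * ccdf H x)"
          using \<kappa> d by (intro mult_left_mono)
        have "g x \<le> (\<rho>2 * s + \<kappa> * e) * ccdf H x"
          using ren[of x] x 1 2 by (simp add: algebra_simps)
        then show "g x / ccdf H x \<le> max (B / ccdf H A) (\<rho>2 * s + \<kappa> * e)"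
          using pos[of x] by (auto simp: divide_le_eq le_max_iff_disj)
      qed
    qed (use u in auto)
    then have "s \<le> C"
      using \<rho>2 by (auto simp: C_def le_max_iff_disj field_simps)
    moreover have "g u \<le> s * ccdf H u" using sx[of u] u pos[of u] by (simp add: field_simps)
    ultimately show ?thesis using pos[of u] by (meson mult_right_mono order_trans less_imp_le)
  qed
  with C0 show ?thesis by blast
qed

text \<open>S collects the ratios that are eventually valid, uniformly in g; it is nonempty by
  \<open>renewal_error_bounded\<close>. One pass through the inequality turns r into rho2 r + delta
  for any delta > 0, so a positive infimum of S would contract below itself.\<close>

lemma renewal_error_small:
  assumes H: "subexponential H" and \<rho>: "0 \<le> \<rho>" "\<rho> < 1" and \<kappa>: "0 \<le> \<kappa>" and B: "0 \<le> B"
    and \<eta>: "0 < \<eta>"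
  shows "\<exists>A\<ge>0. \<forall>g\<in>renewal_error_class H \<rho> \<kappa> B. \<forall>u\<ge>A. g u \<le> \<eta> * ccdf H u"
proof -
  interpret real_distribution H using H by (simp add: subexponential_def)
  have H0: "measure H {..<0} = 0" and pos: "\<And>x. 0 < ccdf H x"
    using H by (simp_all add: subexponential_def ccdf_def)
  define S where "S = {r. 0 \<le> r \<and> (\<exists>A\<ge>0. \<forall>g\<in>renewal_error_class H \<rho> \<kappa> B. \<forall>u\<ge>A. g u \<le> r * ccdf H u)}"
  define \<rho>2 where "\<rho>2 = (1 + \<rho>) / 2"
  define e where "e = (1 - \<rho>) / 2"
  have e: "0 < e" and \<rho>2: "\<rho> * (1 + e) \<le> \<rho>2" "\<rho>2 < 1" "0 \<le> \<rho>2"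
    using \<rho> mult_left_le_one_le[of e \<rho>] by (auto simp: e_def \<rho>2_def field_simps)
  have "S \<noteq> {}" using renewal_error_bounded[OF assms(1-5)] unfolding S_def by blast
  have bdd: "bdd_below S" by (rule bdd_belowI[of _ 0]) (auto simp: S_def)
  have step: "\<rho>2 * r + \<delta> \<in> S" if r: "r \<in> S" and \<delta>: "0 < \<delta>" for r \<delta>
  proof -
    obtain A where A: "0 \<le> A" and gA: "\<And>g u. g \<in> renewal_error_class H \<rho> \<kappa> B \<Longrightarrow> A \<le> u \<Longrightarrow> g u \<le> r * ccdf H u"
      and r0: "0 \<le> r"
      using r by (auto simp: S_def)
    define d where "d = \<delta> / (2 * (\<kappa> + 1))"
    define d' where "d' = \<delta> / (2 * (B + 1))"
    have d: "0 < d" "\<kappa> * d \<le> \<delta> / 2" and d': "0 < d'" "B * d' \<le> \<delta> / 2"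
      using \<delta> \<kappa> B by (auto simp: d_def d'_def field_simps)
    have "\<forall>\<^sub>F u in at_top. ccdf H (u - A) / ccdf H u < 1 + d'"
      using order_tendstoD(2)[OF subexponential_long_tailed[OF H A]] d' by auto
    then have "\<forall>\<^sub>F u in at_top. 0 \<le> u \<and> \<bar>ccdf (H \<star> H) u - 2 * ccdf H u\<bar> \<le> e * ccdf H u
        \<and> \<bar>ccdf (H \<star> H) u - 2 * ccdf H u\<bar> \<le> d * ccdf H u \<and> ccdf H (u - A) - ccdf H u \<le> d' * ccdf H u"
      using subexponential_eventually_convolution[OF H e] subexponential_eventually_convolution[OF H d(1)]
        eventually_ge_at_top[of 0]
    proof eventually_elim
      case (elim u)
      then show ?case using pos[of u] by (auto simp: field_simps)
    qed
    then obtain A' where A': "\<And>u. A' \<le> u \<Longrightarrow> 0 \<le> u \<and> \<bar>ccdf (H \<star> H) u - 2 * ccdf H u\<bar> \<le> e * ccdf H u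
        \<and> \<bar>ccdf (H \<star> H) u - 2 * ccdf H u\<bar> \<le> d * ccdf H u \<and> ccdf H (u - A) - ccdf H u \<le> d' * ccdf H u"
      by (auto simp: eventually_at_top_linorder)
    have "g u \<le> (\<rho>2 * r + \<delta>) * ccdf H u" if g: "g \<in> renewal_error_class H \<rho> \<kappa> B" and u: "A' \<le> u" for g u
    proof -
      have [measurable]: "g \<in> borel_measurable borel"
        and g0: "\<And>x. 0 \<le> g x" and gB: "\<And>x. g x \<le> B" and gneg: "\<And>x. x < 0 \<Longrightarrow> g x = 0"
        and ren: "\<And>x. 0 \<le> x \<Longrightarrow> g x \<le> \<rho> * (LINT y|H. g (x - y)) + \<kappa> * \<bar>ccdf (H \<star> H) x - 2 * ccdf H x\<bar>"
        using g by (auto simp: renewal_error_class_def)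
      note A' = A'[OF u]
      \<comment> \<open>For y <= u - A the argument u - y is at least A and the ratio r applies. On
        the last stretch only g <= B is known, but its mass \<open>ccdf H (u - A) - ccdf H u\<close>
        is o of the tail because H is long-tailed.\<close>
      have "(LINT y|H. g (u - y)) \<le> (LINT y|H. r * (ccdf H (u - y) * indicator {..u} y) + B * indicator {u - A<..u} y)"
      proof (rule integral_mono)
        show "integrable H (\<lambda>y. g (u - y))"
          using g0 gB by (intro integrable_bounded_shift[where B=B]) auto
        show "integrable H (\<lambda>y. r * (ccdf H (u - y) * indicator {..u} y) + B * indicator {u - A<..u} y)"
          by (intro Bochner_Integration.integrable_add integrable_mult_right integral_ccdf_split H0 integrable_real_indicator)
             (auto simp: emeasure_eq_measure less_top[symmetric])
        fix y
        show "g (u - y) \<le> r * (ccdf H (u - y) * indicator {..u} y) + B * indicator {u - A<..u} y"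
          using gA[OF g, of "u - y"] gB[of "u - y"] gneg[of "u - y"] r0 B A ccdf_bounds(1)[of "u - y"]
          by (auto split: split_indicator intro!: order_trans[OF gB] add_increasing)
      qed
      also have "\<dots> = r * (ccdf (H \<star> H) u - ccdf H u) + B * (ccdf H (u - A) - ccdf H u)"
      proof -
        have "measure H {u - A<..u} = ccdf H (u - A) - ccdf H u"
          using A by (cases "A = 0") (auto simp: ccdf_def cdf_diff_eq[symmetric])
        then show ?thesis
          by (subst Bochner_Integration.integral_add)
             (auto intro!: integrable_mult_right integral_ccdf_split H0 integrable_real_indicator
               simp: integral_ccdf_split[OF H0] emeasure_eq_measure less_top[symmetric])
      qed
      also have "\<dots> \<le> r * ((1 + e) * ccdf H u) + B * (d' * ccdf H u)"
        using A' r0 B by (intro add_mono mult_left_mono) (auto simp: algebra_simps)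
      also have "\<dots> \<le> r * ((1 + e) * ccdf H u) + \<delta> / 2 * ccdf H u"
        using d' pos[of u] mult_right_mono[OF d'(2), of "ccdf H u"] by (simp add: mult.assoc)
      finally have "\<rho> * (LINT y|H. g (u - y)) \<le> \<rho> * (r * ((1 + e) * ccdf H u) + \<delta> / 2 * ccdf H u)"
        using \<rho> by (intro mult_left_mono)
      also have "\<dots> = \<rho> * (1 + e) * (r * ccdf H u) + \<rho> * (\<delta> / 2 * ccdf H u)" by (simp add: algebra_simps)
      also have "\<dots> \<le> \<rho>2 * (r * ccdf H u) + 1 * (\<delta> / 2 * ccdf H u)"
        using \<rho>2 \<rho> r0 pos[of u] \<delta> by (intro add_mono mult_right_mono) auto
      finally have 1: "\<rho> * (LINT y|H. g (u - y)) \<le> \<rho>2 * (r * ccdf H u) + \<delta> / 2 * ccdf H u" by simp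
      have "\<kappa> * \<bar>ccdf (H \<star> H) u - 2 * ccdf H u\<bar> \<le> \<kappa> * (d * ccdf H u)"
        using \<kappa> A' by (intro mult_left_mono) auto
      also have "\<dots> \<le> \<delta> / 2 * ccdf H u"
        using d mult_right_mono[OF d(2), of "ccdf H u"] pos[of u] by (simp add: mult.assoc)
      finally show ?thesis using ren[of u] A' 1 by (simp add: algebra_simps)
    qed
    moreover have "0 \<le> \<rho>2 * r + \<delta>" using \<rho>2 r0 \<delta> by simp
    ultimately show ?thesis unfolding S_def
      by (auto intro!: exI[of _ "max 0 A'"])
  qed
  define s where "s = Inf S"
  have "0 \<le> s" unfolding s_def by (rule cInf_greatest) (use \<open>S \<noteq> {}\<close> in \<open>auto simp: S_def\<close>)
  have "\<exists>r\<in>S. r < \<eta>"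
  proof (cases "s = 0")
    case True
    then show ?thesis using cInf_lessD[OF \<open>S \<noteq> {}\<close>, of \<eta>] \<eta> by (auto simp: s_def)
  next
    case False
    with \<open>0 \<le> s\<close> have s: "0 < s" by simp
    \<comment> \<open>Then 2 delta is half of the gap s (1 - rho2), so that rho2 (s + delta) + delta
      stays below s.\<close>
    define \<delta> where "\<delta> = s * (1 - \<rho>2) / 4"
    have \<delta>: "0 < \<delta>" using s \<rho>2 by (simp add: \<delta>_def)
    obtain r where r: "r \<in> S" "r < s + \<delta>"
      using cInf_lessD[OF \<open>S \<noteq> {}\<close>, of "s + \<delta>"] \<delta> by (auto simp: s_def)
    have "s \<le> \<rho>2 * r + \<delta>" unfolding s_def by (rule cInf_lower[OF step[OF r(1) \<delta>] bdd])
    also have "\<dots> \<le> \<rho>2 * (s + \<delta>) + \<delta>" using r \<rho>2 by (intro add_right_mono mult_left_mono) auto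
    also have "\<dots> \<le> \<rho>2 * s + 2 * \<delta>" using \<rho>2 \<delta> mult_left_le_one_le[of \<delta> \<rho>2] by (simp add: algebra_simps)
    also have "\<dots> < s" using s \<rho>2 by (simp add: \<delta>_def field_simps)
    finally show ?thesis by simp
  qed
  then obtain r A where "r < \<eta>" "0 \<le> A"
    and A: "\<forall>g\<in>renewal_error_class H \<rho> \<kappa> B. \<forall>u\<ge>A. g u \<le> r * ccdf H u"
    by (auto simp: S_def)
  then have "\<forall>g\<in>renewal_error_class H \<rho> \<kappa> B. \<forall>u\<ge>A. g u \<le> \<eta> * ccdf H u"
    using pos by (meson less_imp_le mult_right_mono order_trans)
  then show ?thesis using \<open>0 \<le> A\<close> by blast
qed

text \<open>Subtract the candidate kappa tail. Since kappa = rho + rho kappa, the leading terms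
  cancel and the remainder f solves the renewal equation with forcing rho kappa
  (\<open>ccdf (H \<star> H)\<close> - 2 \<open>ccdf H\<close>). Its modulus lies in the error class
  with the parameters of rho1, which gives one threshold for all rho <= rho1.\<close>

theorem subexponential_renewal_asymptotics:
  assumes H: "subexponential H" and \<rho>1: "0 \<le> \<rho>1" "\<rho>1 < 1" and \<eta>: "0 < \<eta>"
  shows "\<exists>A\<ge>0. \<forall>\<rho> \<psi>. 0 \<le> \<rho> \<longrightarrow> \<rho> \<le> \<rho>1 \<longrightarrow> \<psi> \<in> borel_measurable borel \<longrightarrow>
     (\<forall>u. 0 \<le> \<psi> u \<and> \<psi> u \<le> 1) \<longrightarrow> (\<forall>u<0. \<psi> u = 1) \<longrightarrow>
     (\<forall>u\<ge>0. \<psi> u = \<rho> * (LINT y|H. \<psi> (u - y))) \<longrightarrow>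
     (\<forall>u\<ge>A. \<bar>\<psi> u - \<rho> / (1 - \<rho>) * ccdf H u\<bar> \<le> \<eta> * ccdf H u)"
proof -
  interpret real_distribution H using H by (simp add: subexponential_def)
  have H0: "measure H {..<0} = 0" and pos: "\<And>x. 0 < ccdf H x"
    using H by (simp_all add: subexponential_def ccdf_def)
  \<comment> \<open>\<open>\<kappa>1\<close> dominates kappa and rho kappa for every rho <= rho1;
    hence 1 + kappa1 bounds the remainder f.\<close>
  define \<kappa>1 where "\<kappa>1 = \<rho>1 / (1 - \<rho>1)"
  have \<kappa>1: "0 \<le> \<kappa>1" using \<rho>1 by (simp add: \<kappa>1_def)
  obtain A where A: "0 \<le> A"
    and gA: "\<And>g u. g \<in> renewal_error_class H \<rho>1 \<kappa>1 (1 + \<kappa>1) \<Longrightarrow> A \<le> u \<Longrightarrow> g u \<le> \<eta> * ccdf H u"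
    using renewal_error_small[OF H \<rho>1 \<kappa>1 _ \<eta>, of "1 + \<kappa>1"] \<kappa>1 by auto
  have "\<bar>\<psi> u - \<rho> / (1 - \<rho>) * ccdf H u\<bar> \<le> \<eta> * ccdf H u"
    if \<rho>: "0 \<le> \<rho>" "\<rho> \<le> \<rho>1" and [measurable]: "\<psi> \<in> borel_measurable borel"
      and \<psi>01: "\<And>u. 0 \<le> \<psi> u \<and> \<psi> u \<le> 1" and \<psi>neg: "\<And>u. u < 0 \<Longrightarrow> \<psi> u = 1"
      and ren: "\<And>u. 0 \<le> u \<Longrightarrow> \<psi> u = \<rho> * (LINT y|H. \<psi> (u - y))" and u: "A \<le> u" for \<rho> \<psi> u
  proof -
    define \<kappa> where "\<kappa> = \<rho> / (1 - \<rho>)"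
    have \<kappa>: "0 \<le> \<kappa>" "\<kappa> \<le> \<kappa>1" "\<kappa> = \<rho> + \<rho> * \<kappa>"
      using \<rho> \<rho>1 by (auto simp: \<kappa>_def \<kappa>1_def intro!: frac_le) (simp add: field_simps)
    have \<rho>\<kappa>: "\<rho> * \<kappa> \<le> \<kappa>1" using \<kappa> \<rho> by auto
    \<comment> \<open>Cut off at 0: for negative x the difference is the constant 1 - kappa, which
      \<open>dec\<close> carries as a separate indicator term.\<close>
    define f where "f = (\<lambda>x. (\<psi> x - \<kappa> * ccdf H x) * indicator {0..} x)"
    have [measurable]: "f \<in> borel_measurable borel" unfolding f_def by measurable
    have fb: "\<bar>f x\<bar> \<le> 1 + \<kappa>1" for x
    proof -
      have "\<bar>\<psi> x - \<kappa> * ccdf H x\<bar> \<le> \<bar>\<psi> x\<bar> + \<bar>\<kappa> * ccdf H x\<bar>" by (rule abs_triangle_ineq4)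
      also have "\<dots> \<le> 1 + \<kappa>1 * 1" using \<psi>01[of x] \<kappa> ccdf_bounds[of x]
        by (auto simp: abs_mult simp del: mult_1_right intro!: add_mono mult_mono)
      finally show ?thesis using \<kappa>1 by (auto simp: f_def split: split_indicator)
    qed
    have dec: "\<psi> v = f v + \<kappa> * ccdf H v + (1 - \<kappa>) * indicator {..<0} v" for v
      using \<psi>neg[of v] ccdf_neg[OF H0, of v] by (auto simp: f_def split: split_indicator)
    have fren: "f v = \<rho> * (LINT y|H. f (v - y)) + \<rho> * \<kappa> * (ccdf (H \<star> H) v - 2 * ccdf H v)" if v: "0 \<le> v" for v
    proof -
      have i1: "integrable H (\<lambda>y. f (v - y))" by (rule integrable_bounded_shift[OF _ fb]) simp
      have i2: "integrable H (\<lambda>y. ccdf H (v - y))" by (rule integrable_ccdf_shift)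
      have i3: "integrable H (\<lambda>y. indicator {..<0} (v - y) :: real)"
        by (intro integrable_bounded_shift[where B=1]) (auto split: split_indicator)
      have "(LINT y|H. indicator {..<0} (v - y) :: real) = (LINT y|H. indicator {v<..} y)"
        by (intro Bochner_Integration.integral_cong) (auto split: split_indicator)
      also have "\<dots> = ccdf H v" by (simp add: ccdf_eq_measure)
      finally have 3: "(LINT y|H. indicator {..<0} (v - y) :: real) = ccdf H v" .
      have "(LINT y|H. \<psi> (v - y)) = (LINT y|H. f (v - y) + \<kappa> * ccdf H (v - y) + (1 - \<kappa>) * indicator {..<0} (v - y))"
        by (simp add: dec[symmetric])
      also have "\<dots> = (LINT y|H. f (v - y)) + \<kappa> * ccdf (H \<star> H) v + (1 - \<kappa>) * ccdf H v"
        using i1 i2 i3 by (simp add: 3 ccdf_convolution[OF real_distribution_axioms])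
      finally have "\<psi> v = \<rho> * ((LINT y|H. f (v - y)) + \<kappa> * ccdf (H \<star> H) v + (1 - \<kappa>) * ccdf H v)"
        using ren[OF v] by simp
      then have "f v = \<rho> * ((LINT y|H. f (v - y)) + \<kappa> * ccdf (H \<star> H) v + (1 - \<kappa>) * ccdf H v) - \<kappa> * ccdf H v"
        using v by (simp add: f_def)
      also have "\<dots> = \<rho> * (LINT y|H. f (v - y)) + \<rho> * \<kappa> * ccdf (H \<star> H) v + (\<rho> - \<rho> * \<kappa> - \<kappa>) * ccdf H v"
        by (simp add: algebra_simps)
      also have "\<rho> - \<rho> * \<kappa> - \<kappa> = - 2 * (\<rho> * \<kappa>)" using \<kappa>(3) by linarith
      finally show ?thesis by (simp add: algebra_simps)
    qed
    have "(\<lambda>x. \<bar>f x\<bar>) \<in> renewal_error_class H \<rho>1 \<kappa>1 (1 + \<kappa>1)"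
      unfolding renewal_error_class_def
    proof (intro CollectI conjI allI impI)
      fix v :: real assume v: "0 \<le> v"
      have "\<bar>f v\<bar> \<le> \<bar>\<rho> * (LINT y|H. f (v - y))\<bar> + \<bar>\<rho> * \<kappa> * (ccdf (H \<star> H) v - 2 * ccdf H v)\<bar>"
        using fren[OF v] by (metis abs_triangle_ineq)
      also have "\<dots> = \<rho> * \<bar>LINT y|H. f (v - y)\<bar> + \<rho> * \<kappa> * \<bar>ccdf (H \<star> H) v - 2 * ccdf H v\<bar>"
        using \<rho> \<kappa> by (simp add: abs_mult)
      also have "\<dots> \<le> \<rho>1 * (LINT y|H. \<bar>f (v - y)\<bar>) + \<kappa>1 * \<bar>ccdf (H \<star> H) v - 2 * ccdf H v\<bar>"
        using \<rho> \<rho>\<kappa> \<kappa>1 by (intro add_mono mult_mono integral_abs_bound) auto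
      finally show "\<bar>f v\<bar> \<le> \<rho>1 * (LINT y|H. \<bar>f (v - y)\<bar>) + \<kappa>1 * \<bar>ccdf (H \<star> H) v - 2 * ccdf H v\<bar>" .
    qed (use fb in \<open>auto simp: f_def\<close>)
    from gA[OF this u] A u show ?thesis by (simp add: f_def \<kappa>_def)
  qed
  then show ?thesis using A by blast
qed

section \<open>First passage of a walk with drift and nonnegative jumps\<close>

(* hit_prob n u is the probability that the walk started in u with steps a - s, s of law \<nu>, enters the
   negative half-line within n steps and does so at a point of A. *)
primrec hit_prob :: "real measure \<Rightarrow> real \<Rightarrow> real set \<Rightarrow> nat \<Rightarrow> real \<Rightarrow> real" where
  "hit_prob \<nu> a A 0 u = indicator A u"
| "hit_prob \<nu> a A (Suc n) u =
     (if u < 0 then indicator A u else LINT s|\<nu>. hit_prob \<nu> a A n (u + a - s))"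

definition hit_prob_limit :: "real measure \<Rightarrow> real \<Rightarrow> real set \<Rightarrow> real \<Rightarrow> real" where
  "hit_prob_limit \<nu> a A u = (SUP n. hit_prob \<nu> a A n u)"

text \<open>Not a signed integral: the value is 0 when beta <= alpha. So the mass of (v - s, v] is
  nonnegative for every step s, also on the null set where s < 0.\<close>

definition mass_between :: "(real \<Rightarrow> real) \<Rightarrow> real \<Rightarrow> real \<Rightarrow> real" where
  "mass_between q \<alpha> \<beta> = (LINT x|lborel. (if \<alpha> < x \<and> x \<le> \<beta> then q x else 0))"

definition unit_valued :: "(real \<Rightarrow> real) \<Rightarrow> bool" where
  "unit_valued q \<longleftrightarrow> q \<in> borel_measurable borel \<and> (\<forall>x. 0 \<le> q x \<and> q x \<le> 1)"

lemma unit_valuedD: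
  assumes "unit_valued q"
  shows "q \<in> borel_measurable borel" "0 \<le> q x" "q x \<le> 1" "\<bar>q x\<bar> \<le> 1"
  using assms by (auto simp: unit_valued_def)

lemma mass_between_integrable:
  assumes "unit_valued q"
  shows "integrable lborel (\<lambda>x. (if \<alpha> < x \<and> x \<le> \<beta> then q x else 0))"
proof (rule integrableI_bounded_set[where A="{\<alpha><..\<beta>}" and B=1])
  note [measurable] = unit_valuedD(1)[OF assms]
  show "(\<lambda>x. (if \<alpha> < x \<and> x \<le> \<beta> then q x else 0)) \<in> borel_measurable lborel" by measurable
  show "emeasure lborel {\<alpha><..\<beta>} < \<infinity>" by (cases "\<alpha> \<le> \<beta>") auto
qed (use unit_valuedD[OF assms] in auto)

lemma mass_between_nonneg: "unit_valued q \<Longrightarrow> 0 \<le> mass_between q \<alpha> \<beta>"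
  unfolding mass_between_def by (intro integral_nonneg_AE AE_I2) (auto simp: unit_valuedD)

lemma mass_between_empty: "\<beta> \<le> \<alpha> \<Longrightarrow> mass_between q \<alpha> \<beta> = 0"
proof -
  assume "\<beta> \<le> \<alpha>"
  then have "(\<lambda>x. (if \<alpha> < x \<and> x \<le> \<beta> then q x else 0)) = (\<lambda>_. 0)" by auto
  then show ?thesis by (simp add: mass_between_def)
qed

lemma integral_indicator_Ioc:
  fixes k :: real
  assumes "\<alpha> \<le> \<beta>"
  shows "(LINT x|lborel. (if \<alpha> < x \<and> x \<le> \<beta> then k else 0)) = k * (\<beta> - \<alpha>)"
    and "integrable lborel (\<lambda>x. (if \<alpha> < x \<and> x \<le> \<beta> then k else 0))"
proof -
  have eq: "(\<lambda>x. (if \<alpha> < x \<and> x \<le> \<beta> then k else 0)) = (\<lambda>x. k * indicator {\<alpha><..\<beta>} x)"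
    by (rule ext) (simp add: indicator_def)
  show "(LINT x|lborel. (if \<alpha> < x \<and> x \<le> \<beta> then k else 0)) = k * (\<beta> - \<alpha>)"
    unfolding eq using assms by simp
  show "integrable lborel (\<lambda>x. (if \<alpha> < x \<and> x \<le> \<beta> then k else 0))"
    unfolding eq using assms by (intro integrable_mult_right integrable_real_indicator) auto
qed

lemma mass_between_le:
  assumes q: "unit_valued q" and "\<alpha> \<le> \<beta>" and k: "\<And>x. \<alpha> < x \<Longrightarrow> x \<le> \<beta> \<Longrightarrow> q x \<le> k"
  shows "mass_between q \<alpha> \<beta> \<le> k * (\<beta> - \<alpha>)"
  unfolding mass_between_def integral_indicator_Ioc(1)[OF assms(2), symmetric]
  by (intro integral_mono mass_between_integrable q integral_indicator_Ioc assms) (auto intro: k)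

lemma mass_between_ge:
  assumes q: "unit_valued q" and "\<alpha> \<le> \<beta>" and k: "\<And>x. \<alpha> < x \<Longrightarrow> x \<le> \<beta> \<Longrightarrow> k \<le> q x"
  shows "k * (\<beta> - \<alpha>) \<le> mass_between q \<alpha> \<beta>"
  unfolding mass_between_def integral_indicator_Ioc(1)[OF assms(2), symmetric]
  by (intro integral_mono mass_between_integrable q integral_indicator_Ioc assms) (auto intro: k)

lemma mass_between_le_length: "unit_valued q \<Longrightarrow> \<alpha> \<le> \<beta> \<Longrightarrow> mass_between q \<alpha> \<beta> \<le> \<beta> - \<alpha>"
  using mass_between_le[of q \<alpha> \<beta> 1] by (simp add: unit_valuedD)

lemma mass_between_mono:
  assumes "unit_valued q" "unit_valued q'" "\<And>x. q x \<le> q' x"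
  shows "mass_between q \<alpha> \<beta> \<le> mass_between q' \<alpha> \<beta>"
  unfolding mass_between_def
  by (intro integral_mono mass_between_integrable assms) (auto intro: assms)

lemma mass_between_add:
  assumes "unit_valued q" "\<alpha> \<le> \<beta>" "\<beta> \<le> \<gamma>"
  shows "mass_between q \<alpha> \<beta> + mass_between q \<beta> \<gamma> = mass_between q \<alpha> \<gamma>"
proof -
  have "(\<lambda>x. (if \<alpha> < x \<and> x \<le> \<gamma> then q x else 0)) =
     (\<lambda>x. (if \<alpha> < x \<and> x \<le> \<beta> then q x else 0) + (if \<beta> < x \<and> x \<le> \<gamma> then q x else 0))"
    using assms(2,3) by (intro ext) simp
  then show ?thesis
    by (simp add: mass_between_def mass_between_integrable[OF assms(1)])
qed

lemma mass_between_shift: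
  "mass_between q (\<alpha> + t) (\<beta> + t) = (LINT x|lborel. (if \<alpha> < x \<and> x \<le> \<beta> then q (x + t) else 0))"
  unfolding mass_between_def
  by (subst lborel_integral_real_affine[where c=1 and t=t]) (auto simp: add.commute intro!: Bochner_Integration.integral_cong)

lemma mass_between_measurable:
  assumes "unit_valued q"
  shows "(\<lambda>s. mass_between q (u - s) v) \<in> borel_measurable borel"
proof -
  note [measurable] = unit_valuedD(1)[OF assms]
  show ?thesis unfolding mass_between_def by measurable
qed

lemma mass_between_downward:
  assumes q: "unit_valued q"
  shows "0 \<le> mass_between q (v - s) v" "mass_between q (v - s) v \<le> max 0 s"
  using mass_between_nonneg[OF q] mass_between_le_length[OF q, of "v - s" v] mass_between_empty[of v "v - s" q]
  by (auto simp: max_def)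

lemma (in real_distribution) hit_prob_measurable [measurable]:
  assumes [measurable]: "A \<in> sets borel"
  shows "hit_prob M a A n \<in> borel_measurable borel"
proof (induction n)
  case (Suc n)
  note [measurable] = Suc
  have "hit_prob M a A (Suc n) = (\<lambda>u. if u < 0 then indicator A u else LINT s|M. hit_prob M a A n (u + a - s))"
    by (simp add: fun_eq_iff)
  then show ?case by simp
qed simp

lemma (in real_distribution) hit_prob_bounds: "0 \<le> hit_prob M a A n u \<and> hit_prob M a A n u \<le> 1"
proof (induction n arbitrary: u)
  case (Suc n)
  have "(LINT s|M. hit_prob M a A n (u + a - s)) \<le> 1"
    using Suc by (cases "integrable M (\<lambda>s. hit_prob M a A n (u + a - s))")
      (auto intro!: integral_le_const simp: not_integrable_integral_eq)
  with Suc show ?case by (auto intro!: integral_nonneg_AE)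
qed simp

section \<open>One step of the walk: interval masses and the integrated one-step equation\<close>

locale nonneg_step = real_distribution \<nu> for \<nu> :: "real measure" +
  assumes AE_nonneg: "AE s in \<nu>. 0 \<le> s" and integrable_step: "integrable \<nu> (\<lambda>s. s)"
begin

lemma mass_between_measurable_step:
  "unit_valued q \<Longrightarrow> (\<lambda>s. mass_between q (u - s) v) \<in> borel_measurable \<nu>"
  using mass_between_measurable by simp

lemma integrable_mass_between_down:
  assumes q: "unit_valued q"
  shows "integrable \<nu> (\<lambda>s. mass_between q (v - s) v)"
proof (rule Bochner_Integration.integrable_bound[OF integrable_step])
  show "(\<lambda>s. mass_between q (v - s) v) \<in> borel_measurable \<nu>"
    by (rule mass_between_measurable_step[OF q])
  show "AE s in \<nu>. norm (mass_between q (v - s) v) \<le> norm s"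
    using AE_nonneg
  proof eventually_elim
    case (elim s)
    then show ?case using mass_between_downward[OF q, of v s] by simp
  qed
qed

text \<open>By \<open>expected_mass_eq\<close> this is the integral of q (v - y)
  \<open>ccdf \<nu> y\<close> over y >= 0, that is, the mean step times the convolution of q with
  the integrated tail law. As an expectation it is the boundary term in
  \<open>mass_between_transport\<close>.\<close>

definition expected_mass :: "(real \<Rightarrow> real) \<Rightarrow> real \<Rightarrow> real" where
  "expected_mass q v = (LINT s|\<nu>. mass_between q (v - s) v)"

lemma expected_mass_nonneg: "unit_valued q \<Longrightarrow> 0 \<le> expected_mass q v"
  unfolding expected_mass_def by (intro integral_nonneg_AE AE_I2 mass_between_nonneg)

lemma expected_mass_mono:
  assumes "unit_valued q" "unit_valued q'" "\<And>x. q x \<le> q' x"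
  shows "expected_mass q v \<le> expected_mass q' v"
  unfolding expected_mass_def
  by (intro integral_mono integrable_mass_between_down mass_between_mono assms)

lemma nn_integral_expected_mass:
  assumes q: "unit_valued q"
  shows "(\<integral>\<^sup>+y. ennreal (if 0 \<le> y then q (v - y) * ccdf \<nu> y else 0) \<partial>lborel) = ennreal (expected_mass q v)"
proof -
  note [measurable] = unit_valuedD(1)[OF q]
  interpret P: pair_sigma_finite lborel \<nu> ..
  have m: "ennreal (mass_between q (v - s) v) = (\<integral>\<^sup>+y. (if 0 \<le> y \<and> y < s then ennreal (q (v - y)) else 0) \<partial>lborel)" for s
  proof -
    have "mass_between q (v - s) v = (LINT y|lborel. (if 0 \<le> y \<and> y < s then q (v - y) else 0))"
      unfolding mass_between_def
      by (subst lborel_integral_real_affine[where c="-1" and t=v]) (auto intro!: Bochner_Integration.integral_cong)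
    moreover have "integrable lborel (\<lambda>y. (if 0 \<le> y \<and> y < s then q (v - y) else 0))"
      using lborel_integrable_real_affine[OF mass_between_integrable[OF q, of "v - s" v], of "-1" v]
      by (rule Bochner_Integration.integrable_cong[THEN iffD1, OF refl, rotated]) auto
    then have "ennreal (LINT y|lborel. (if 0 \<le> y \<and> y < s then q (v - y) else 0)) =
      (\<integral>\<^sup>+y. ennreal (if 0 \<le> y \<and> y < s then q (v - y) else 0) \<partial>lborel)"
      by (intro nn_integral_eq_integral[symmetric]) (auto simp: unit_valuedD[OF q])
    ultimately show ?thesis by (auto intro!: nn_integral_cong)
  qed
  have "ennreal (expected_mass q v) = (\<integral>\<^sup>+s. ennreal (mass_between q (v - s) v) \<partial>\<nu>)"
    unfolding expected_mass_def
    by (intro nn_integral_eq_integral[symmetric] integrable_mass_between_down q AE_I2 mass_between_nonneg)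
  also have "\<dots> = (\<integral>\<^sup>+s. \<integral>\<^sup>+y. (if 0 \<le> y \<and> y < s then ennreal (q (v - y)) else 0) \<partial>lborel \<partial>\<nu>)"
    by (simp add: m)
  also have "\<dots> = (\<integral>\<^sup>+y. \<integral>\<^sup>+s. (if 0 \<le> y \<and> y < s then ennreal (q (v - y)) else 0) \<partial>\<nu> \<partial>lborel)"
    by (rule P.Fubini') measurable
  also have "\<dots> = (\<integral>\<^sup>+y. ennreal (if 0 \<le> y then q (v - y) * ccdf \<nu> y else 0) \<partial>lborel)"
  proof (rule nn_integral_cong)
    fix y
    have "(\<integral>\<^sup>+s. (if 0 \<le> y \<and> y < s then ennreal (q (v - y)) else 0) \<partial>\<nu>)
      = (\<integral>\<^sup>+s. (if 0 \<le> y then ennreal (q (v - y)) else 0) * indicator {y<..} s \<partial>\<nu>)"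
      by (intro nn_integral_cong) (auto split: split_indicator)
    also have "\<dots> = (if 0 \<le> y then ennreal (q (v - y)) else 0) * emeasure \<nu> {y<..}"
      by (rule nn_integral_cmult_indicator) simp
    also have "\<dots> = ennreal (if 0 \<le> y then q (v - y) * ccdf \<nu> y else 0)"
      by (simp add: emeasure_eq_measure ccdf_eq_measure ennreal_mult unit_valuedD[OF q])
    finally show "(\<integral>\<^sup>+s. (if 0 \<le> y \<and> y < s then ennreal (q (v - y)) else 0) \<partial>\<nu>) = \<dots>" .
  qed
  finally show ?thesis by simp
qed

lemma expected_mass_eq:
  assumes q: "unit_valued q"
  shows "expected_mass q v = (LINT y|lborel. (if 0 \<le> y then q (v - y) * ccdf \<nu> y else 0))"
proof -
  note [measurable] = unit_valuedD(1)[OF q]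
  have m: "(\<lambda>y. if 0 \<le> y then q (v - y) * ccdf \<nu> y else 0) \<in> borel_measurable lborel"
    by measurable
  show ?thesis
    using nn_integral_expected_mass[OF q, of v] expected_mass_nonneg[OF q, of v]
    by (subst integral_eq_nn_integral[OF m]) (auto simp: unit_valuedD[OF q] ccdf_bounds)
qed

lemma integrable_ccdf: "integrable lborel (\<lambda>y. if 0 \<le> y then ccdf \<nu> y else 0)"
proof (rule integrableI_nn_integral_finite)
  have "(\<integral>\<^sup>+y. ennreal (if 0 \<le> y then 1 * ccdf \<nu> y else 0) \<partial>lborel) = ennreal (expected_mass (\<lambda>_. 1) 0)"
    by (rule nn_integral_expected_mass) (simp add: unit_valued_def)
  then show "(\<integral>\<^sup>+y. ennreal (if 0 \<le> y then ccdf \<nu> y else 0) \<partial>lborel) = ennreal (expected_mass (\<lambda>_. 1) 0)"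
    by (simp cong: if_cong)
qed (simp_all add: ccdf_bounds)

text \<open>A step carries (u, v] to (u + a - s, v + a - s]. Compared with (u + a, v + a], this
  gains a piece of length s at the lower end and loses one at the upper end; the averages of their
  masses are the two values of \<open>expected_mass\<close>. Keeping q' apart from q covers finite
  horizons, where q' belongs to the next horizon, and the limit, where q' = q.\<close>

lemma mass_between_transport:
  assumes q: "unit_valued q" and u: "0 \<le> u" "u \<le> v"
    and q': "\<And>x. 0 \<le> x \<Longrightarrow> q' x = (LINT s|\<nu>. q (x + a - s))"
  shows "mass_between q' u v
    = expected_mass q (u + a) + mass_between q (u + a) (v + a) - expected_mass q (v + a)"
proof -
  note [measurable] = unit_valuedD(1)[OF q]
  interpret P: pair_sigma_finite lborel \<nu> ..
  have "mass_between q' u v = (LINT x|lborel. LINT s|\<nu>. (if u < x \<and> x \<le> v then q (x + a - s) else 0))"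
    unfolding mass_between_def using u q' by (intro Bochner_Integration.integral_cong) auto
  also have "\<dots> = (LINT s|\<nu>. LINT x|lborel. (if u < x \<and> x \<le> v then q (x + a - s) else 0))"
  proof (rule P.Fubini_integral[symmetric], rule integrableI_bounded_set[where A="{u<..v} \<times> UNIV" and B=1])
    show "emeasure (lborel \<Otimes>\<^sub>M \<nu>) ({u<..v} \<times> UNIV) < \<infinity>"
      using u by (subst emeasure_pair_measure_Times) (auto simp: emeasure_eq_measure ennreal_mult_less_top)
    show "AE z in lborel \<Otimes>\<^sub>M \<nu>. z \<in> {u<..v} \<times> UNIV \<longrightarrow>
        norm (case z of (x, s) \<Rightarrow> if u < x \<and> x \<le> v then q (x + a - s) else 0) \<le> 1"
      by (intro AE_I2) (auto simp: unit_valuedD[OF q])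
    show "AE z in lborel \<Otimes>\<^sub>M \<nu>. z \<notin> {u<..v} \<times> UNIV \<longrightarrow>
        (case z of (x, s) \<Rightarrow> if u < x \<and> x \<le> v then q (x + a - s) else 0) = 0"
      by (intro AE_I2) (auto split: if_splits)
  qed simp_all
  also have "\<dots> = (LINT s|\<nu>. mass_between q (u + a - s) (v + a - s))"
    using mass_between_shift[of q u "a - s" v for s]
    by (simp add: add_diff_eq cong: if_cong)
  also have "\<dots> = (LINT s|\<nu>. mass_between q (u + a - s) (u + a) + mass_between q (u + a) (v + a)
      - mass_between q (v + a - s) (v + a))"
  proof (rule integral_cong_AE)
    show "AE s in \<nu>. mass_between q (u + a - s) (v + a - s) = mass_between q (u + a - s) (u + a)
        + mass_between q (u + a) (v + a) - mass_between q (v + a - s) (v + a)"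
      using AE_nonneg
    proof eventually_elim
      case (elim s)
      \<comment> \<open>Both groupings split (u + a - s, v + a]; this also covers steps so large
        that the shifted interval is disjoint from the original one.\<close>
      show ?case
        using mass_between_add[OF q, of "u + a - s" "u + a" "v + a"]
          mass_between_add[OF q, of "u + a - s" "v + a - s" "v + a"] elim u by auto
    qed
    show "(\<lambda>s. mass_between q (u + a - s) (v + a - s)) \<in> borel_measurable \<nu>"
      unfolding mass_between_def by measurable
  qed (intro borel_measurable_diff borel_measurable_add borel_measurable_const mass_between_measurable_step q)
  also have "\<dots> = expected_mass q (u + a) + mass_between q (u + a) (v + a) - expected_mass q (v + a)"
    by (simp add: expected_mass_def integrable_mass_between_down[OF q] prob_space[unfolded space_eq_univ])
  finally show ?thesis .
qed

text \<open>For decreasing q the mass of (v - s, v] is at most s q (v - s), which is dominated by s.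
  This gives a convergent upper bound for \<open>expected_mass\<close>, enough to control the
  boundary term at infinity. The modulus keeps the integrand nonnegative on the null set s <
  0.\<close>

lemma expected_mass_tendsto:
  assumes q: "unit_valued q" and am: "antimono q" and L: "(q \<longlongrightarrow> L) at_top"
  shows "((\<lambda>v. LINT s|\<nu>. \<bar>s\<bar> * q (v - s)) \<longlongrightarrow> L * (LINT s|\<nu>. s)) at_top"
    and "expected_mass q v \<le> (LINT s|\<nu>. \<bar>s\<bar> * q (v - s))"
proof -
  note [measurable] = unit_valuedD(1)[OF q]
  have "((\<lambda>v. LINT s|\<nu>. \<bar>s\<bar> * q (v - s)) \<longlongrightarrow> (LINT s|\<nu>. \<bar>s\<bar> * L)) at_top"
  proof (rule integral_dominated_convergence_at_top[where w="\<lambda>s. \<bar>s\<bar>"])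
    show "\<forall>\<^sub>F v in at_top. AE s in \<nu>. norm (\<bar>s\<bar> * q (v - s)) \<le> \<bar>s\<bar>"
      using unit_valuedD[OF q] by (intro always_eventually allI AE_I2) (auto simp: abs_mult intro: mult_left_le)
    have "filterlim (\<lambda>v. - s + v) at_top at_top" for s :: real
      by (rule filterlim_tendsto_add_at_top[OF tendsto_const filterlim_ident])
    then show "AE s in \<nu>. ((\<lambda>v. \<bar>s\<bar> * q (v - s)) \<longlongrightarrow> \<bar>s\<bar> * L) at_top"
      by (intro AE_I2 tendsto_mult tendsto_const filterlim_compose[OF L]) simp
    show "integrable \<nu> (\<lambda>s. \<bar>s\<bar>)" using integrable_step by simp
  qed simp_all
  moreover have "(LINT s|\<nu>. \<bar>s\<bar> * L) = L * (LINT s|\<nu>. s)"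
    unfolding integral_mult_right_zero[symmetric]
  proof (rule integral_cong_AE)
    show "AE s in \<nu>. \<bar>s\<bar> * L = L * s" using AE_nonneg by eventually_elim simp
  qed simp_all
  ultimately show "((\<lambda>v. LINT s|\<nu>. \<bar>s\<bar> * q (v - s)) \<longlongrightarrow> L * (LINT s|\<nu>. s)) at_top"
    by (simp only:)
  show "expected_mass q v \<le> (LINT s|\<nu>. \<bar>s\<bar> * q (v - s))"
    unfolding expected_mass_def
  proof (rule integral_mono_AE)
    show "integrable \<nu> (\<lambda>s. \<bar>s\<bar> * q (v - s))"
    proof (rule Bochner_Integration.integrable_bound[OF integrable_step])
      show "AE s in \<nu>. norm (\<bar>s\<bar> * q (v - s)) \<le> norm s"
        using unit_valuedD[OF q] by (intro AE_I2) (simp add: abs_mult mult_left_le)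
    qed simp
    show "AE s in \<nu>. mass_between q (v - s) v \<le> \<bar>s\<bar> * q (v - s)"
      using AE_nonneg
    proof eventually_elim
      case (elim s)
      then show ?case using mass_between_le[OF q, of "v - s" v "q (v - s)"] antimonoD[OF am]
        by (auto simp: mult.commute)
    qed
  qed (intro integrable_mass_between_down q)
qed

section \<open>First-passage probabilities: monotonicity, limits, ladder inequalities,
  overshoot\<close>

lemma unit_valued_hit_prob: "A \<in> sets borel \<Longrightarrow> unit_valued (hit_prob \<nu> a A n)"
  by (simp add: unit_valued_def hit_prob_bounds hit_prob_measurable)

lemma integrable_unit_valued_shift: "unit_valued q \<Longrightarrow> integrable \<nu> (\<lambda>s. q (u - s))"
  by (rule integrable_bounded_shift[where B=1]) (auto simp: unit_valuedD)

lemma hit_prob_neg: "u < 0 \<Longrightarrow> hit_prob \<nu> a A n u = indicator A u"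
  by (cases n) auto

lemma hit_prob_Suc_mono:
  assumes A: "A \<in> sets borel" "A \<subseteq> {..<0}"
  shows "hit_prob \<nu> a A n u \<le> hit_prob \<nu> a A (Suc n) u"
proof (induction n arbitrary: u)
  case 0
  then show ?case using A by (auto simp: indicator_def not_less intro!: integral_nonneg_AE)
next
  case (Suc n)
  show ?case
  proof (cases "u < 0")
    case False
    have "(LINT s|\<nu>. hit_prob \<nu> a A n (u + a - s)) \<le> (LINT s|\<nu>. hit_prob \<nu> a A (Suc n) (u + a - s))"
      by (intro integral_mono Suc integrable_unit_valued_shift unit_valued_hit_prob A)
    then show ?thesis using False by (simp only: hit_prob.simps if_False)
  qed simp
qed

lemma hit_prob_incseq:
  assumes A: "A \<in> sets borel" "A \<subseteq> {..<0}"
  shows "incseq (\<lambda>n. hit_prob \<nu> a A n u)"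
  using hit_prob_Suc_mono[OF A] by (rule incseq_SucI)

lemma hit_prob_LIMSEQ:
  assumes A: "A \<in> sets borel" "A \<subseteq> {..<0}"
  shows "(\<lambda>n. hit_prob \<nu> a A n u) \<longlonglongrightarrow> hit_prob_limit \<nu> a A u"
  unfolding hit_prob_limit_def
  by (rule LIMSEQ_incseq_SUP[OF bdd_aboveI2[where M=1] hit_prob_incseq[OF A]]) (simp add: hit_prob_bounds)

lemma unit_valued_hit_prob_limit:
  assumes A: "A \<in> sets borel" "A \<subseteq> {..<0}"
  shows "unit_valued (hit_prob_limit \<nu> a A)"
  unfolding unit_valued_def
proof (intro conjI allI)
  note [measurable] = hit_prob_measurable[OF A(1)]
  show "hit_prob_limit \<nu> a A \<in> borel_measurable borel"
    by (rule borel_measurable_LIMSEQ_real[OF hit_prob_LIMSEQ[OF A]]) measurable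
  fix x
  show "0 \<le> hit_prob_limit \<nu> a A x" "hit_prob_limit \<nu> a A x \<le> 1"
    using LIMSEQ_le_const[OF hit_prob_LIMSEQ[OF A]] LIMSEQ_le_const2[OF hit_prob_LIMSEQ[OF A]] hit_prob_bounds
    by blast+
qed

lemma hit_prob_le_limit:
  assumes A: "A \<in> sets borel" "A \<subseteq> {..<0}"
  shows "hit_prob \<nu> a A n u \<le> hit_prob_limit \<nu> a A u"
  by (rule incseq_le[OF hit_prob_incseq[OF A] hit_prob_LIMSEQ[OF A]])

lemma hit_prob_limit_neg: "u < 0 \<Longrightarrow> hit_prob_limit \<nu> a A u = indicator A u"
  by (simp add: hit_prob_limit_def hit_prob_neg)

lemma hit_prob_limit_harmonic:
  assumes A: "A \<in> sets borel" "A \<subseteq> {..<0}" and u: "0 \<le> u"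
  shows "hit_prob_limit \<nu> a A u = (LINT s|\<nu>. hit_prob_limit \<nu> a A (u + a - s))"
proof -
  note [measurable] = hit_prob_measurable[OF A(1)] unit_valuedD(1)[OF unit_valued_hit_prob_limit[OF A]]
  have "(\<lambda>n. LINT s|\<nu>. hit_prob \<nu> a A n (u + a - s)) \<longlonglongrightarrow> (LINT s|\<nu>. hit_prob_limit \<nu> a A (u + a - s))"
    by (rule integral_dominated_convergence[where w="\<lambda>_. 1"])
       (auto simp: hit_prob_bounds intro!: hit_prob_LIMSEQ A)
  moreover have "(\<lambda>n. hit_prob \<nu> a A (Suc n) u) \<longlonglongrightarrow> hit_prob_limit \<nu> a A u"
    by (rule LIMSEQ_Suc[OF hit_prob_LIMSEQ[OF A]])
  ultimately show ?thesis using u by (auto intro: LIMSEQ_unique)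
qed

lemma hit_prob_antimono: "antimono (hit_prob \<nu> a {..<0} n)"
proof (induction n)
  case 0
  show ?case by (auto simp: antimono_def indicator_def)
next
  case (Suc n)
  show ?case
  proof (rule antimonoI)
    fix u v :: real assume uv: "u \<le> v"
    show "hit_prob \<nu> a {..<0} (Suc n) v \<le> hit_prob \<nu> a {..<0} (Suc n) u"
    proof (cases "u < 0")
      case True
      then show ?thesis using hit_prob_neg[of u a "{..<0}" "Suc n"] hit_prob_bounds[of a "{..<0}" "Suc n" v] by simp
    next
      case False
      have "(LINT s|\<nu>. hit_prob \<nu> a {..<0} n (v + a - s)) \<le> (LINT s|\<nu>. hit_prob \<nu> a {..<0} n (u + a - s))"
        using uv by (intro integral_mono antimonoD[OF Suc] integrable_unit_valued_shift unit_valued_hit_prob) auto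
      then show ?thesis using False uv by simp
    qed
  qed
qed

lemma hit_prob_limit_antimono: "antimono (hit_prob_limit \<nu> a {..<0})"
  by (rule antimonoI)
     (rule LIMSEQ_le[OF hit_prob_LIMSEQ hit_prob_LIMSEQ], auto intro: antimonoD[OF hit_prob_antimono])

text \<open>Finitely many steps rarely cover a large distance; formally, dominated convergence along
  the horizon. The unlimited horizon has no such statement at this point, since nothing relates a to
  the mean step here.\<close>

lemma hit_prob_tendsto_0: "(hit_prob \<nu> a {..<0} n \<longlongrightarrow> 0) at_top"
proof (induction n)
  case 0
  have "\<forall>\<^sub>F u in at_top. indicator {..<0} (u::real) = (0::real)"
    using eventually_ge_at_top[of 0] by eventually_elim auto
  then show ?case by (simp add: tendsto_eventually)
next
  case (Suc n)
  have "((\<lambda>u. LINT s|\<nu>. hit_prob \<nu> a {..<0} n (u + a - s)) \<longlongrightarrow> (LINT s|\<nu>. 0)) at_top"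
  proof (rule integral_dominated_convergence_at_top[where w="\<lambda>_. 1"])
    have "filterlim (\<lambda>u. (a - s) + u) at_top at_top" for s :: real
      by (rule filterlim_tendsto_add_at_top[OF tendsto_const filterlim_ident])
    then show "AE s in \<nu>. ((\<lambda>u. hit_prob \<nu> a {..<0} n (u + a - s)) \<longlongrightarrow> 0) at_top"
      by (intro AE_I2 filterlim_compose[OF Suc]) (simp add: algebra_simps)
  qed (auto simp: hit_prob_bounds)
  then have "((\<lambda>u. LINT s|\<nu>. hit_prob \<nu> a {..<0} n (u + a - s)) \<longlongrightarrow> 0) at_top" by simp
  moreover have "\<forall>\<^sub>F u in at_top. (LINT s|\<nu>. hit_prob \<nu> a {..<0} n (u + a - s)) = hit_prob \<nu> a {..<0} (Suc n) u"
    using eventually_ge_at_top[of 0] by eventually_elim auto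
  ultimately show ?case by (simp only: filterlim_cong)
qed

(* Integrating the one-step equation over [v, w] telescopes to the same boundary expression at v and
   at w; it vanishes as w tends to infinity once p tends to 0. The lower estimate is proved first, for
   the finite horizons, where the decay is immediate; it then forces the limit L of p to satisfy
   a L <= (mean step) L, so that L = 0. *)
theorem hit_prob_ladder:
  assumes a: "0 < a" "(LINT s|\<nu>. s) < a" and u: "0 \<le> u"
  defines "p \<equiv> hit_prob_limit \<nu> a {..<0}"
  shows "a * p (u + a) \<le> expected_mass p (u + a)" and "expected_mass p (u + a) \<le> a * p u"
proof -
  have A: "{..<0::real} \<in> sets borel" "{..<0::real} \<subseteq> {..<0}" by auto
  note up = unit_valued_hit_prob_limit[OF A, of a, folded p_def]
  note un = unit_valued_hit_prob[OF A(1), of a]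
  have am: "antimono p" unfolding p_def by (rule hit_prob_limit_antimono)
  let ?h = "hit_prob \<nu> a {..<0}"
  have lower: "a * p (v + a) \<le> expected_mass p (v + a)" if v: "0 \<le> v" for v
  proof -
    have "a * ?h n (v + a) \<le> expected_mass p (v + a)" for n
    proof -
      have "mass_between (?h n) v (v + a) - expected_mass (?h n) (v + a) \<le> a * ?h n w" if w: "v \<le> w" for w
      proof -
        \<comment> \<open>The one-step average of horizon n is horizon n + 1, so transport relates
          two different horizons; monotonicity in n turns it into an inequality for a single
          one.\<close>
        have "mass_between (?h n) v w \<le> mass_between (?h (Suc n)) v w"
          by (intro mass_between_mono un hit_prob_Suc_mono A)
        also have "\<dots> = expected_mass (?h n) (v + a) + mass_between (?h n) (v + a) (w + a) - expected_mass (?h n) (w + a)"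
          using v w by (intro mass_between_transport un) auto
        finally have "mass_between (?h n) v w \<le> expected_mass (?h n) (v + a) + mass_between (?h n) (v + a) (w + a)"
          using expected_mass_nonneg[OF un, of n "w + a"] by simp
        moreover have "mass_between (?h n) v w + mass_between (?h n) w (w + a) = mass_between (?h n) v (v + a) + mass_between (?h n) (v + a) (w + a)"
          using v w a by (simp add: mass_between_add[OF un])
        moreover have "mass_between (?h n) w (w + a) \<le> ?h n w * (w + a - w)"
          using a by (intro mass_between_le un) (auto intro: antimonoD[OF hit_prob_antimono])
        ultimately show ?thesis by (simp add: mult.commute)
      qed
      then have "mass_between (?h n) v (v + a) - expected_mass (?h n) (v + a) \<le> a * 0"
        by (intro tendsto_lowerbound[OF tendsto_mult[OF tendsto_const hit_prob_tendsto_0[of a n]]])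
           (auto intro: eventually_mono[OF eventually_ge_at_top[of v]])
      moreover have "?h n (v + a) * (v + a - v) \<le> mass_between (?h n) v (v + a)"
        using a by (intro mass_between_ge un) (auto intro: antimonoD[OF hit_prob_antimono])
      moreover have "expected_mass (?h n) (v + a) \<le> expected_mass p (v + a)"
        unfolding p_def by (intro expected_mass_mono un unit_valued_hit_prob_limit hit_prob_le_limit A)
      ultimately show ?thesis by (simp add: mult.commute)
    qed
    then show ?thesis
      unfolding p_def by (intro LIMSEQ_le_const2[OF tendsto_mult[OF tendsto_const hit_prob_LIMSEQ[OF A]]]) auto
  qed
  show "a * p (u + a) \<le> expected_mass p (u + a)" using lower u by simp
  have bdd: "bdd_below (range p)" by (rule bdd_belowI[of _ 0]) (auto simp: unit_valuedD[OF up])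
  define L where "L = (INF x. p x)"
  have L: "(p \<longlongrightarrow> L) at_top"
  proof (rule decreasing_tendsto)
    show "\<forall>\<^sub>F x in at_top. L \<le> p x" unfolding L_def by (intro always_eventually allI cINF_lower bdd) auto
    fix y assume "L < y"
    then obtain x0 where "p x0 < y" unfolding L_def using bdd by (subst (asm) cINF_less_iff) auto
    then show "\<forall>\<^sub>F x in at_top. p x < y"
      using antimonoD[OF am] by (intro eventually_mono[OF eventually_ge_at_top[of x0]]) (auto intro: le_less_trans)
  qed
  have shift: "filterlim (\<lambda>v. v + a) at_top at_top"
    using filterlim_tendsto_add_at_top[OF tendsto_const[of a] filterlim_ident] by (simp add: add.commute)
  have "a * L \<le> L * (LINT s|\<nu>. s)"
  proof (rule tendsto_le)
    show "((\<lambda>v. LINT s|\<nu>. \<bar>s\<bar> * p ((v + a) - s)) \<longlongrightarrow> L * (LINT s|\<nu>. s)) at_top"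
      by (rule filterlim_compose[OF expected_mass_tendsto(1)[OF up am L] shift])
    show "((\<lambda>v. a * p (v + a)) \<longlongrightarrow> a * L) at_top"
      by (intro tendsto_mult tendsto_const filterlim_compose[OF L shift])
    show "\<forall>\<^sub>F v in at_top. a * p (v + a) \<le> (LINT s|\<nu>. \<bar>s\<bar> * p ((v + a) - s))"
      using eventually_ge_at_top[of 0]
      by eventually_elim (use lower expected_mass_tendsto(2)[OF up am L] order_trans in blast)
  qed simp
  then have "L \<le> 0" using a by (metis mult.commute mult_le_cancel_left not_le)
  moreover have "0 \<le> L" by (rule tendsto_lowerbound[OF L]) (auto simp: unit_valuedD[OF up])
  ultimately have L0: "L = 0" by simp
  have "expected_mass p (u + a) \<le> mass_between p u (u + a)"
  proof (rule tendsto_lowerbound)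
    have "((\<lambda>v. mass_between p u (u + a) + (LINT s|\<nu>. \<bar>s\<bar> * p ((v + a) - s))) \<longlongrightarrow> mass_between p u (u + a) + 0 * (LINT s|\<nu>. s)) at_top"
      using L by (intro tendsto_add tendsto_const filterlim_compose[OF expected_mass_tendsto(1)[OF up am] shift]) (simp add: L0)
    then show "((\<lambda>v. mass_between p u (u + a) + (LINT s|\<nu>. \<bar>s\<bar> * p ((v + a) - s))) \<longlongrightarrow> mass_between p u (u + a)) at_top"
      by simp
    show "\<forall>\<^sub>F v in at_top. expected_mass p (u + a) \<le> mass_between p u (u + a) + (LINT s|\<nu>. \<bar>s\<bar> * p ((v + a) - s))"
      using eventually_ge_at_top[of u]
    proof eventually_elim
      case (elim v)
      have "mass_between p u v = expected_mass p (u + a) + mass_between p (u + a) (v + a) - expected_mass p (v + a)"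
        using u elim by (intro mass_between_transport up) (auto simp: p_def intro: hit_prob_limit_harmonic[OF A])
      moreover have "mass_between p u v + mass_between p v (v + a) = mass_between p u (u + a) + mass_between p (u + a) (v + a)"
        using u elim a by (simp add: mass_between_add[OF up])
      ultimately show ?case
        using expected_mass_tendsto(2)[OF up am L, of "v + a"] mass_between_nonneg[OF up, of v "v + a"] by simp
    qed
  qed simp
  also have "\<dots> \<le> p u * (u + a - u)"
    using a by (intro mass_between_le up) (auto intro: antimonoD[OF am])
  finally show "expected_mass p (u + a) \<le> a * p u" by (simp add: mult.commute)
qed

text \<open>Run the walk from u and from u + R + K with the same steps; p u - p (u + R + K) is the
  probability that only the lower one is ruined. When the lower one lands in [-R, 0), the upper one
  is at K or above and survives with probability at least 1 - p K. The induction replaces this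
  coupling by the one-step equation, which holds for p at both levels when u >= 0.\<close>

theorem hit_prob_small_overshoot:
  fixes a R K u :: real
  assumes R: "0 \<le> R" "0 \<le> K"
  defines "p \<equiv> hit_prob_limit \<nu> a {..<0}"
  shows "(1 - p K) * hit_prob \<nu> a {-R..<0} n u \<le> p u - p (u + R + K)"
proof -
  have A: "{..<0::real} \<in> sets borel" "{..<0::real} \<subseteq> {..<0}" by auto
  have B: "{-R..<0} \<in> sets borel" by auto
  note up = unit_valued_hit_prob_limit[OF A, of a, folded p_def]
  have am: "antimono p" unfolding p_def by (rule hit_prob_limit_antimono)
  have neg: "(1 - p K) * indicator {-R..<0} u \<le> p u - p (u + R + K)" for u
  proof (cases "u \<in> {-R..<0}")
    case True
    then have "p (u + R + K) \<le> p K" by (intro antimonoD[OF am]) auto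
    then show ?thesis using True by (auto simp: p_def hit_prob_limit_neg)
  next
    case False
    then show ?thesis using antimonoD[OF am, of u "u + R + K"] R by auto
  qed
  show ?thesis
  proof (induction n arbitrary: u)
    case 0
    show ?case using neg by simp
  next
    case (Suc n)
    show ?case
    proof (cases "u < 0")
      case True
      then show ?thesis using neg by simp
    next
      case False
      have "(1 - p K) * hit_prob \<nu> a {-R..<0} (Suc n) u = (LINT s|\<nu>. (1 - p K) * hit_prob \<nu> a {-R..<0} n (u + a - s))"
        using False by simp
      also have "\<dots> \<le> (LINT s|\<nu>. p (u + a - s) - p ((u + R + K) + a - s))"
        using Suc[of "u + a - s" for s]
        by (intro integral_mono Bochner_Integration.integrable_diff integrable_mult_right integrable_unit_valued_shift
            up unit_valued_hit_prob B) (simp add: algebra_simps)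
      also have "\<dots> = p u - p (u + R + K)"
        using False R hit_prob_limit_harmonic[OF A, of u a] hit_prob_limit_harmonic[OF A, of "u + R + K" a]
        by (subst Bochner_Integration.integral_diff) (auto intro: integrable_unit_valued_shift up simp: p_def[symmetric])
      finally show ?thesis .
    qed
  qed
qed

end

section \<open>Compound Poisson steps\<close>

(* The event of hit_prob for blocks of claims: ns k is the number of claims in period k. *)
primrec hits :: "real \<Rightarrow> real set \<Rightarrow> nat \<Rightarrow> real \<Rightarrow> (nat \<Rightarrow> nat) \<Rightarrow> (nat \<Rightarrow> real) \<Rightarrow> bool" where
  "hits a A 0 u ns x \<longleftrightarrow> u \<in> A"
| "hits a A (Suc n) u ns x \<longleftrightarrow>
     (if u < 0 then u \<in> A
      else hits a A n (u + a - (\<Sum>i<ns 0. x i)) (\<lambda>k. ns (Suc k)) (\<lambda>i. x (i + ns 0)))"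

lemma sum_lessThan_add:
  fixes x :: "nat \<Rightarrow> real"
  shows "(\<Sum>i<m + n. x i) = (\<Sum>i<m. x i) + (\<Sum>i<n. x (i + m))"
  by (induction n) (auto simp: add.commute)

text \<open>The path form that the surplus on a grid can be matched with.
  \<open>A \<subseteq> {..<0}\<close> ensures that a nonnegative start is not yet a hit, as the
  recursion presumes.\<close>

lemma hits_iff:
  assumes A: "A \<subseteq> {..<0}"
  shows "hits a A n u ns x \<longleftrightarrow>
    (\<exists>k\<le>n. (\<forall>j<k. 0 \<le> u + a * real j - (\<Sum>i<(\<Sum>m<j. ns m). x i)) \<and>
       u + a * real k - (\<Sum>i<(\<Sum>m<k. ns m). x i) \<in> A)"
proof (induction n arbitrary: u ns x)
  case 0
  show ?case by simp
next
  case (Suc n)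
  define V where "V j = u + a * real j - (\<Sum>i<(\<Sum>m<j. ns m). x i)" for j
  define V' where "V' j = (u + a - (\<Sum>i<ns 0. x i)) + a * real j - (\<Sum>i<(\<Sum>m<j. ns (Suc m)). x (i + ns 0))" for j
  have VS: "V (Suc j) = V' j" for j
  proof -
    have "(\<Sum>m<Suc j. ns m) = ns 0 + (\<Sum>m<j. ns (Suc m))" by (rule sum.lessThan_Suc_shift)
    then show ?thesis by (simp add: V_def V'_def sum_lessThan_add algebra_simps)
  qed
  have V0: "V 0 = u" by (simp add: V_def)
  have ex: "(\<exists>k\<le>Suc n. (\<forall>j<k. 0 \<le> V j) \<and> V k \<in> A) \<longleftrightarrow>
      V 0 \<in> A \<or> (0 \<le> V 0 \<and> (\<exists>k\<le>n. (\<forall>j<k. 0 \<le> V (Suc j)) \<and> V (Suc k) \<in> A))"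
    (is "?L \<longleftrightarrow> ?R")
  proof
    assume ?L
    then obtain k where k: "k \<le> Suc n" "\<forall>j<k. 0 \<le> V j" "V k \<in> A" by auto
    show ?R
    proof (cases k)
      case 0
      then show ?thesis using k by simp
    next
      case (Suc k')
      then show ?thesis using k by auto
    qed
  next
    assume ?R
    then show ?L
    proof
      assume "V 0 \<in> A"
      then show ?L by (intro exI[of _ 0]) auto
    next
      assume R: "0 \<le> V 0 \<and> (\<exists>k\<le>n. (\<forall>j<k. 0 \<le> V (Suc j)) \<and> V (Suc k) \<in> A)"
      then obtain k where "k \<le> n" "\<forall>j<k. 0 \<le> V (Suc j)" "V (Suc k) \<in> A" by auto
      then show ?L using R by (intro exI[of _ "Suc k"]) (auto simp: less_Suc_eq_0_disj)
    qed
  qed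
  have "hits a A (Suc n) u ns x \<longleftrightarrow> (if u < 0 then u \<in> A else \<exists>k\<le>n. (\<forall>j<k. 0 \<le> V' j) \<and> V' k \<in> A)"
    by (simp only: hits.simps Suc.IH V'_def)
  also have "\<dots> \<longleftrightarrow> (\<exists>k\<le>Suc n. (\<forall>j<k. 0 \<le> V j) \<and> V k \<in> A)"
    unfolding ex VS V0 using A by auto
  finally show ?case by (simp add: V_def)
qed

lemma measurable_random_sum:
  assumes [measurable]: "g \<in> measurable M (count_space UNIV)"
    and h: "h \<in> measurable M (PiM UNIV (\<lambda>_::nat. borel))"
  shows "(\<lambda>z. \<Sum>i<(g z::nat). h z i :: real) \<in> borel_measurable M"
proof (rule measurable_compose_countable[OF _ assms(1)])
  fix j
  have "(\<lambda>z. h z i) \<in> borel_measurable M" for i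
    using measurable_compose[OF h measurable_component_singleton[of i UNIV]] by simp
  then show "(\<lambda>z. \<Sum>i<j. h z i) \<in> borel_measurable M" by (rule borel_measurable_sum)
qed

lemma measurable_random_shift:
  assumes [measurable]: "g \<in> measurable M (count_space UNIV)"
    and h: "h \<in> measurable M (PiM UNIV (\<lambda>_::nat. borel :: real measure))"
  shows "(\<lambda>z i. h z (i + (g z::nat))) \<in> measurable M (PiM UNIV (\<lambda>_::nat. borel :: real measure))"
proof (rule measurable_PiM_single')
  fix i :: nat
  have "(\<lambda>z. h z i) \<in> borel_measurable M" for i
    using measurable_compose[OF h measurable_component_singleton[of i UNIV]] by simp
  then show "(\<lambda>z. h z (i + g z)) \<in> borel_measurable M"
    by (rule measurable_compose_countable[OF _ assms(1)])
qed auto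

lemma measurable_hits:
  assumes [measurable]: "A \<in> sets borel"
    and "f \<in> borel_measurable M" "g \<in> measurable M (PiM UNIV (\<lambda>_::nat. count_space UNIV))"
      "h \<in> measurable M (PiM UNIV (\<lambda>_::nat. borel))"
  shows "Measurable.pred M (\<lambda>z. hits a A n (f z) (g z) (h z))"
  using assms(2-)
proof (induction n arbitrary: f g h)
  case 0
  note [measurable] = 0
  show ?case by simp
next
  case (Suc n)
  note [measurable] = Suc.prems(1)
  have g: "(\<lambda>z. g z k) \<in> measurable M (count_space UNIV)" for k
    using measurable_compose[OF Suc.prems(2) measurable_component_singleton[of k UNIV]] by simp
  note [measurable] = measurable_random_sum[OF g Suc.prems(3)]
  have "(\<lambda>z k. g z (Suc k)) \<in> measurable M (PiM UNIV (\<lambda>_::nat. count_space UNIV))"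
    by (rule measurable_PiM_single') (auto intro: g)
  then have [measurable]: "Measurable.pred M (\<lambda>z. hits a A n (f z + a - (\<Sum>i<g z 0. h z i))
      (\<lambda>k. g z (Suc k)) (\<lambda>i. h z (i + g z 0)))"
    by (intro Suc.IH measurable_random_shift g Suc.prems) measurable
  show ?case by simp
qed

text \<open>An i.i.d. sequence keeps its law when everything from position j on is replaced by an
  independent copy: independence of past and future at j, expressed through integrals.\<close>

lemma (in sequence_space) nn_integral_comb_seq:
  assumes [measurable]: "f \<in> borel_measurable S"
  shows "(\<integral>\<^sup>+x. f x \<partial>S) = (\<integral>\<^sup>+x. \<integral>\<^sup>+x'. f (comb_seq j x x') \<partial>S \<partial>S)"
proof -
  have sf: "sigma_finite_measure S" by (rule prob_space_imp_sigma_finite[OF prob_space_axioms])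
  have m: "(\<lambda>(x, x'). comb_seq j x x') \<in> measurable (S \<Otimes>\<^sub>M S) S"
    by measurable
  have "(\<integral>\<^sup>+x. f x \<partial>S) = (\<integral>\<^sup>+x. f x \<partial>distr (S \<Otimes>\<^sub>M S) S (\<lambda>(x, x'). comb_seq j x x'))"
    using PiM_comb_seq[of j] by simp
  also have "\<dots> = (\<integral>\<^sup>+z. f (case z of (x, x') \<Rightarrow> comb_seq j x x') \<partial>(S \<Otimes>\<^sub>M S))"
    by (subst nn_integral_distr[OF m]) simp_all
  also have "\<dots> = (\<integral>\<^sup>+x. \<integral>\<^sup>+x'. f (case (x, x') of (x, x') \<Rightarrow> comb_seq j x x') \<partial>S \<partial>S)"
    by (rule sigma_finite_measure.nn_integral_fst[OF sf, symmetric]) (rule measurable_compose[OF m assms])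
  finally show ?thesis by simp
qed

section \<open>Random sums: the total claim of one period\<close>

locale compound_step = nonneg_step D for D :: "real measure" +
  fixes P1 :: "nat measure"
  assumes P1: "prob_space P1" and sets_P1: "sets P1 = UNIV"
begin

definition PN :: "(nat \<Rightarrow> nat) measure" where "PN = PiM UNIV (\<lambda>_. P1)"
definition PX :: "(nat \<Rightarrow> real) measure" where "PX = PiM UNIV (\<lambda>_. D)"
definition compound :: "real measure" where
  "compound = distr (P1 \<Otimes>\<^sub>M PX) borel (\<lambda>(j, x). \<Sum>i<j. x i)"

lemma sets_PN [measurable_cong]: "sets PN = sets (PiM UNIV (\<lambda>_. count_space UNIV))"
  unfolding PN_def by (rule sets_PiM_cong) (simp_all add: sets_P1)

lemma sets_PX [measurable_cong]: "sets PX = sets (PiM UNIV (\<lambda>_. borel))"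
  unfolding PX_def by (rule sets_PiM_cong) simp_all

lemma sets_P1' [measurable_cong]: "sets P1 = sets (count_space UNIV)"
  by (simp add: sets_P1)

sublocale P1: prob_space P1 by (rule P1)
sublocale SN: sequence_space P1 ..
sublocale SX: sequence_space D ..
sublocale PN: prob_space PN unfolding PN_def by (rule SN.prob_space_axioms)
sublocale PX: prob_space PX unfolding PX_def by (rule SX.prob_space_axioms)
sublocale P1PX: pair_prob_space P1 PX ..
sublocale PNPX: pair_prob_space PN PX ..

lemma measurable_sum_PX [measurable]: "(\<lambda>(j, x). \<Sum>i<j. x i) \<in> borel_measurable (P1 \<Otimes>\<^sub>M PX)"
  unfolding case_prod_beta by (rule measurable_random_sum) measurable

sublocale compound: real_distribution compound
proof -
  interpret C: prob_space compound
    unfolding compound_def by (rule P1PX.prob_space_distr[OF measurable_sum_PX])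
  show "real_distribution compound"
    by unfold_locales (simp add: compound_def)
qed

lemma nn_integral_PN_iter:
  assumes [measurable]: "f \<in> borel_measurable PN"
  shows "(\<integral>\<^sup>+ns. f ns \<partial>PN) = (\<integral>\<^sup>+j. \<integral>\<^sup>+ns. f (case_nat j ns) \<partial>PN \<partial>P1)"
proof -
  have m: "(\<lambda>(s, \<omega>). case_nat s \<omega>) \<in> measurable (P1 \<Otimes>\<^sub>M PN) PN"
    unfolding PN_def by measurable
  have "(\<integral>\<^sup>+ns. f ns \<partial>PN) = (\<integral>\<^sup>+ns. f ns \<partial>distr (P1 \<Otimes>\<^sub>M PN) PN (\<lambda>(s, \<omega>). case_nat s \<omega>))"
    using SN.PiM_iter by (simp add: PN_def)
  also have "\<dots> = (\<integral>\<^sup>+z. f (case z of (s, \<omega>) \<Rightarrow> case_nat s \<omega>) \<partial>(P1 \<Otimes>\<^sub>M PN))"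
    by (subst nn_integral_distr[OF m]) simp_all
  also have "\<dots> = (\<integral>\<^sup>+j. \<integral>\<^sup>+ns. f (case (j, ns) of (s, \<omega>) \<Rightarrow> case_nat s \<omega>) \<partial>PN \<partial>P1)"
    by (rule PN.nn_integral_fst[symmetric]) (rule measurable_compose[OF m assms])
  finally show ?thesis by simp
qed

lemma nn_integral_PX_comb:
  "f \<in> borel_measurable PX \<Longrightarrow> (\<integral>\<^sup>+x. f x \<partial>PX) = (\<integral>\<^sup>+x. \<integral>\<^sup>+x'. f (comb_seq j x x') \<partial>PX \<partial>PX)"
  unfolding PX_def by (rule SX.nn_integral_comb_seq)

lemma nn_integral_PN_comb:
  "f \<in> borel_measurable PN \<Longrightarrow> (\<integral>\<^sup>+x. f x \<partial>PN) = (\<integral>\<^sup>+x. \<integral>\<^sup>+x'. f (comb_seq j x x') \<partial>PN \<partial>PN)"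
  unfolding PN_def by (rule SN.nn_integral_comb_seq)

lemma nn_integral_compound:
  assumes [measurable]: "f \<in> borel_measurable borel"
  shows "(\<integral>\<^sup>+s. f s \<partial>compound) = (\<integral>\<^sup>+j. \<integral>\<^sup>+x. f (\<Sum>i<j. x i) \<partial>PX \<partial>P1)"
proof -
  have "(\<integral>\<^sup>+s. f s \<partial>compound) = (\<integral>\<^sup>+z. f (case z of (j, x) \<Rightarrow> \<Sum>i<j. x i) \<partial>(P1 \<Otimes>\<^sub>M PX))"
    unfolding compound_def by (subst nn_integral_distr[OF measurable_sum_PX]) simp_all
  also have "\<dots> = (\<integral>\<^sup>+j. \<integral>\<^sup>+x. f (case (j, x) of (j, x) \<Rightarrow> \<Sum>i<j. x i) \<partial>PX \<partial>P1)"
    by (rule PX.nn_integral_fst[symmetric]) (rule measurable_compose[OF measurable_sum_PX assms])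
  finally show ?thesis by simp
qed

lemma nn_integral_component:
  assumes [measurable]: "f \<in> borel_measurable borel"
  shows "(\<integral>\<^sup>+x. f (x i) \<partial>PX) = (\<integral>\<^sup>+s. f s \<partial>D)"
proof -
  have "D = distr PX D (\<lambda>x. x i)"
    unfolding PX_def by (rule SX.PiM_component[symmetric]) simp
  then have "(\<integral>\<^sup>+s. f s \<partial>D) = (\<integral>\<^sup>+s. f s \<partial>distr PX D (\<lambda>x. x i))" by simp
  also have "\<dots> = (\<integral>\<^sup>+x. f (x i) \<partial>PX)"
    unfolding PX_def by (subst nn_integral_distr) measurable
  finally show ?thesis by simp
qed

lemma AE_PX_nonneg: "AE x in PX. \<forall>i. 0 \<le> x i"
proof -
  have "AE x in PX. 0 \<le> x i" for i
  proof -
    have eq: "distr PX D (\<lambda>x. x i) = D"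
      unfolding PX_def by (rule SX.PiM_component) simp
    have "AE s in distr PX D (\<lambda>x. x i). 0 \<le> s" unfolding eq by (rule AE_nonneg)
    then show ?thesis
      by (subst (asm) AE_distr_iff) (auto simp: PX_def)
  qed
  then show ?thesis by (simp add: AE_all_countable)
qed

text \<open>For fixed claims, splice the counts at k: E reads only the counts before k, while the
  constraint reads the first entry of the independent copy. E may look arbitrarily far ahead in the
  claims.\<close>

lemma emeasure_next_count:
  assumes E: "Measurable.pred (PiM UNIV (\<lambda>_::nat. count_space UNIV) \<Otimes>\<^sub>M PiM UNIV (\<lambda>_::nat. borel)) (\<lambda>z. E (fst z) (snd z))"
    and past: "\<And>ns ns' x. (\<And>m. m < k \<Longrightarrow> ns m = ns' m) \<Longrightarrow> E ns x = E ns' x"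
  shows "emeasure (PN \<Otimes>\<^sub>M PX) {z\<in>space (PN \<Otimes>\<^sub>M PX). E (fst z) (snd z) \<and> fst z k \<in> C}
    = emeasure (PN \<Otimes>\<^sub>M PX) {z\<in>space (PN \<Otimes>\<^sub>M PX). E (fst z) (snd z)} * emeasure P1 C"
proof -
  have sets_eq: "sets (PN \<Otimes>\<^sub>M PX) = sets (PiM UNIV (\<lambda>_::nat. count_space (UNIV::nat set)) \<Otimes>\<^sub>M PiM UNIV (\<lambda>_::nat. borel :: real measure))"
    by (intro sets_pair_measure_cong sets_PN sets_PX)
  have E': "Measurable.pred (PN \<Otimes>\<^sub>M PX) (\<lambda>z. E (fst z) (snd z))"
    using E by (simp only: measurable_cong_sets[OF sets_eq refl])
  define I where "I ns x = (if E ns x then 1 else 0 :: ennreal)" for ns x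
  have [measurable]: "(\<lambda>z. I (fst z) (snd z)) \<in> borel_measurable (PN \<Otimes>\<^sub>M PX)"
    unfolding I_def using E' by measurable
  have Cm [measurable]: "(\<lambda>z. indicator C (fst z k) :: ennreal) \<in> borel_measurable (PN \<Otimes>\<^sub>M PX)"
    by measurable
  have gen: "emeasure (PN \<Otimes>\<^sub>M PX) {z\<in>space (PN \<Otimes>\<^sub>M PX). E (fst z) (snd z) \<and> fst z k \<in> C'}
      = (\<integral>\<^sup>+x. \<integral>\<^sup>+ns. I ns x * indicator C' (ns k) \<partial>PN \<partial>PX)" for C'
  proof -
    let ?S = "{z\<in>space (PN \<Otimes>\<^sub>M PX). E (fst z) (snd z) \<and> fst z k \<in> C'}"
    have "?S \<in> sets (PN \<Otimes>\<^sub>M PX)" using E' by measurable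
    then have "emeasure (PN \<Otimes>\<^sub>M PX) ?S = (\<integral>\<^sup>+z. indicator ?S z \<partial>(PN \<Otimes>\<^sub>M PX))" by simp
    also have "\<dots> = (\<integral>\<^sup>+z. I (fst z) (snd z) * indicator C' (fst z k) \<partial>(PN \<Otimes>\<^sub>M PX))"
      by (intro nn_integral_cong) (auto simp: I_def indicator_def)
    also have "\<dots> = (\<integral>\<^sup>+x. \<integral>\<^sup>+ns. I ns x * indicator C' (ns k) \<partial>PN \<partial>PX)"
      using PNPX.nn_integral_snd[of "\<lambda>z. I (fst z) (snd z) * indicator C' (fst z k)"] by simp
    finally show ?thesis .
  qed
  have inner: "(\<integral>\<^sup>+ns. I ns x * indicator C (ns k) \<partial>PN) = (\<integral>\<^sup>+ns. I ns x \<partial>PN) * emeasure P1 C" if x: "x \<in> space PX" for x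
  proof -
    have [measurable]: "(\<lambda>ns. I ns x) \<in> borel_measurable PN"
      using measurable_compose[OF measurable_Pair2'[OF x], of "\<lambda>z. I (fst z) (snd z)" PN borel] by simp
    have "(\<integral>\<^sup>+ns. I ns x * indicator C (ns k) \<partial>PN)
        = (\<integral>\<^sup>+ns. \<integral>\<^sup>+ns'. I (comb_seq k ns ns') x * indicator C (comb_seq k ns ns' k) \<partial>PN \<partial>PN)"
      by (rule nn_integral_PN_comb) measurable
    also have "\<dots> = (\<integral>\<^sup>+ns. \<integral>\<^sup>+ns'. I ns x * indicator C (ns' 0) \<partial>PN \<partial>PN)"
    proof (intro nn_integral_cong arg_cong2[where f="(*)"])
      fix ns ns' :: "nat \<Rightarrow> nat"
      show "I (comb_seq k ns ns') x = I ns x"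
        unfolding I_def using past[of "comb_seq k ns ns'" ns x] by (simp add: comb_seq_less)
      show "indicator C (comb_seq k ns ns' k) = (indicator C (ns' 0) :: ennreal)"
        using comb_seq_add[of k ns ns' 0] by simp
    qed
    also have "\<dots> = (\<integral>\<^sup>+ns. I ns x * emeasure P1 C \<partial>PN)"
    proof (rule nn_integral_cong)
      fix ns
      have eq: "P1 = distr PN P1 (\<lambda>ns. ns 0)"
        unfolding PN_def by (rule SN.PiM_component[symmetric]) simp
      have "emeasure P1 C = (\<integral>\<^sup>+j. indicator C j \<partial>P1)" by (simp add: sets_P1)
      also have "\<dots> = (\<integral>\<^sup>+j. indicator C j \<partial>distr PN P1 (\<lambda>ns. ns 0))"
        by (rule arg_cong[OF eq])
      also have "\<dots> = (\<integral>\<^sup>+ns'. indicator C (ns' 0) \<partial>PN)"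
        unfolding PN_def by (subst nn_integral_distr) measurable
      finally show "(\<integral>\<^sup>+ns'. I ns x * indicator C (ns' 0) \<partial>PN) = I ns x * emeasure P1 C"
        by (subst nn_integral_cmult) simp_all
    qed
    also have "\<dots> = (\<integral>\<^sup>+ns. I ns x \<partial>PN) * emeasure P1 C"
      by (rule nn_integral_multc) measurable
    finally show ?thesis .
  qed
  have "emeasure (PN \<Otimes>\<^sub>M PX) {z\<in>space (PN \<Otimes>\<^sub>M PX). E (fst z) (snd z) \<and> fst z k \<in> C}
      = (\<integral>\<^sup>+x. (\<integral>\<^sup>+ns. I ns x \<partial>PN) * emeasure P1 C \<partial>PX)"
    unfolding gen by (intro nn_integral_cong inner)
  also have "\<dots> = (\<integral>\<^sup>+x. \<integral>\<^sup>+ns. I ns x \<partial>PN \<partial>PX) * emeasure P1 C"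
  proof (rule nn_integral_multc)
    have "(\<lambda>z. I (snd z) (fst z)) \<in> borel_measurable (PX \<Otimes>\<^sub>M PN)"
      using measurable_compose[OF measurable_pair_swap', of "\<lambda>z. I (fst z) (snd z)" PN PX borel]
      by (simp add: case_prod_beta)
    then show "(\<lambda>x. \<integral>\<^sup>+ns. I ns x \<partial>PN) \<in> borel_measurable PX"
      by (intro PN.borel_measurable_nn_integral) (simp add: case_prod_beta)
  qed
  also have "(\<integral>\<^sup>+x. \<integral>\<^sup>+ns. I ns x \<partial>PN \<partial>PX) = emeasure (PN \<Otimes>\<^sub>M PX) {z\<in>space (PN \<Otimes>\<^sub>M PX). E (fst z) (snd z)}"
    using gen[of UNIV] by simp
  finally show ?thesis .
qed

text \<open>Induction on the horizon after splitting off the count j of the first period. The claims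
  before position j make up the first step, and splicing the claim sequence at j makes the later
  ones independent of that step.\<close>

theorem emeasure_hits:
  assumes A: "A \<in> sets borel"
  shows "emeasure (PN \<Otimes>\<^sub>M PX) {z\<in>space (PN \<Otimes>\<^sub>M PX). hits a A n u (fst z) (snd z)}
    = ennreal (hit_prob compound a A n u)"
proof -
  define I where "I n u ns x = (if hits a A n u ns x then 1 else 0::ennreal)" for n u ns x
  have I_meas: "(\<lambda>z. I n (f z) (g z) (h z)) \<in> borel_measurable M"
    if "f \<in> borel_measurable M" "g \<in> measurable M (PiM UNIV (\<lambda>_::nat. count_space UNIV))"
      "h \<in> measurable M (PiM UNIV (\<lambda>_::nat. borel))" for n f g h and M :: "'z measure"
    using measurable_hits[OF A that, of a n] unfolding I_def by measurable
  have PNm: "measurable M PN = measurable M (PiM UNIV (\<lambda>_::nat. count_space UNIV))" for M :: "'z measure"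
    by (rule measurable_cong_sets[OF refl sets_PN])
  have PXm: "measurable M PX = measurable M (PiM UNIV (\<lambda>_::nat. borel))" for M :: "'z measure"
    by (rule measurable_cong_sets[OF refl sets_PX])
  have main: "(\<integral>\<^sup>+ns. \<integral>\<^sup>+x. I n u ns x \<partial>PX \<partial>PN) = ennreal (hit_prob compound a A n u)" for n u
  proof (induction n arbitrary: u)
    case 0
    then show ?case
      by (simp add: I_def PX.emeasure_space_1 PN.emeasure_space_1 indicator_def)
  next
    case (Suc n)
    show ?case
    proof (cases "u < 0")
      case True
      then show ?thesis
        by (simp add: I_def PX.emeasure_space_1 PN.emeasure_space_1 indicator_def)
    next
      case False
      let ?u = "\<lambda>j x. u + a - (\<Sum>i<j. x i) :: real"
      have "(\<integral>\<^sup>+ns. \<integral>\<^sup>+x. I (Suc n) u ns x \<partial>PX \<partial>PN)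
          = (\<integral>\<^sup>+ns. \<integral>\<^sup>+x. I n (?u (ns 0) x) (\<lambda>k. ns (Suc k)) (\<lambda>i. x (i + ns 0)) \<partial>PX \<partial>PN)"
        using False by (simp add: I_def)
      also have "\<dots> = (\<integral>\<^sup>+j. \<integral>\<^sup>+ns. \<integral>\<^sup>+x. I n (?u j x) ns (\<lambda>i. x (i + j)) \<partial>PX \<partial>PN \<partial>P1)"
      proof (subst nn_integral_PN_iter)
        have [measurable]: "(\<lambda>z. I n (?u (fst z 0) (snd z)) (\<lambda>k. fst z (Suc k)) (\<lambda>i. snd z (i + fst z 0))) \<in> borel_measurable (PN \<Otimes>\<^sub>M PX)"
        proof (rule I_meas)
          have f: "(\<lambda>z. fst z k) \<in> measurable (PN \<Otimes>\<^sub>M PX) (count_space UNIV)" for k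
            by measurable
          have s: "snd \<in> measurable (PN \<Otimes>\<^sub>M PX) (PiM UNIV (\<lambda>_. borel))"
            using measurable_snd[of PN PX] by (simp add: PXm)
          note [measurable] = measurable_random_sum[OF f s]
          show "(\<lambda>z. ?u (fst z 0) (snd z)) \<in> borel_measurable (PN \<Otimes>\<^sub>M PX)" by measurable
          show "(\<lambda>z k. fst z (Suc k)) \<in> measurable (PN \<Otimes>\<^sub>M PX) (PiM UNIV (\<lambda>_. count_space UNIV))"
            by (rule measurable_PiM_single') (auto intro: f)
          show "(\<lambda>z i. snd z (i + fst z 0)) \<in> measurable (PN \<Otimes>\<^sub>M PX) (PiM UNIV (\<lambda>_. borel))"
            by (rule measurable_random_shift[OF f s])
        qed
        show "(\<lambda>ns. \<integral>\<^sup>+x. I n (?u (ns 0) x) (\<lambda>k. ns (Suc k)) (\<lambda>i. x (i + ns 0)) \<partial>PX) \<in> borel_measurable PN"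
          by (rule PX.borel_measurable_nn_integral) (simp add: case_prod_beta)
      qed simp
      also have "\<dots> = (\<integral>\<^sup>+j. \<integral>\<^sup>+x. ennreal (hit_prob compound a A n (?u j x)) \<partial>PX \<partial>P1)"
      proof (rule nn_integral_cong)
        fix j
        have m: "(\<lambda>(ns, x, x'). I n (?u j x) ns x') \<in> borel_measurable (PN \<Otimes>\<^sub>M PX \<Otimes>\<^sub>M PX)"
          unfolding case_prod_beta
        proof (rule I_meas)
          have s: "(\<lambda>z. fst (snd z)) \<in> measurable (PN \<Otimes>\<^sub>M PX \<Otimes>\<^sub>M PX) (PiM UNIV (\<lambda>_. borel))"
            unfolding PXm[symmetric] by measurable
          note [measurable] = measurable_random_sum[OF _ s, of "\<lambda>_. j"]
          show "(\<lambda>z. ?u j (fst (snd z))) \<in> borel_measurable (PN \<Otimes>\<^sub>M PX \<Otimes>\<^sub>M PX)" by measurable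
          show "fst \<in> measurable (PN \<Otimes>\<^sub>M PX \<Otimes>\<^sub>M PX) (PiM UNIV (\<lambda>_. count_space UNIV))"
            unfolding PNm[symmetric] by measurable
          show "(\<lambda>z. snd (snd z)) \<in> measurable (PN \<Otimes>\<^sub>M PX \<Otimes>\<^sub>M PX) (PiM UNIV (\<lambda>_. borel))"
            unfolding PXm[symmetric] by measurable
        qed
        have m2: "(\<lambda>(ns, x). \<integral>\<^sup>+x'. I n (?u j x) ns x' \<partial>PX) \<in> borel_measurable (PN \<Otimes>\<^sub>M PX)"
          unfolding case_prod_beta
        proof (rule PX.borel_measurable_nn_integral)
          have "(\<lambda>z. (fst (fst z), snd (fst z), snd z)) \<in> measurable ((PN \<Otimes>\<^sub>M PX) \<Otimes>\<^sub>M PX) (PN \<Otimes>\<^sub>M PX \<Otimes>\<^sub>M PX)"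
            by measurable
          from measurable_compose[OF this m]
          show "(\<lambda>(z, x'). I n (?u j (snd z)) (fst z) x') \<in> borel_measurable ((PN \<Otimes>\<^sub>M PX) \<Otimes>\<^sub>M PX)"
            by (simp add: case_prod_beta)
        qed
        have "(\<integral>\<^sup>+ns. \<integral>\<^sup>+x. I n (?u j x) ns (\<lambda>i. x (i + j)) \<partial>PX \<partial>PN)
            = (\<integral>\<^sup>+ns. \<integral>\<^sup>+x. \<integral>\<^sup>+x'. I n (?u j x) ns x' \<partial>PX \<partial>PX \<partial>PN)"
        proof (rule nn_integral_cong)
          fix ns assume ns: "ns \<in> space PN"
          have "(\<lambda>x. I n (?u j x) ns (\<lambda>i. x (i + j))) \<in> borel_measurable PX"
          proof (rule I_meas)
            have id: "(\<lambda>x. x) \<in> measurable PX (PiM UNIV (\<lambda>_. borel))"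
              unfolding PXm[symmetric] by measurable
            note [measurable] = measurable_random_sum[OF _ id, of "\<lambda>_. j"]
            show "?u j \<in> borel_measurable PX" by measurable
            show "(\<lambda>x i. x (i + j)) \<in> measurable PX (PiM UNIV (\<lambda>_. borel))"
              using measurable_random_shift[OF _ id, of "\<lambda>_. j"] by simp
            show "(\<lambda>x. ns) \<in> measurable PX (PiM UNIV (\<lambda>_. count_space UNIV))"
              by (simp add: space_PiM)
          qed
          then show "(\<integral>\<^sup>+x. I n (?u j x) ns (\<lambda>i. x (i + j)) \<partial>PX)
            = (\<integral>\<^sup>+x. \<integral>\<^sup>+x'. I n (?u j x) ns x' \<partial>PX \<partial>PX)"
            by (subst nn_integral_PX_comb[where j=j]) (simp_all add: comb_seq_less comb_seq_add)
        qed
        also have "\<dots> = (\<integral>\<^sup>+x. \<integral>\<^sup>+ns. \<integral>\<^sup>+x'. I n (?u j x) ns x' \<partial>PX \<partial>PN \<partial>PX)"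
          by (rule PNPX.Fubini'[symmetric, OF m2])
        also have "\<dots> = (\<integral>\<^sup>+x. ennreal (hit_prob compound a A n (?u j x)) \<partial>PX)"
          by (simp add: Suc.IH)
        finally show "(\<integral>\<^sup>+ns. \<integral>\<^sup>+x. I n (?u j x) ns (\<lambda>i. x (i + j)) \<partial>PX \<partial>PN)
          = (\<integral>\<^sup>+x. ennreal (hit_prob compound a A n (?u j x)) \<partial>PX)" .
      qed
      also have "\<dots> = (\<integral>\<^sup>+s. ennreal (hit_prob compound a A n (u + a - s)) \<partial>compound)"
      proof -
        note [measurable] = compound.hit_prob_measurable[OF A]
        show ?thesis by (subst nn_integral_compound) simp_all
      qed
      also have "\<dots> = ennreal (LINT s|compound. hit_prob compound a A n (u + a - s))"
        by (intro nn_integral_eq_integral compound.integrable_bounded_shift[where B=1]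
            compound.hit_prob_measurable A AE_I2) (simp_all add: compound.hit_prob_bounds abs_le_iff)
      also have "\<dots> = ennreal (hit_prob compound a A (Suc n) u)"
        using False by simp
      finally show ?thesis .
    qed
  qed
  let ?E = "{z\<in>space (PN \<Otimes>\<^sub>M PX). hits a A n u (fst z) (snd z)}"
  have m: "(\<lambda>z. I n u (fst z) (snd z)) \<in> borel_measurable (PN \<Otimes>\<^sub>M PX)"
  proof (rule I_meas)
    show "fst \<in> measurable (PN \<Otimes>\<^sub>M PX) (PiM UNIV (\<lambda>_. count_space UNIV))"
      unfolding PNm[symmetric] by measurable
    show "snd \<in> measurable (PN \<Otimes>\<^sub>M PX) (PiM UNIV (\<lambda>_. borel))"
      unfolding PXm[symmetric] by measurable
  qed simp
  have E: "?E = {z\<in>space (PN \<Otimes>\<^sub>M PX). I n u (fst z) (snd z) = 1}"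
    by (auto simp: I_def)
  have "?E \<in> sets (PN \<Otimes>\<^sub>M PX)"
    unfolding E using m by measurable
  then have "emeasure (PN \<Otimes>\<^sub>M PX) ?E = (\<integral>\<^sup>+z. indicator ?E z \<partial>(PN \<Otimes>\<^sub>M PX))"
    by simp
  also have "\<dots> = (\<integral>\<^sup>+z. I n u (fst z) (snd z) \<partial>(PN \<Otimes>\<^sub>M PX))"
    by (intro nn_integral_cong) (auto simp: I_def indicator_def)
  also have "\<dots> = (\<integral>\<^sup>+ns. \<integral>\<^sup>+x. I n u ns x \<partial>PX \<partial>PN)"
    using PX.nn_integral_fst[OF m] by simp
  also have "\<dots> = ennreal (hit_prob compound a A n u)" by (rule main)
  finally show ?thesis .
qed

end

text \<open>At r = 0 this is the point mass at 0, since 0 ^ 0 = 1.\<close>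

definition poisson_law :: "real \<Rightarrow> nat measure" where
  "poisson_law r = density (count_space UNIV) (\<lambda>k. ennreal (exp (- r) * r ^ k / fact k))"

lemma sets_poisson_law: "sets (poisson_law r) = UNIV"
  by (simp add: poisson_law_def)

lemma emeasure_poisson_law: "0 \<le> r \<Longrightarrow> emeasure (poisson_law r) {k} = ennreal (exp (- r) * r ^ k / fact k)"
proof -
  have "emeasure (poisson_law r) {k} = (\<integral>\<^sup>+j. ennreal (exp (- r) * r ^ k / fact k) * indicator {k} j \<partial>count_space UNIV)"
    unfolding poisson_law_def by (subst emeasure_density) (auto intro!: nn_integral_cong split: split_indicator)
  also have "\<dots> = ennreal (exp (- r) * r ^ k / fact k)" by (subst nn_integral_cmult_indicator) auto
  finally show ?thesis .
qed

lemma prob_space_poisson_law: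
  assumes "0 \<le> r"
  shows "prob_space (poisson_law r)"
proof (rule prob_spaceI)
  have sm: "(\<lambda>k. exp (- r) * (r ^ k /\<^sub>R fact k)) sums (exp (- r) * exp r)"
    by (intro sums_mult exp_converges)
  have "emeasure (poisson_law r) (space (poisson_law r)) = (\<Sum>k. ennreal (exp (- r) * (r ^ k /\<^sub>R fact k)))"
    unfolding poisson_law_def
    by (subst emeasure_density) (auto simp: nn_integral_count_space_nat divide_inverse mult_ac)
  also have "\<dots> = ennreal (exp (- r) * exp r)"
    using sm assms by (subst suminf_ennreal2) (auto simp: sums_iff)
  finally show "emeasure (poisson_law r) (space (poisson_law r)) = 1" by (simp add: exp_minus)
qed

section \<open>Poisson counts: a short period has essentially at most one claim\<close>

locale poisson_compound = nonneg_step D for D :: "real measure" +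
  fixes r :: real
  assumes rate_nonneg: "0 \<le> r"
begin

sublocale compound_step D "poisson_law r"
  by (intro compound_step.intro nonneg_step_axioms compound_step_axioms.intro prob_space_poisson_law
      rate_nonneg sets_poisson_law)

text \<open>Since j! m! <= (j + m)!, the weight at j + m is at most the weight at j times r^m / m!,
  and these factors sum to exp r.\<close>

lemma emeasure_poisson_atLeast_le: "emeasure (poisson_law r) {j..} \<le> ennreal (exp r) * emeasure (poisson_law r) {j}"
proof -
  define w where "w k = exp (- r) * r ^ k / fact k" for k :: nat
  have w0: "0 \<le> w k" for k using rate_nonneg by (simp add: w_def)
  have w: "emeasure (poisson_law r) {k} = ennreal (w k)" for k by (simp add: emeasure_poisson_law w_def rate_nonneg)
  have w_le: "w (j + m) \<le> w j * (r ^ m /\<^sub>R fact m)" for m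
  proof -
    have "fact j * fact m \<le> (fact (j + m) :: real)"
      using dvd_imp_le[OF fact_fact_dvd_fact[of j m, where 'a=nat]]
      by (metis fact_nonzero of_nat_fact of_nat_le_iff of_nat_mult neq0_conv)
    then have "exp (- r) * r ^ (j + m) / fact (j + m) \<le> exp (- r) * r ^ (j + m) / (fact j * fact m)"
      using rate_nonneg by (intro divide_left_mono) auto
    then show ?thesis by (simp add: w_def power_add divide_simps)
  qed
  have sm: "(\<lambda>m. w j * (r ^ m /\<^sub>R fact m)) sums (w j * exp r)" by (intro sums_mult exp_converges)
  have "emeasure (poisson_law r) {j..} = emeasure (poisson_law r) (\<Union>m. {j + m})"
    by (rule arg_cong[where f="emeasure (poisson_law r)"]) (auto simp: nat_le_iff_add)
  also have "\<dots> = (\<Sum>m. emeasure (poisson_law r) {j + m})"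
    by (rule suminf_emeasure[symmetric]) (auto simp: sets_poisson_law disjoint_family_on_def)
  also have "\<dots> \<le> (\<Sum>m. ennreal (w j * (r ^ m /\<^sub>R fact m)))"
  proof (rule suminf_le)
    show "emeasure (poisson_law r) {j + m} \<le> ennreal (w j * (r ^ m /\<^sub>R fact m))" for m
      unfolding w by (rule ennreal_leI[OF w_le])
  qed simp_all
  also have "\<dots> = ennreal (w j * exp r)"
    using sm w0 rate_nonneg by (subst suminf_ennreal2) (auto simp: sums_iff)
  finally show ?thesis by (simp add: w ennreal_mult w0 mult.commute)
qed

lemma nn_integral_poisson_id: "(\<integral>\<^sup>+j. ennreal (real j) \<partial>poisson_law r) = ennreal r"
proof -
  define w where "w k = exp (- r) * r ^ k / fact k" for k :: nat
  have w0: "0 \<le> w k" for k using rate_nonneg by (simp add: w_def)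
  have "(\<lambda>k. r ^ k /\<^sub>R fact k) sums exp r" by (rule exp_converges)
  then have "(\<lambda>k. r * exp (- r) * (r ^ k /\<^sub>R fact k)) sums (r * exp (- r) * exp r)"
    by (rule sums_mult)
  moreover have "r * exp (- r) * (r ^ k /\<^sub>R fact k) = real (Suc k) * w (Suc k)" for k
    by (simp add: w_def field_simps del: of_nat_Suc)
  moreover have "r * exp (- r) * exp r = r" by (simp add: exp_minus)
  ultimately have "(\<lambda>k. real (Suc k) * w (Suc k)) sums r" by simp
  then have sm: "(\<lambda>k. real k * w k) sums r" using sums_Suc[of "\<lambda>k. real k * w k" r] by simp
  have "(\<integral>\<^sup>+j. ennreal (real j) \<partial>poisson_law r) = (\<integral>\<^sup>+j. ennreal (w j) * ennreal (real j) \<partial>count_space UNIV)"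
    unfolding poisson_law_def w_def by (subst nn_integral_density) auto
  also have "\<dots> = (\<Sum>j. ennreal (real j * w j))"
    by (subst nn_integral_count_space_nat) (simp add: ennreal_mult[symmetric] w0 mult.commute)
  also have "\<dots> = ennreal r"
    using sm w0 by (subst suminf_ennreal2) (auto simp: sums_iff)
  finally show ?thesis .
qed

lemma expectation_nonneg: "0 \<le> (LINT s|D. s)"
  using AE_nonneg by (rule integral_nonneg_AE)

lemma nn_integral_sum_PX: "(\<integral>\<^sup>+x. ennreal (\<Sum>i<j. x i) \<partial>PX) = ennreal (real j * (LINT s|D. s))"
proof -
  have "(\<integral>\<^sup>+x. ennreal (\<Sum>i<j. x i) \<partial>PX) = (\<integral>\<^sup>+x. (\<Sum>i<j. ennreal (x i)) \<partial>PX)"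
  proof (rule nn_integral_cong_AE)
    show "AE x in PX. ennreal (\<Sum>i<j. x i) = (\<Sum>i<j. ennreal (x i))"
      using AE_PX_nonneg by eventually_elim (simp add: sum_ennreal)
  qed
  also have "\<dots> = (\<Sum>i<j. \<integral>\<^sup>+x. ennreal (x i) \<partial>PX)"
    by (rule nn_integral_sum) measurable
  also have "\<dots> = (\<Sum>i<j. \<integral>\<^sup>+s. ennreal s \<partial>D)"
    by (simp add: nn_integral_component)
  also have "(\<integral>\<^sup>+s. ennreal s \<partial>D) = ennreal (LINT s|D. s)"
    by (rule nn_integral_eq_integral[OF integrable_step AE_nonneg])
  finally show ?thesis
    by (simp add: ennreal_mult expectation_nonneg ennreal_of_nat_eq_real_of_nat)
qed

lemma nn_integral_compound_id: "(\<integral>\<^sup>+s. ennreal s \<partial>compound) = ennreal (r * (LINT s|D. s))"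
  by (subst nn_integral_compound)
     (simp_all add: nn_integral_sum_PX ennreal_mult expectation_nonneg rate_nonneg
       nn_integral_multc nn_integral_poisson_id)

lemma AE_compound_nonneg: "AE s in compound. 0 \<le> s"
proof -
  have "(\<integral>\<^sup>+s. indicator {..<0} s \<partial>compound) = (\<integral>\<^sup>+j. \<integral>\<^sup>+x. indicator {..<0} (\<Sum>i<j. x i) \<partial>PX \<partial>poisson_law r)"
    by (rule nn_integral_compound) simp
  also have "\<dots> = (\<integral>\<^sup>+j. \<integral>\<^sup>+x. 0 \<partial>PX \<partial>poisson_law r)"
  proof (rule nn_integral_cong, rule nn_integral_cong_AE)
    fix j
    show "AE x in PX. indicator {..<0} (\<Sum>i<j. x i) = (0::ennreal)"
      using AE_PX_nonneg by eventually_elim (simp add: indicator_def not_less sum_nonneg)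
  qed
  finally have "{..<0} \<in> null_sets compound" by (simp add: null_sets_def)
  then show ?thesis by (rule AE_I') (auto simp: not_le)
qed

lemma integrable_compound: "integrable compound (\<lambda>s. s)"
  by (rule integrableI_nn_integral_finite[OF _ AE_compound_nonneg nn_integral_compound_id]) simp

sublocale compound: nonneg_step compound
  by (intro nonneg_step.intro compound.real_distribution_axioms nonneg_step_axioms.intro
      AE_compound_nonneg integrable_compound)

lemma expectation_compound: "(LINT s|compound. s) = r * (LINT s|D. s)"
  using AE_compound_nonneg expectation_nonneg rate_nonneg
  by (subst integral_eq_nn_integral) (auto simp: nn_integral_compound_id)

text \<open>Split by the number of claims. No claim contributes 0; exactly one, of probability r exp
  (- r), contributes the mass for a single claim; the others contribute at most their share of the
  mean total, because a mass never exceeds the length of its interval. The gap is of order r^2,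
  hence negligible after division by a mesh proportional to r.\<close>

theorem expected_mass_compound:
  assumes q: "unit_valued q"
  shows "r * exp (- r) * expected_mass q v \<le> compound.expected_mass q v"
    and "compound.expected_mass q v
      \<le> r * exp (- r) * expected_mass q v + (r - r * exp (- r)) * (LINT s|D. s)"
proof -
  define \<phi> where "\<phi> s = ennreal (mass_between q (v - s) v)" for s
  have [measurable]: "\<phi> \<in> borel_measurable borel"
    unfolding \<phi>_def using mass_between_measurable[OF q] by measurable
  define e where "e j = (\<integral>\<^sup>+x. \<phi> (\<Sum>i<j. x i) \<partial>PX)" for j :: nat
  define \<mu> where "\<mu> = (LINT s|D. s)"
  define b where "b = r * exp (- r)"
  have \<mu>0: "0 \<le> \<mu>" and b0: "0 \<le> b" using expectation_nonneg rate_nonneg by (simp_all add: \<mu>_def b_def)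
  have b: "emeasure (poisson_law r) {1} = ennreal b"
    using emeasure_poisson_law[OF rate_nonneg, of 1] by (simp add: b_def mult.commute)
  have EC: "ennreal (compound.expected_mass q v) = (\<integral>\<^sup>+j. e j \<partial>poisson_law r)"
    unfolding compound.expected_mass_def e_def
    by (subst nn_integral_eq_integral[symmetric])
       (auto intro!: compound.integrable_mass_between_down mass_between_nonneg q
         simp: \<phi>_def[symmetric] nn_integral_compound)
  have ED: "ennreal (expected_mass q v) = e 1"
  proof -
    have "e 1 = (\<integral>\<^sup>+x. \<phi> (x 0) \<partial>PX)" by (simp add: e_def)
    also have "\<dots> = (\<integral>\<^sup>+s. \<phi> s \<partial>D)" by (rule nn_integral_component) simp
    finally show ?thesis
      unfolding expected_mass_def \<phi>_def
      by (subst nn_integral_eq_integral[symmetric])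
         (auto intro!: integrable_mass_between_down mass_between_nonneg q)
  qed
  have e_le: "e j \<le> ennreal (real j * \<mu>)" for j
  proof -
    have "e j \<le> (\<integral>\<^sup>+x. ennreal (\<Sum>i<j. x i) \<partial>PX)"
      unfolding e_def
    proof (rule nn_integral_mono_AE)
      show "AE x in PX. \<phi> (\<Sum>i<j. x i) \<le> ennreal (\<Sum>i<j. x i)"
        using AE_PX_nonneg
      proof eventually_elim
        case (elim x)
        then have "0 \<le> (\<Sum>i<j. x i)" by (simp add: sum_nonneg)
        then show ?case using mass_between_downward(2)[OF q, of v "\<Sum>i<j. x i"]
          by (simp add: \<phi>_def ennreal_leI)
      qed
    qed
    then show ?thesis by (simp add: nn_integral_sum_PX \<mu>_def)
  qed
  have split: "(\<integral>\<^sup>+j. f j \<partial>poisson_law r) = f 1 * ennreal b + (\<integral>\<^sup>+j. f j * indicator (- {1}) j \<partial>poisson_law r)" for f :: "nat \<Rightarrow> ennreal"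
  proof -
    have "(\<integral>\<^sup>+j. f j \<partial>poisson_law r) = (\<integral>\<^sup>+j. f 1 * indicator {1} j + f j * indicator (- {1}) j \<partial>poisson_law r)"
      by (intro nn_integral_cong) (auto split: split_indicator)
    also have "\<dots> = (\<integral>\<^sup>+j. f 1 * indicator {1} j \<partial>poisson_law r) + (\<integral>\<^sup>+j. f j * indicator (- {1}) j \<partial>poisson_law r)"
      by (rule nn_integral_add) measurable
    also have "(\<integral>\<^sup>+j. f 1 * indicator {1} j \<partial>poisson_law r) = f 1 * emeasure (poisson_law r) {1}"
      by (rule nn_integral_cmult_indicator) (simp add: sets_poisson_law)
    finally show ?thesis by (simp only: b)
  qed
  define R where "R = (\<integral>\<^sup>+j. e j * indicator (- {1}) j \<partial>poisson_law r)"
  define R' where "R' = (\<integral>\<^sup>+j. ennreal (real j * \<mu>) * indicator (- {1}) j \<partial>poisson_law r)"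
  have "R \<le> R'" unfolding R_def R'_def by (intro nn_integral_mono mult_right_mono e_le) simp
  have "ennreal (r * \<mu>) = (\<integral>\<^sup>+j. ennreal (real j * \<mu>) \<partial>poisson_law r)"
    by (simp add: ennreal_mult \<mu>0 rate_nonneg nn_integral_multc nn_integral_poisson_id)
  also have "\<dots> = ennreal (\<mu> * b) + R'"
    by (subst split) (simp add: R'_def ennreal_mult \<mu>0 b0)
  finally have R': "ennreal (r * \<mu>) = ennreal (\<mu> * b) + R'" .
  then have "R' \<noteq> top" by auto
  then obtain x where x: "0 \<le> x" "R' = ennreal x" by (cases R') auto
  with R' have xeq: "x = (r - b) * \<mu>"
    using \<mu>0 b0 rate_nonneg by (simp add: ennreal_plus[symmetric] algebra_simps del: ennreal_plus)
  have EC': "ennreal (compound.expected_mass q v) = ennreal (b * expected_mass q v) + R"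
  proof -
    have "ennreal (b * expected_mass q v) = e 1 * ennreal b"
      by (simp only: ED[symmetric]) (simp add: ennreal_mult b0 expected_mass_nonneg[OF q] mult.commute)
    then show ?thesis unfolding EC by (subst split) (simp add: R_def)
  qed
  have "ennreal (b * expected_mass q v) \<le> ennreal (compound.expected_mass q v)"
    unfolding EC' by simp
  then show "r * exp (- r) * expected_mass q v \<le> compound.expected_mass q v"
    using compound.expected_mass_nonneg[OF q] by (simp add: b_def)
  have "ennreal (compound.expected_mass q v) \<le> ennreal (b * expected_mass q v + x)"
    unfolding EC' using \<open>R \<le> R'\<close> x b0 expected_mass_nonneg[OF q] by (simp add: add_left_mono)
  then have "compound.expected_mass q v \<le> b * expected_mass q v + x"
    using x b0 expected_mass_nonneg[OF q] by (subst (asm) ennreal_le_iff) auto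
  then show "compound.expected_mass q v
      \<le> r * exp (- r) * expected_mass q v + (r - r * exp (- r)) * (LINT s|D. s)"
    by (simp add: b_def[symmetric] xeq \<mu>_def[symmetric])
qed

end

section \<open>Paths of the surplus\<close>

text \<open>Halving makes each grid contain the coarser ones, so ruin on the grid increases with k
  and the passage to continuous time is a monotone union.\<close>

definition mesh :: "nat \<Rightarrow> real" where
  "mesh k = (1 / 2) ^ k"

lemma mesh_pos: "0 < mesh k"
  by (simp add: mesh_def)

lemma mesh_tendsto: "mesh \<longlonglongrightarrow> 0"
  unfolding mesh_def[abs_def] by (rule LIMSEQ_power_zero) simp

lemma mesh_Suc: "mesh k = 2 * mesh (Suc k)"
  by (simp add: mesh_def)

lemma grid_point:
  assumes "0 \<le> t"
  obtains j :: nat where "t \<le> mesh k * real j" "mesh k * real j < t + mesh k"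
proof -
  define j where "j = nat \<lceil>t / mesh k\<rceil>"
  have "0 \<le> t / mesh k" using assms mesh_pos[of k] by simp
  then have "real j = of_int \<lceil>t / mesh k\<rceil>" by (simp add: j_def)
  then have "t / mesh k \<le> real j" "real j < t / mesh k + 1"
    using ceiling_correct[of "t / mesh k"] by linarith+
  then show thesis using mesh_pos[of k] by (intro that[of j]) (simp_all add: field_simps)
qed

locale risk_paths =
  fixes M :: "'a measure" and N :: "real \<Rightarrow> 'a \<Rightarrow> nat" and X :: "nat \<Rightarrow> 'a \<Rightarrow> real" and c :: real
  assumes counting: "counting_process M N"
    and claims_measurable: "\<And>i. X i \<in> borel_measurable M"
    and c_pos: "0 < c"
begin

abbreviation U :: "real \<Rightarrow> real \<Rightarrow> 'a \<Rightarrow> real" where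
  "U \<equiv> surplus c N X"

lemma N_measurable: "0 \<le> t \<Longrightarrow> N t \<in> measurable M (count_space UNIV)"
  using counting by (simp add: counting_process_def)

lemma U_measurable: "0 \<le> t \<Longrightarrow> U u t \<in> borel_measurable M"
proof -
  assume t: "0 \<le> t"
  have "(\<lambda>\<omega>. \<Sum>i<N t \<omega>. X i \<omega>) \<in> borel_measurable M"
    by (rule measurable_compose_countable[OF _ N_measurable[OF t]]) (intro borel_measurable_sum claims_measurable)
  then show ?thesis unfolding surplus_def[abs_def] by measurable
qed

lemma U_grid_measurable: "U u (mesh k * real j) \<in> borel_measurable M"
  using mesh_pos[of k] by (intro U_measurable) simp

lemma U_0: "\<omega> \<in> space M \<Longrightarrow> U u 0 \<omega> = u"
  using counting by (simp add: counting_process_def surplus_def)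

lemma U_add: "U (u + a) t \<omega> = U u t \<omega> + a"
  by (simp add: surplus_def)

lemma U_right:
  assumes "\<omega> \<in> space M" "0 \<le> t"
  obtains e where "0 < e" "\<And>s. t \<le> s \<Longrightarrow> s < t + e \<Longrightarrow> U u s \<omega> = U u t \<omega> + c * (s - t)"
proof -
  have "((\<lambda>s. N s \<omega>) \<longlongrightarrow> N t \<omega>) (at_right t)"
    using counting assms by (simp add: counting_process_def continuous_within)
  then have "eventually (\<lambda>s. N s \<omega> \<in> {N t \<omega>}) (at_right t)"
    by (rule topological_tendstoD) (auto intro: discrete_topology_class.open_discrete)
  then have "eventually (\<lambda>s. N s \<omega> = N t \<omega>) (at_right t)" by simp
  then obtain b where b: "b > t" "\<And>s. t < s \<Longrightarrow> s < b \<Longrightarrow> N s \<omega> = N t \<omega>"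
    unfolding eventually_at_right_field by blast
  show thesis
  proof (rule that[of "b - t"])
    fix s assume "t \<le> s" "s < t + (b - t)"
    then have "N s \<omega> = N t \<omega>" using b(2)[of s] by (cases "s = t") auto
    then show "U u s \<omega> = U u t \<omega> + c * (s - t)" by (simp add: surplus_def algebra_simps)
  qed (use b in simp)
qed

text \<open>Time 0 is included so that a negative start is ruined at once and the ruin probability
  is 1 on the negative half-line, as the renewal equation requires. For u >= 0 the event agrees with
  \<open>ruin_event\<close>.\<close>

definition ruined :: "real \<Rightarrow> 'a set" where
  "ruined u = {\<omega>\<in>space M. \<exists>t\<ge>0. U u t \<omega> < 0}"

definition skeleton_hits :: "real set \<Rightarrow> nat \<Rightarrow> real \<Rightarrow> 'a set" where
  "skeleton_hits A k u = {\<omega>\<in>space M. \<exists>j. (\<forall>i<j. 0 \<le> U u (mesh k * real i) \<omega>) \<and> U u (mesh k * real j) \<omega> \<in> A}"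

lemma skeleton_hits_sets:
  assumes [measurable]: "A \<in> sets borel"
  shows "skeleton_hits A k u \<in> sets M"
proof -
  note [measurable] = U_grid_measurable
  show ?thesis unfolding skeleton_hits_def by measurable
qed

lemma skeleton_hits_neg:
  "skeleton_hits {..<0} k u = {\<omega>\<in>space M. \<exists>j. U u (mesh k * real j) \<omega> < 0}"
proof -
  have "(\<exists>j. (\<forall>i<j. 0 \<le> f i) \<and> f j < 0) \<longleftrightarrow> (\<exists>j. f j < 0)" for f :: "nat \<Rightarrow> real"
  proof
    assume "\<exists>j. f j < 0"
    then have "f (LEAST j. f j < 0) < 0" by (rule LeastI_ex)
    moreover have "\<forall>i<(LEAST j. f j < 0). 0 \<le> f i" by (meson not_less not_less_Least)
    ultimately show "\<exists>j. (\<forall>i<j. 0 \<le> f i) \<and> f j < 0" by blast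
  qed blast
  then show ?thesis by (simp only: skeleton_hits_def lessThan_iff)
qed

text \<open>On mesh h the ladder inequalities involve the levels u and u + c h; the shift by theta
  times the mesh, with theta = 0 or c, covers both. Passing to k + 1 keeps the old grid points and
  does not raise the initial level.\<close>

lemma skeleton_ruin_incseq:
  assumes \<theta>: "0 \<le> \<theta>"
  shows "incseq (\<lambda>k. skeleton_hits {..<0} k (u + \<theta> * mesh k))"
proof (rule incseq_SucI, rule subsetI)
  fix k \<omega> assume "\<omega> \<in> skeleton_hits {..<0} k (u + \<theta> * mesh k)"
  then obtain j where \<omega>: "\<omega> \<in> space M" and j: "U u (mesh k * real j) \<omega> + \<theta> * mesh k < 0"
    by (auto simp: skeleton_hits_neg U_add)
  have "mesh (Suc k) * real (2 * j) = mesh k * real j" by (simp add: mesh_Suc[of k])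
  then have "U u (mesh (Suc k) * real (2 * j)) \<omega> = U u (mesh k * real j) \<omega>" by (simp only:)
  moreover have "\<theta> * mesh (Suc k) \<le> \<theta> * mesh k"
    using \<theta> mesh_pos[of "Suc k"] by (intro mult_left_mono) (simp_all add: mesh_Suc[of k])
  ultimately have "U u (mesh (Suc k) * real (2 * j)) \<omega> + \<theta> * mesh (Suc k) < 0" using j by linarith
  then show "\<omega> \<in> skeleton_hits {..<0} (Suc k) (u + \<theta> * mesh (Suc k))"
    using \<omega> unfolding skeleton_hits_neg U_add by blast
qed

text \<open>After a time t of negative surplus the path rises with slope c up to the next claim, so
  a grid point within one mesh of t is at most c times the mesh higher. It absorbs the shift as well
  once (c + theta) times the mesh is less than - U t.\<close>

lemma ruined_eq_Union:
  assumes \<theta>: "0 \<le> \<theta>"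
  shows "ruined u = (\<Union>k. skeleton_hits {..<0} k (u + \<theta> * mesh k))"
proof (intro equalityI subsetI)
  fix \<omega> assume "\<omega> \<in> ruined u"
  then obtain t where \<omega>: "\<omega> \<in> space M" and t: "0 \<le> t" "U u t \<omega> < 0" by (auto simp: ruined_def)
  obtain e where e: "0 < e" "\<And>s. t \<le> s \<Longrightarrow> s < t + e \<Longrightarrow> U u s \<omega> = U u t \<omega> + c * (s - t)"
    using U_right[OF \<omega> t(1)] by blast
  have "0 < min e (- U u t \<omega> / (c + \<theta>))" using e(1) t(2) c_pos \<theta> by (simp add: divide_neg_pos add_pos_nonneg)
  then obtain k where k: "mesh k < min e (- U u t \<omega> / (c + \<theta>))"
    using order_tendstoD(2)[OF mesh_tendsto] unfolding eventually_sequentially by blast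
  obtain j where j: "t \<le> mesh k * real j" "mesh k * real j < t + mesh k"
    using grid_point[OF t(1)] by blast
  have "U u (mesh k * real j) \<omega> = U u t \<omega> + c * (mesh k * real j - t)" using j k by (intro e(2)) auto
  moreover have "c * (mesh k * real j - t) \<le> c * mesh k" using j c_pos by (intro mult_left_mono) auto
  moreover have "(c + \<theta>) * mesh k < - U u t \<omega>" using k c_pos \<theta> by (auto simp: field_simps)
  ultimately have "U u (mesh k * real j) \<omega> + \<theta> * mesh k < 0" by (simp add: algebra_simps)
  then show "\<omega> \<in> (\<Union>k. skeleton_hits {..<0} k (u + \<theta> * mesh k))"
    using \<omega> by (auto simp: skeleton_hits_neg U_add)
next
  fix \<omega> assume "\<omega> \<in> (\<Union>k. skeleton_hits {..<0} k (u + \<theta> * mesh k))"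
  then obtain k j where \<omega>: "\<omega> \<in> space M" and j: "U u (mesh k * real j) \<omega> + \<theta> * mesh k < 0"
    by (auto simp: skeleton_hits_neg U_add)
  have "0 \<le> mesh k * real j" "0 \<le> \<theta> * mesh k" using mesh_pos[of k] \<theta> by simp_all
  then show "\<omega> \<in> ruined u" using j \<omega> by (auto simp: ruined_def intro!: exI[of _ "mesh k * real j"])
qed

lemma ruined_sets: "ruined u \<in> sets M"
  unfolding ruined_eq_Union[OF order_refl] by (intro sets.countable_UN') (auto intro: skeleton_hits_sets)

lemma ruin_event_eq: "0 \<le> u \<Longrightarrow> ruin_event M c N X u = ruined u"
proof -
  assume u: "0 \<le> u"
  have "(\<exists>t>0. U u t \<omega> < 0) \<longleftrightarrow> (\<exists>t\<ge>0. U u t \<omega> < 0)" if "\<omega> \<in> space M" for \<omega>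
    using U_0[OF that, of u] u by (metis less_eq_real_def not_less)
  moreover have "ruin_time c N X u \<omega> < \<infinity> \<longleftrightarrow> (\<exists>t>0. U u t \<omega> < 0)" for \<omega>
    unfolding ruin_time_def Inf_less_iff by auto
  ultimately show ?thesis by (auto simp: ruin_event_def ruined_def)
qed

definition surplus_at_ruin :: "real \<Rightarrow> 'a \<Rightarrow> real" where
  "surplus_at_ruin u \<omega> = U u (real_of_ereal (ruin_time c N X u \<omega>)) \<omega>"

lemma ruin_time_obtain:
  assumes u: "0 \<le> u" and \<omega>: "\<omega> \<in> ruined u"
  obtains T where "0 \<le> T" "surplus_at_ruin u \<omega> = U u T \<omega>"
    "\<And>s. 0 \<le> s \<Longrightarrow> s < T \<Longrightarrow> 0 \<le> U u s \<omega>"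
    "\<And>e. 0 < e \<Longrightarrow> \<exists>s\<ge>T. s < T + e \<and> U u s \<omega> < 0"
proof -
  have \<omega>M: "\<omega> \<in> space M" using \<omega> by (simp add: ruined_def)
  have fin: "ruin_time c N X u \<omega> < \<infinity>"
    using \<omega> ruin_event_eq[OF u] by (auto simp: ruin_event_def)
  have ge0: "0 \<le> ruin_time c N X u \<omega>"
    unfolding ruin_time_def by (intro Inf_greatest) auto
  define T where "T = real_of_ereal (ruin_time c N X u \<omega>)"
  have T: "ereal T = ruin_time c N X u \<omega>" "0 \<le> T"
    using fin ge0 by (auto simp: T_def ereal_real' real_of_ereal_pos)
  have before: "0 \<le> U u s \<omega>" if "0 \<le> s" "s < T" for s
  proof (rule ccontr)
    assume neg: "\<not> 0 \<le> U u s \<omega>"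
    then have "s \<noteq> 0" using U_0[OF \<omega>M, of u] u by auto
    then have "ruin_time c N X u \<omega> \<le> ereal s"
      unfolding ruin_time_def using neg that by (intro Inf_lower) auto
    then have "ereal T \<le> ereal s" unfolding T(1) .
    then show False using that by simp
  qed
  show thesis
  proof (rule that[OF T(2) _ before])
    show "surplus_at_ruin u \<omega> = U u T \<omega>" by (simp add: surplus_at_ruin_def T_def)
    fix e :: real assume "0 < e"
    then have "ruin_time c N X u \<omega> < ereal (T + e)" by (simp flip: T(1))
    then obtain s where s: "0 < s" "U u s \<omega> < 0" "s < T + e"
      by (auto simp: ruin_time_def Inf_less_iff)
    moreover have "T \<le> s" using before[of s] s by (meson less_imp_le not_le)
    ultimately show "\<exists>s\<ge>T. s < T + e \<and> U u s \<omega> < 0" by blast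
  qed
qed

text \<open>Negative values occur at or arbitrarily soon after the ruin time T, while just after T
  the path is linear with slope c > 0; so it is negative at T itself. The first grid point at or
  after T shows this value up to c times the mesh, and all earlier grid points lie before T, where
  the surplus is nonnegative.\<close>

lemma first_passage:
  assumes u: "0 \<le> u" and \<omega>: "\<omega> \<in> ruined u"
  shows "surplus_at_ruin u \<omega> < 0"
    and "\<forall>\<^sub>F k in sequentially. \<exists>j. (\<forall>i<j. 0 \<le> U u (mesh k * real i) \<omega>) \<and> U u (mesh k * real j) \<omega> < 0 \<and>
      surplus_at_ruin u \<omega> \<le> U u (mesh k * real j) \<omega> \<and>
      U u (mesh k * real j) \<omega> \<le> surplus_at_ruin u \<omega> + c * mesh k"
proof -
  have \<omega>M: "\<omega> \<in> space M" using \<omega> by (simp add: ruined_def)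
  obtain T where T: "0 \<le> T" "surplus_at_ruin u \<omega> = U u T \<omega>"
    and before: "\<And>s. 0 \<le> s \<Longrightarrow> s < T \<Longrightarrow> 0 \<le> U u s \<omega>"
    and after: "\<And>e. 0 < e \<Longrightarrow> \<exists>s\<ge>T. s < T + e \<and> U u s \<omega> < 0"
    using ruin_time_obtain[OF u \<omega>] by blast
  obtain e where e: "0 < e" "\<And>s. T \<le> s \<Longrightarrow> s < T + e \<Longrightarrow> U u s \<omega> = U u T \<omega> + c * (s - T)"
    using U_right[OF \<omega>M T(1)] by blast
  note UT = T(2)
  obtain s where s: "T \<le> s" "s < T + e" "U u s \<omega> < 0" using after[OF e(1)] by blast
  with e(2)[of s] c_pos have neg: "U u T \<omega> < 0"
    by (smt (verit) mult_nonneg_nonneg)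
  then show "surplus_at_ruin u \<omega> < 0" by (simp add: UT)
  have "0 < min e (- U u T \<omega> / c)" using e(1) neg c_pos by (simp add: divide_neg_pos)
  from order_tendstoD(2)[OF mesh_tendsto this]
  show "\<forall>\<^sub>F k in sequentially. \<exists>j. (\<forall>i<j. 0 \<le> U u (mesh k * real i) \<omega>) \<and> U u (mesh k * real j) \<omega> < 0 \<and>
      surplus_at_ruin u \<omega> \<le> U u (mesh k * real j) \<omega> \<and>
      U u (mesh k * real j) \<omega> \<le> surplus_at_ruin u \<omega> + c * mesh k"
  proof eventually_elim
    case (elim k)
    obtain j where j: "T \<le> mesh k * real j" "mesh k * real j < T + mesh k"
      using grid_point[OF T(1)] by blast
    have Uj: "U u (mesh k * real j) \<omega> = U u T \<omega> + c * (mesh k * real j - T)"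
      using j elim by (intro e(2)) auto
    have up: "c * (mesh k * real j - T) \<le> c * mesh k" and lo: "0 \<le> c * (mesh k * real j - T)"
      using j c_pos by (auto intro!: mult_left_mono)
    have "c * mesh k < - U u T \<omega>" using elim c_pos by (auto simp: field_simps)
    then have "U u (mesh k * real j) \<omega> < 0" using Uj up by simp
    moreover have "0 \<le> U u (mesh k * real i) \<omega>" if "i < j" for i
    proof (rule before)
      show "0 \<le> mesh k * real i" using mesh_pos[of k] by simp
      have "mesh k * (real i + 1) \<le> mesh k * real j"
        using that mesh_pos[of k] by (intro mult_left_mono) auto
      then show "mesh k * real i < T" using j by (simp add: algebra_simps)
    qed
    ultimately show ?case using Uj up lo UT by (intro exI[of _ j]) auto
  qed
qed

lemma surplus_at_ruin_measurable:
  assumes u: "0 \<le> u"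
  shows "surplus_at_ruin u \<in> borel_measurable (restrict_space M (ruined u))"
proof -
  \<comment> \<open>On a path without negative grid values the LEAST is an unspecified number. On
    the ruin event a negative grid value exists for all large k, so the limit is not
    affected.\<close>
  define W where "W k \<omega> = U u (mesh k * real (LEAST j. U u (mesh k * real j) \<omega> < 0)) \<omega>" for k \<omega>
  have W: "W k \<in> borel_measurable M" for k
    unfolding W_def
  proof (rule measurable_compose_countable[OF U_grid_measurable])
    note [measurable] = U_grid_measurable
    show "(\<lambda>\<omega>. LEAST j. U u (mesh k * real j) \<omega> < 0) \<in> measurable M (count_space UNIV)"
      by measurable
  qed
  show ?thesis
  proof (rule borel_measurable_LIMSEQ_real)
    show "W k \<in> borel_measurable (restrict_space M (ruined u))" for k
      by (rule measurable_restrict_space1[OF W])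
    fix \<omega> assume "\<omega> \<in> space (restrict_space M (ruined u))"
    then have \<omega>: "\<omega> \<in> ruined u" by (simp add: space_restrict_space)
    have ev: "\<forall>\<^sub>F k in sequentially. surplus_at_ruin u \<omega> \<le> W k \<omega> \<and> W k \<omega> \<le> surplus_at_ruin u \<omega> + c * mesh k"
      using first_passage(2)[OF u \<omega>]
    proof eventually_elim
      case (elim k)
      then obtain j where j: "\<forall>i<j. 0 \<le> U u (mesh k * real i) \<omega>" "U u (mesh k * real j) \<omega> < 0"
        "surplus_at_ruin u \<omega> \<le> U u (mesh k * real j) \<omega>"
        "U u (mesh k * real j) \<omega> \<le> surplus_at_ruin u \<omega> + c * mesh k" by blast
      have "(LEAST j. U u (mesh k * real j) \<omega> < 0) = j"
      proof (rule Least_equality)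
        fix i assume "U u (mesh k * real i) \<omega> < 0"
        then show "j \<le> i" using j(1) by (meson not_less)
      qed (rule j(2))
      then show ?case using j by (simp add: W_def)
    qed
    show "(\<lambda>k. W k \<omega>) \<longlonglongrightarrow> surplus_at_ruin u \<omega>"
    proof (rule tendsto_sandwich[OF _ _ tendsto_const])
      have "(\<lambda>k. surplus_at_ruin u \<omega> + c * mesh k) \<longlonglongrightarrow> surplus_at_ruin u \<omega> + c * 0"
        by (intro tendsto_intros mesh_tendsto)
      then show "(\<lambda>k. surplus_at_ruin u \<omega> + c * mesh k) \<longlonglongrightarrow> surplus_at_ruin u \<omega>" by simp
    qed (use ev in \<open>auto elim: eventually_mono\<close>)
  qed
qed

definition small_deficit :: "real \<Rightarrow> real \<Rightarrow> 'a set" where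
  "small_deficit R u = {\<omega>\<in>ruined u. - R \<le> surplus_at_ruin u \<omega>}"

lemma small_deficit_sets:
  assumes "0 \<le> u"
  shows "small_deficit R u \<in> sets M"
proof -
  note [measurable] = surplus_at_ruin_measurable[OF assms]
  have "{\<omega>\<in>space (restrict_space M (ruined u)). - R \<le> surplus_at_ruin u \<omega>} \<in> sets (restrict_space M (ruined u))"
    by measurable
  moreover have "{\<omega>\<in>space (restrict_space M (ruined u)). - R \<le> surplus_at_ruin u \<omega>} = small_deficit R u"
    using sets.sets_into_space[OF ruined_sets] by (auto simp: space_restrict_space small_deficit_def)
  ultimately show ?thesis
    using ruined_sets by (auto simp: sets_restrict_space_iff)
qed

end

section \<open>Skeletons of the surplus process\<close>

definition increment :: "(real \<Rightarrow> 'a \<Rightarrow> nat) \<Rightarrow> real \<Rightarrow> nat \<Rightarrow> 'a \<Rightarrow> nat" where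
  "increment N h k \<omega> = N (h * real (Suc k)) \<omega> - N (h * real k) \<omega>"

abbreviation count_sequences :: "(nat \<Rightarrow> nat) measure" where
  "count_sequences \<equiv> PiM UNIV (\<lambda>_. count_space UNIV)"

abbreviation real_sequences :: "(nat \<Rightarrow> real) measure" where
  "real_sequences \<equiv> PiM UNIV (\<lambda>_. borel)"

(* Only the marginal laws of the claim counts and of the claims are fixed here; see decoupled for
   their joint law. *)
locale poisson_claims = prob_space M + risk_paths M N X c
  for M :: "'a measure" and N :: "real \<Rightarrow> 'a \<Rightarrow> nat" and X :: "nat \<Rightarrow> 'a \<Rightarrow> real" and c :: real +
  fixes l :: real and D :: "real measure"
  assumes increments_law: "\<And>h. 0 \<le> h \<Longrightarrow>
      distr M count_sequences (\<lambda>\<omega> k. increment N h k \<omega>) = PiM UNIV (\<lambda>_. poisson_law (l * h))"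
    and claims_law: "distr M real_sequences (\<lambda>\<omega> i. X i \<omega>) = PiM UNIV (\<lambda>_. D)"
    and claims: "claim_size_law D"
    and rate: "0 \<le> l" and net_profit: "l * mean D < c"
begin

sublocale D: nonneg_step D
proof (intro nonneg_step.intro nonneg_step_axioms.intro)
  show "real_distribution D" "integrable D (\<lambda>s. s)" using claims by (simp_all add: claim_size_law_def)
  have "AE x in D. 0 < x" using claims by (simp add: claim_size_law_def)
  then show "AE s in D. 0 \<le> s" by eventually_elim simp
qed

lemma poisson_compound_step: "0 \<le> h \<Longrightarrow> poisson_compound D (l * h)"
  by (intro poisson_compound.intro poisson_compound_axioms.intro D.nonneg_step_axioms) (simp add: rate)

lemma increment_measurable: "0 \<le> h \<Longrightarrow> increment N h k \<in> measurable M (count_space UNIV)"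
proof -
  assume h: "0 \<le> h"
  have [measurable]: "N (h * real j) \<in> measurable M (count_space UNIV)" for j
    using h by (intro N_measurable) simp
  show ?thesis unfolding increment_def[abs_def] by measurable
qed

lemma increments_measurable: "0 \<le> h \<Longrightarrow> (\<lambda>\<omega> k. increment N h k \<omega>) \<in> measurable M count_sequences"
  by (rule measurable_PiM_single') (auto intro: increment_measurable)

lemma claims_sequence_measurable: "(\<lambda>\<omega> i. X i \<omega>) \<in> measurable M real_sequences"
  by (rule measurable_PiM_single') (auto intro: claims_measurable)

text \<open>A predicate in h rather than a locale assumption: the model supplies it for h = 1, the
  product copy for every h >= 0.\<close>

definition decoupled :: "real \<Rightarrow> bool" where
  "decoupled h \<longleftrightarrow> distr M (count_sequences \<Otimes>\<^sub>M real_sequences) (\<lambda>\<omega>. (\<lambda>k. increment N h k \<omega>, \<lambda>i. X i \<omega>))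
     = distr M count_sequences (\<lambda>\<omega> k. increment N h k \<omega>) \<Otimes>\<^sub>M distr M real_sequences (\<lambda>\<omega> i. X i \<omega>)"

lemma joint_law:
  assumes h: "0 \<le> h" and dec: "decoupled h"
  shows "distr M (count_sequences \<Otimes>\<^sub>M real_sequences) (\<lambda>\<omega>. (\<lambda>k. increment N h k \<omega>, \<lambda>i. X i \<omega>))
    = compound_step.PN (poisson_law (l * h)) \<Otimes>\<^sub>M compound_step.PX D"
proof -
  interpret C: poisson_compound D "l * h" by (rule poisson_compound_step[OF h])
  show ?thesis
    using dec by (simp add: decoupled_def C.PN_def C.PX_def increments_law[OF h] claims_law)
qed

definition step_law :: "real \<Rightarrow> real measure" where
  "step_law h = compound_step.compound D (poisson_law (l * h))"

lemma AE_claims_nonneg: "AE \<omega> in M. \<forall>i. 0 \<le> X i \<omega>"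
proof -
  interpret C: poisson_compound D 0
    using poisson_compound_step[of 0] by simp
  have "AE x in distr M real_sequences (\<lambda>\<omega> i. X i \<omega>). \<forall>i. 0 \<le> x i"
    using C.AE_PX_nonneg unfolding claims_law C.PX_def .
  then show ?thesis by (rule AE_distrD[OF claims_sequence_measurable])
qed

lemma sum_increment:
  assumes "\<omega> \<in> space M" "0 \<le> h"
  shows "(\<Sum>m<j. increment N h m \<omega>) = N (h * real j) \<omega>"
proof (induction j)
  case 0
  then show ?case using counting assms by (simp add: counting_process_def)
next
  case (Suc j)
  have "N (h * real j) \<omega> \<le> N (h * real (Suc j)) \<omega>"
    using counting assms by (auto simp: counting_process_def mult_left_mono)
  then show ?case using Suc by (simp add: increment_def)
qed

lemma prob_skeleton:
  assumes A: "A \<in> sets borel" "A \<subseteq> {..<0}" and dec: "decoupled (mesh m)"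
  shows "prob {\<omega>\<in>space M. \<exists>k\<le>n. (\<forall>j<k. 0 \<le> U u (mesh m * real j) \<omega>) \<and> U u (mesh m * real k) \<omega> \<in> A}
    = hit_prob (step_law (mesh m)) (c * mesh m) A n u"
proof -
  let ?h = "mesh m"
  have h: "0 \<le> ?h" using mesh_pos[of m] by simp
  interpret C: poisson_compound D "l * ?h" by (rule poisson_compound_step[OF h])
  let ?CS = "PiM UNIV (\<lambda>_::nat. count_space (UNIV::nat set))" and ?B = "PiM UNIV (\<lambda>_::nat. borel :: real measure)"
  let ?f = "\<lambda>\<omega>. (\<lambda>k. increment N ?h k \<omega>, \<lambda>i. X i \<omega>)"
  let ?E = "{z\<in>space (C.PN \<Otimes>\<^sub>M C.PX). hits (c * ?h) A n u (fst z) (snd z)}"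
  have f: "?f \<in> measurable M (?CS \<Otimes>\<^sub>M ?B)"
    by (intro measurable_Pair increments_measurable[OF h] claims_sequence_measurable)
  have sets_eq: "sets (C.PN \<Otimes>\<^sub>M C.PX) = sets (?CS \<Otimes>\<^sub>M ?B)"
    by (intro sets_pair_measure_cong C.sets_PN C.sets_PX)
  have E: "?E \<in> sets (?CS \<Otimes>\<^sub>M ?B)"
  proof -
    have "{z\<in>space (?CS \<Otimes>\<^sub>M ?B). hits (c * ?h) A n u (fst z) (snd z)} \<in> sets (?CS \<Otimes>\<^sub>M ?B)"
      using measurable_hits[OF A(1), of "\<lambda>_. u" "?CS \<Otimes>\<^sub>M ?B" fst snd] by measurable
    then show ?thesis using sets_eq_imp_space_eq[OF sets_eq] by simp
  qed
  have "emeasure M (?f -` ?E \<inter> space M) = emeasure (distr M (?CS \<Otimes>\<^sub>M ?B) ?f) ?E"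
    by (rule emeasure_distr[OF f E, symmetric])
  also have "\<dots> = ennreal (hit_prob (step_law ?h) (c * ?h) A n u)"
    unfolding joint_law[OF h dec] step_law_def by (rule C.emeasure_hits[OF A(1)])
  finally have "prob (?f -` ?E \<inter> space M) = hit_prob (step_law ?h) (c * ?h) A n u"
    by (simp add: emeasure_eq_measure step_law_def C.compound.hit_prob_bounds)
  moreover have "?f -` ?E \<inter> space M = {\<omega>\<in>space M. \<exists>k\<le>n. (\<forall>j<k. 0 \<le> U u (?h * real j) \<omega>) \<and> U u (?h * real k) \<omega> \<in> A}"
  proof -
    have "?f \<omega> \<in> space (C.PN \<Otimes>\<^sub>M C.PX)" if "\<omega> \<in> space M" for \<omega>
      using measurable_space[OF f that] sets_eq_imp_space_eq[OF sets_eq] by simp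
    then show ?thesis
      by (auto simp: hits_iff[OF A(2)] sum_increment[OF _ h] surplus_def mult.assoc)
  qed
  ultimately show ?thesis by simp
qed

lemma prob_skeleton_hits:
  assumes A: "A \<in> sets borel" "A \<subseteq> {..<0}" and dec: "decoupled (mesh m)"
  shows "prob (skeleton_hits A m u) = hit_prob_limit (step_law (mesh m)) (c * mesh m) A u"
proof -
  have h: "0 \<le> mesh m" using mesh_pos[of m] by simp
  interpret C: poisson_compound D "l * mesh m" by (rule poisson_compound_step[OF h])
  let ?S = "\<lambda>n. {\<omega>\<in>space M. \<exists>k\<le>n. (\<forall>j<k. 0 \<le> U u (mesh m * real j) \<omega>) \<and> U u (mesh m * real k) \<omega> \<in> A}"
  note [measurable] = U_grid_measurable A(1)
  have "(\<lambda>n. prob (?S n)) \<longlonglongrightarrow> prob (\<Union>n. ?S n)"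
  proof (rule finite_Lim_measure_incseq)
    show "incseq ?S" by (rule incseq_SucI) (auto intro: le_SucI)
    show "range ?S \<subseteq> sets M" by auto
  qed
  moreover have "(\<Union>n. ?S n) = skeleton_hits A m u"
    by (auto simp: skeleton_hits_def)
  moreover have "(\<lambda>n. prob (?S n)) \<longlonglongrightarrow> hit_prob_limit (step_law (mesh m)) (c * mesh m) A u"
    unfolding prob_skeleton[OF A dec] step_law_def by (rule C.compound.hit_prob_LIMSEQ[OF A])
  ultimately show ?thesis by (auto intro: LIMSEQ_unique)
qed


lemma mesh_0: "mesh 0 = 1"
  by (simp add: mesh_def)

definition skeleton_ruin :: "real \<Rightarrow> real" where
  "skeleton_ruin u = prob (skeleton_hits {..<0} 0 u)"

lemma skeleton_ruin_bounds: "0 \<le> skeleton_ruin u" "skeleton_ruin u \<le> 1"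
  by (simp_all add: skeleton_ruin_def)

lemma skeleton_ruin_eq:
  assumes "decoupled 1"
  shows "skeleton_ruin u = hit_prob_limit (step_law 1) c {..<0} u"
  using prob_skeleton_hits[of "{..<0}" 0 u] assms by (simp add: skeleton_ruin_def mesh_0)

definition ruin_prob :: "real \<Rightarrow> real" where
  "ruin_prob u = prob (ruined u)"

lemma skeleton_ruin_le: "skeleton_ruin u \<le> ruin_prob u"
  unfolding skeleton_ruin_def ruin_prob_def
  using ruined_eq_Union[of 0 u] by (intro finite_measure_mono ruined_sets) auto

text \<open>If the surplus from u + c is negative at t, then up to the next integer time at most c
  of premium comes in and claims are only added; so the surplus from u is negative at that integer
  time.\<close>

lemma ruin_prob_le_skeleton: "ruin_prob (u + c) \<le> skeleton_ruin u"
  unfolding skeleton_ruin_def ruin_prob_def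
proof (rule finite_measure_mono_AE)
  show "AE \<omega> in M. \<omega> \<in> ruined (u + c) \<longrightarrow> \<omega> \<in> skeleton_hits {..<0} 0 u"
    using AE_claims_nonneg
  proof eventually_elim
    case (elim \<omega>)
    show ?case
    proof
      assume "\<omega> \<in> ruined (u + c)"
      then obtain t where \<omega>: "\<omega> \<in> space M" and t: "0 \<le> t" "U u t \<omega> + c < 0"
        by (auto simp: ruined_def U_add)
      obtain j where j: "t \<le> mesh 0 * real j" "mesh 0 * real j < t + mesh 0"
        using grid_point[OF t(1)] by blast
      have "N t \<omega> \<le> N (mesh 0 * real j) \<omega>"
        using counting \<omega> t j by (auto simp: counting_process_def)
      then have "(\<Sum>i<N t \<omega>. X i \<omega>) \<le> (\<Sum>i<N (mesh 0 * real j) \<omega>. X i \<omega>)"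
        using elim by (intro sum_mono2) auto
      moreover have "c * (mesh 0 * real j) \<le> c * (t + 1)"
        using j c_pos by (intro mult_left_mono) (auto simp: mesh_0)
      ultimately have "U u (mesh 0 * real j) \<omega> < 0"
        using t by (simp add: surplus_def algebra_simps)
      then show "\<omega> \<in> skeleton_hits {..<0} 0 u"
        using \<omega> unfolding skeleton_hits_neg by blast
    qed
  qed
qed (rule skeleton_hits_sets, simp)

end

section \<open>Claims independent of the counts on every grid: the ladder equation\<close>

locale cramer_lundberg = poisson_claims +
  assumes decoupled: "\<And>h. 0 \<le> h \<Longrightarrow> decoupled h"
begin

lemma decoupled_mesh: "decoupled (mesh k)"
  using mesh_pos[of k] by (intro decoupled) simp

lemma ruin_prob_limit:
  assumes "0 \<le> \<theta>"
  shows "(\<lambda>k. prob (skeleton_hits {..<0} k (u + \<theta> * mesh k))) \<longlonglongrightarrow> ruin_prob u"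
  unfolding ruin_prob_def ruined_eq_Union[OF assms]
  by (rule finite_Lim_measure_incseq) (auto intro: skeleton_ruin_incseq[OF assms] skeleton_hits_sets)

lemma unit_valued_ruin_prob: "unit_valued ruin_prob"
  unfolding unit_valued_def
proof (intro conjI allI)
  have "hit_prob_limit (step_law (mesh k)) (c * mesh k) {..<0} \<in> borel_measurable borel" for k
  proof -
    interpret C: poisson_compound D "l * mesh k"
      using mesh_pos[of k] by (intro poisson_compound_step) simp
    show ?thesis unfolding step_law_def by (intro unit_valuedD(1) C.compound.unit_valued_hit_prob_limit) auto
  qed
  then have "(\<lambda>u. prob (skeleton_hits {..<0} k u)) \<in> borel_measurable borel" for k
    by (simp add: prob_skeleton_hits decoupled_mesh)
  then show "ruin_prob \<in> borel_measurable borel"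
    by (rule borel_measurable_LIMSEQ_real[rotated]) (use ruin_prob_limit[of 0] in simp)
qed (simp_all add: ruin_prob_def)

lemma ruin_prob_neg: "u < 0 \<Longrightarrow> ruin_prob u = 1"
proof -
  assume "u < 0"
  then have "ruined u = space M" using U_0 by (auto simp: ruined_def intro!: exI[of _ 0])
  then show ?thesis by (simp add: ruin_prob_def prob_space)
qed

text \<open>Apply \<open>hit_prob_ladder\<close> on each mesh and divide by the mesh. Its two
  inequalities evaluate the grid probability at u + c mesh k and at u; by
  \<open>ruin_prob_limit\<close> with theta = c and theta = 0 both tend to the ruin probability at
  u, which takes the place of a continuity argument.\<close>

theorem ruin_prob_ladder:
  assumes u: "0 \<le> u"
  shows "c * ruin_prob u = l * D.expected_mass ruin_prob u"
proof -
  define p where "p k v = prob (skeleton_hits {..<0} k v)" for k v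
  define E where "E k = D.expected_mass (p k) (u + c * mesh k)" for k
  have p_eq: "p k = hit_prob_limit (step_law (mesh k)) (c * mesh k) {..<0}" for k
    by (simp add: p_def prob_skeleton_hits decoupled_mesh fun_eq_iff)
  have up: "unit_valued (p k)" for k
  proof -
    interpret C: poisson_compound D "l * mesh k"
      using mesh_pos[of k] by (intro poisson_compound_step) simp
    show ?thesis unfolding p_eq step_law_def by (intro C.compound.unit_valued_hit_prob_limit) auto
  qed
  have bounds: "l * exp (- (l * mesh k)) * E k \<le> c * p k u"
    "c * p k (u + c * mesh k) \<le> l * exp (- (l * mesh k)) * E k + l * (1 - exp (- (l * mesh k))) * mean D" for k
  proof -
    have h: "0 < mesh k" by (rule mesh_pos)
    interpret C: poisson_compound D "l * mesh k"
      using h by (intro poisson_compound_step) simp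
    have a: "0 < c * mesh k" "(LINT s|C.compound. s) < c * mesh k"
      using h c_pos net_profit mult_strict_right_mono[OF net_profit h]
      by (simp_all add: C.expectation_compound mean_def mult_ac)
    note L = C.compound.hit_prob_ladder[OF a u, folded step_law_def, folded p_eq]
    note EM = C.expected_mass_compound[OF up, of k "u + c * mesh k", folded E_def mean_def step_law_def]
    have "(l * exp (- (l * mesh k)) * E k) * mesh k \<le> (c * p k u) * mesh k"
      using L(2) EM(1) by (simp add: mult_ac)
    then show "l * exp (- (l * mesh k)) * E k \<le> c * p k u" using h by simp
    have "(c * p k (u + c * mesh k)) * mesh k
      \<le> (l * exp (- (l * mesh k)) * E k + l * (1 - exp (- (l * mesh k))) * mean D) * mesh k"
      using L(1) EM(2) by (simp add: algebra_simps)
    then show "c * p k (u + c * mesh k) \<le> l * exp (- (l * mesh k)) * E k + l * (1 - exp (- (l * mesh k))) * mean D"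
      using h by simp
  qed
  have Elim: "E \<longlonglongrightarrow> D.expected_mass ruin_prob u"
    unfolding E_def[abs_def] D.expected_mass_eq[OF up] D.expected_mass_eq[OF unit_valued_ruin_prob]
  proof (rule integral_dominated_convergence[where w="\<lambda>y. if 0 \<le> y then ccdf D y else 0"])
    note [measurable] = unit_valuedD(1)[OF up] unit_valuedD(1)[OF unit_valued_ruin_prob]
    show "(\<lambda>y. if 0 \<le> y then ruin_prob (u - y) * ccdf D y else 0) \<in> borel_measurable lborel" by measurable
    show "(\<lambda>y. if 0 \<le> y then p k (u + c * mesh k - y) * ccdf D y else 0) \<in> borel_measurable lborel" for k by measurable
    show "integrable lborel (\<lambda>y. if 0 \<le> y then ccdf D y else 0)" by (rule D.integrable_ccdf)
    have "(\<lambda>k. p k (u + c * mesh k - y)) \<longlonglongrightarrow> ruin_prob (u - y)" for y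
      using ruin_prob_limit[of c "u - y"] c_pos by (simp add: p_def algebra_simps)
    then show "AE y in lborel. (\<lambda>k. if 0 \<le> y then p k (u + c * mesh k - y) * ccdf D y else 0)
        \<longlonglongrightarrow> (if 0 \<le> y then ruin_prob (u - y) * ccdf D y else 0)"
      by (intro AE_I2) (auto intro!: tendsto_intros)
    show "AE y in lborel. norm (if 0 \<le> y then p k (u + c * mesh k - y) * ccdf D y else 0) \<le> (if 0 \<le> y then ccdf D y else 0)" for k
      using unit_valuedD[OF up] D.ccdf_bounds by (intro AE_I2) (auto simp: abs_mult intro!: mult_left_le_one_le)
  qed
  have exp_lim: "(\<lambda>k. exp (- (l * mesh k))) \<longlonglongrightarrow> exp (- (l * 0))"
    by (intro tendsto_intros mesh_tendsto)
  have "l * exp (- (l * 0)) * D.expected_mass ruin_prob u \<le> c * ruin_prob u"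
  proof (rule LIMSEQ_le)
    show "(\<lambda>k. l * exp (- (l * mesh k)) * E k) \<longlonglongrightarrow> l * exp (- (l * 0)) * D.expected_mass ruin_prob u"
      by (intro tendsto_intros exp_lim Elim)
    show "(\<lambda>k. c * p k u) \<longlonglongrightarrow> c * ruin_prob u"
      unfolding p_def using ruin_prob_limit[of 0 u] by (intro tendsto_intros) simp
  qed (use bounds in auto)
  moreover have "c * ruin_prob u \<le> l * exp (- (l * 0)) * D.expected_mass ruin_prob u + l * (1 - exp (- (l * 0))) * mean D"
  proof (rule LIMSEQ_le)
    show "(\<lambda>k. l * exp (- (l * mesh k)) * E k + l * (1 - exp (- (l * mesh k))) * mean D)
      \<longlonglongrightarrow> l * exp (- (l * 0)) * D.expected_mass ruin_prob u + l * (1 - exp (- (l * 0))) * mean D"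
      by (intro tendsto_add tendsto_mult tendsto_diff tendsto_const exp_lim Elim)
    show "(\<lambda>k. c * p k (u + c * mesh k)) \<longlonglongrightarrow> c * ruin_prob u"
      unfolding p_def using ruin_prob_limit[of c u] c_pos by (intro tendsto_intros) simp
  qed (use bounds in auto)
  ultimately show ?thesis by simp
qed


end

section \<open>The ladder height law\<close>

text \<open>F_I through its density, so that integrals against it reduce to
  \<open>expected_mass\<close>; \<open>interval_measure_integrated_tail\<close> identifies it with
  the measure in the theorem.\<close>

definition ladder_law :: "real measure \<Rightarrow> real measure" where
  "ladder_law D = density lborel (\<lambda>y. ennreal (if 0 \<le> y then ccdf D y / mean D else 0))"

lemma mean_pos:
  assumes "claim_size_law D"
  shows "0 < mean D"
proof -
  interpret real_distribution D using assms by (simp add: claim_size_law_def)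
  have "AE x in D. 0 < x" "integrable D (\<lambda>x. x)" using assms by (simp_all add: claim_size_law_def)
  then have "expectation (\<lambda>x. 0) < expectation (\<lambda>x. x)"
    by (intro integral_less_AE_space) (auto simp: emeasure_space_1[simplified])
  then show ?thesis by (simp add: mean_def)
qed

locale positive_step = nonneg_step +
  assumes mean_positive: "0 < mean \<nu>"
begin

lemma expected_mass_one: "expected_mass (\<lambda>_. 1) 0 = mean \<nu>"
proof -
  have one: "unit_valued (\<lambda>_. 1)" by (simp add: unit_valued_def)
  have "expected_mass (\<lambda>_. 1) 0 = (LINT s|\<nu>. s)"
    unfolding expected_mass_def
  proof (rule integral_cong_AE)
    show "AE s in \<nu>. mass_between (\<lambda>_. 1) (0 - s) 0 = s"
      using AE_nonneg
    proof eventually_elim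
      case (elim s)
      then show ?case
        using mass_between_le[OF one, of "0 - s" 0 1] mass_between_ge[OF one, of "0 - s" 0 1] by simp
    qed
  qed (rule mass_between_measurable_step[OF one], simp)
  then show ?thesis by (simp add: mean_def)
qed

lemma density_nonneg: "0 \<le> (if 0 \<le> y then ccdf \<nu> y / mean \<nu> else 0)"
  using ccdf_bounds mean_positive by simp

lemma integral_ladder_law:
  assumes q: "unit_valued q"
  shows "(LINT y|ladder_law \<nu>. q (u - y)) = expected_mass q u / mean \<nu>"
proof -
  note [measurable] = unit_valuedD(1)[OF q]
  have "(LINT y|ladder_law \<nu>. q (u - y)) = (LINT y|lborel. (if 0 \<le> y then ccdf \<nu> y / mean \<nu> else 0) *\<^sub>R q (u - y))"
    unfolding ladder_law_def
    by (rule integral_density) (use density_nonneg in auto)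
  also have "\<dots> = (LINT y|lborel. (if 0 \<le> y then q (u - y) * ccdf \<nu> y else 0) / mean \<nu>)"
    by (intro Bochner_Integration.integral_cong) auto
  finally show ?thesis by (simp add: expected_mass_eq[OF q])
qed

lemma real_distribution_ladder_law: "real_distribution (ladder_law \<nu>)"
proof -
  have one: "unit_valued (\<lambda>_. 1)" by (simp add: unit_valued_def)
  have "emeasure (ladder_law \<nu>) (space (ladder_law \<nu>))
      = (\<integral>\<^sup>+y. ennreal (if 0 \<le> y then ccdf \<nu> y / mean \<nu> else 0) \<partial>lborel)"
    unfolding ladder_law_def by (subst emeasure_density) (auto intro!: nn_integral_cong)
  also have "\<dots> = (\<integral>\<^sup>+y. ennreal (1 / mean \<nu>) * ennreal (if 0 \<le> y then 1 * ccdf \<nu> y else 0) \<partial>lborel)"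
    using mean_positive by (intro nn_integral_cong) (auto simp: ennreal_mult[symmetric] ccdf_bounds)
  also have "\<dots> = ennreal (1 / mean \<nu>) * ennreal (mean \<nu>)"
    by (subst nn_integral_cmult) (auto simp: nn_integral_expected_mass[OF one, of 0] expected_mass_one)
  also have "\<dots> = 1" using mean_positive by (simp add: ennreal_mult[symmetric])
  finally have "prob_space (ladder_law \<nu>)" by (rule prob_spaceI)
  then show ?thesis
    by (simp add: real_distribution_def real_distribution_axioms_def ladder_law_def)
qed

lemma cdf_ladder_law: "cdf (ladder_law \<nu>) = integrated_tail \<nu>"
proof
  fix x
  interpret L: real_distribution "ladder_law \<nu>" by (rule real_distribution_ladder_law)
  have "cdf (ladder_law \<nu>) x = (LINT y|ladder_law \<nu>. indicator {..x} y)"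
    by (simp add: cdf_def)
  also have "\<dots> = (LINT y|lborel. (if 0 \<le> y then ccdf \<nu> y / mean \<nu> else 0) *\<^sub>R indicator {..x} y)"
    unfolding ladder_law_def
    by (rule integral_density) (use density_nonneg in auto)
  also have "\<dots> = (LINT y|lborel. (1 / mean \<nu>) * (indicator {0..x} y *\<^sub>R (1 - cdf \<nu> y)))"
    by (intro Bochner_Integration.integral_cong) (auto simp: ccdf_def split: split_indicator)
  finally show "cdf (ladder_law \<nu>) x = integrated_tail \<nu> x"
    by (simp add: integrated_tail_def set_lebesgue_integral_def)
qed

lemma interval_measure_integrated_tail: "interval_measure (integrated_tail \<nu>) = ladder_law \<nu>"
proof -
  interpret L: real_distribution "ladder_law \<nu>" by (rule real_distribution_ladder_law)
  note F = L.cdf_nondecreasing L.cdf_is_right_cont L.cdf_lim_at_bot L.cdf_lim_at_top_prob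
  have "real_distribution (interval_measure (cdf (ladder_law \<nu>)))"
    by (rule real_distribution_interval_measure[OF F])
  moreover have "cdf (interval_measure (cdf (ladder_law \<nu>))) = cdf (ladder_law \<nu>)"
    by (rule cdf_interval_measure[OF F(1-3)])
  ultimately have "interval_measure (cdf (ladder_law \<nu>)) = ladder_law \<nu>"
    using L.real_distribution_axioms by (intro cdf_unique)
  then show ?thesis by (simp add: cdf_ladder_law)
qed

end

lemma (in cramer_lundberg) ruin_prob_renewal:
  assumes "0 \<le> u"
  shows "ruin_prob u = l * mean D / c * (LINT y|ladder_law D. ruin_prob (u - y))"
proof -
  interpret D: positive_step D by unfold_locales (rule mean_pos[OF claims])
  show ?thesis
    using ruin_prob_ladder[OF assms] D.mean_positive c_pos
    by (simp add: D.integral_ladder_law[OF unit_valued_ruin_prob] field_simps)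
qed

section \<open>Small deficits at ruin\<close>

(* The skeleton at integer times has the same law in the model and in this copy, in which the whole
   claim number process is independent of the claims. In both, the ruin probability lies between the
   skeleton ruin probabilities from levels that differ by one period's premium c. *)
lemma (in poisson_claims) product_copy:
  "cramer_lundberg (M \<Otimes>\<^sub>M M) (\<lambda>t \<omega>. N t (fst \<omega>)) (\<lambda>i \<omega>. X i (snd \<omega>)) c l D"
proof -
  interpret MM: pair_prob_space M M ..
  let ?N = "\<lambda>t \<omega>. N t (fst \<omega>)" and ?X = "\<lambda>i \<omega>. X i (snd \<omega>)"
  have inc: "increment ?N h k \<omega> = increment N h k (fst \<omega>)" for h k \<omega>
    by (simp add: increment_def)
  have fst_law: "distr (M \<Otimes>\<^sub>M M) K (\<lambda>\<omega>. f (fst \<omega>)) = distr M K f" if f: "f \<in> measurable M K" for f and K :: "'z measure"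
  proof -
    have "distr (M \<Otimes>\<^sub>M M) K (\<lambda>\<omega>. f (fst \<omega>)) = distr (distr (M \<Otimes>\<^sub>M M) M fst) K f"
      by (subst distr_distr[OF f measurable_fst]) (simp add: comp_def)
    then show ?thesis by (simp only: distr_pair_fst)
  qed
  have snd_law: "distr (M \<Otimes>\<^sub>M M) K (\<lambda>\<omega>. f (snd \<omega>)) = distr M K f" if f: "f \<in> measurable M K" for f and K :: "'z measure"
  proof (rule measure_eqI)
    fix A assume "A \<in> sets (distr (M \<Otimes>\<^sub>M M) K (\<lambda>\<omega>. f (snd \<omega>)))"
    then have A: "A \<in> sets K" by simp
    have "(\<lambda>\<omega>. f (snd \<omega>)) -` A \<inter> space (M \<Otimes>\<^sub>M M) = space M \<times> (f -` A \<inter> space M)"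
      by (auto simp: space_pair_measure)
    then have "emeasure (distr (M \<Otimes>\<^sub>M M) K (\<lambda>\<omega>. f (snd \<omega>))) A = emeasure (M \<Otimes>\<^sub>M M) (space M \<times> (f -` A \<inter> space M))"
      by (subst emeasure_distr[OF measurable_compose[OF measurable_snd f] A]) simp
    also have "\<dots> = emeasure M (f -` A \<inter> space M)"
      using measurable_sets[OF f A] by (subst emeasure_pair_measure_Times) (simp_all add: emeasure_space_1)
    also have "\<dots> = emeasure (distr M K f) A" by (rule emeasure_distr[OF f A, symmetric])
    finally show "emeasure (distr (M \<Otimes>\<^sub>M M) K (\<lambda>\<omega>. f (snd \<omega>))) A = \<dots>" .
  qed simp
  have paths: "risk_paths (M \<Otimes>\<^sub>M M) ?N ?X c"
  proof
    show "counting_process (M \<Otimes>\<^sub>M M) ?N"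
      unfolding counting_process_def
    proof (intro conjI allI impI ballI)
      fix t :: real assume "0 \<le> t"
      then show "(\<lambda>\<omega>. N t (fst \<omega>)) \<in> measurable (M \<Otimes>\<^sub>M M) (count_space UNIV)"
        by (intro measurable_compose[OF measurable_fst] N_measurable)
    qed (use counting in \<open>auto simp: counting_process_def space_pair_measure\<close>)
    show "(\<lambda>\<omega>. X i (snd \<omega>)) \<in> borel_measurable (M \<Otimes>\<^sub>M M)" for i
      by (rule measurable_compose[OF measurable_snd claims_measurable])
    show "0 < c" by (rule c_pos)
  qed
  interpret C: poisson_claims "M \<Otimes>\<^sub>M M" ?N ?X c l D
  proof (intro poisson_claims.intro poisson_claims_axioms.intro paths)
    show "prob_space (M \<Otimes>\<^sub>M M)" by unfold_locales
    show "distr (M \<Otimes>\<^sub>M M) count_sequences (\<lambda>\<omega> k. increment ?N h k \<omega>) = PiM UNIV (\<lambda>_. poisson_law (l * h))"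
      if "0 \<le> h" for h
      unfolding inc fst_law[OF increments_measurable[OF that]] by (rule increments_law[OF that])
    show "distr (M \<Otimes>\<^sub>M M) real_sequences (\<lambda>\<omega> i. X i (snd \<omega>)) = PiM UNIV (\<lambda>_. D)"
      unfolding snd_law[OF claims_sequence_measurable] by (rule claims_law)
  qed (fact claims rate net_profit)+
  show ?thesis
  proof (intro cramer_lundberg.intro cramer_lundberg_axioms.intro C.poisson_claims_axioms)
    fix h :: real assume h: "0 \<le> h"
    have sf: "sigma_finite_measure (distr M real_sequences (\<lambda>\<omega> i. X i \<omega>))"
      by (intro prob_space_imp_sigma_finite prob_space_distr claims_sequence_measurable)
    show "C.decoupled h"
      unfolding C.decoupled_def inc fst_law[OF increments_measurable[OF h]] snd_law[OF claims_sequence_measurable]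
      by (subst pair_measure_distr[OF increments_measurable[OF h] claims_sequence_measurable sf])
         (simp only: case_prod_unfold)
  qed
qed

lemma (in poisson_claims) skeleton_ruin_sandwich:
  assumes dec: "decoupled 1"
  obtains \<psi> where "unit_valued \<psi>" "\<And>u. u < 0 \<Longrightarrow> \<psi> u = 1"
    "\<And>u. 0 \<le> u \<Longrightarrow> \<psi> u = l * mean D / c * (LINT y|ladder_law D. \<psi> (u - y))"
    "\<And>u. skeleton_ruin u \<le> \<psi> u" "\<And>u. \<psi> (u + c) \<le> skeleton_ruin u"
proof -
  interpret P: cramer_lundberg "M \<Otimes>\<^sub>M M" "\<lambda>t \<omega>. N t (fst \<omega>)" "\<lambda>i \<omega>. X i (snd \<omega>)" c l D
    by (rule product_copy)
  \<comment> \<open>Both sides are the first-passage probability of the walk with step law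
    \<open>step_law 1\<close>, which is determined by c, l and D.\<close>
  have eq: "P.skeleton_ruin u = skeleton_ruin u" for u
    by (simp add: skeleton_ruin_eq[OF dec] P.skeleton_ruin_eq[OF P.decoupled])
  show thesis
  proof (rule that[of P.ruin_prob])
    show "unit_valued P.ruin_prob" by (rule P.unit_valued_ruin_prob)
    show "P.ruin_prob u = 1" if "u < 0" for u using P.ruin_prob_neg[OF that] .
    show "P.ruin_prob u = l * mean D / c * (LINT y|ladder_law D. P.ruin_prob (u - y))" if "0 \<le> u" for u
      by (rule P.ruin_prob_renewal[OF that])
    show "skeleton_ruin u \<le> P.ruin_prob u" for u using P.skeleton_ruin_le[of u] by (simp add: eq)
    show "P.ruin_prob (u + c) \<le> skeleton_ruin u" for u using P.ruin_prob_le_skeleton[of u] by (simp add: eq)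
  qed
qed

lemma measurable_nat_sum:
  fixes j :: nat
  assumes g: "\<And>m. (\<lambda>z. g m z :: nat) \<in> measurable M (count_space UNIV)"
  shows "(\<lambda>z. \<Sum>m<j. g m z) \<in> measurable M (count_space UNIV)"
proof (induction j)
  case (Suc j)
  note [measurable] = Suc g
  show ?case by simp
qed simp

section \<open>From a small deficit at ruin to the integer skeleton\<close>

context poisson_claims
begin

(* With n_j the number of claims up to time j, (k, i) is the first pair with n_k <= i such that, the
   premium of period k being credited at its beginning, the surplus after i claims is below c. Unlike
   the ruin time, this depends on the integer skeleton and the claims only. *)
definition first_deficit :: "real \<Rightarrow> real \<Rightarrow> nat \<Rightarrow> nat \<Rightarrow> nat \<Rightarrow> (nat \<Rightarrow> nat) \<Rightarrow> (nat \<Rightarrow> real) \<Rightarrow> bool" where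
  "first_deficit R u k i a ns x \<longleftrightarrow>
     (\<forall>j\<in>{..k}. c \<le> u + c * real j - (\<Sum>m<(\<Sum>m<j. ns m). x m)) \<and> (\<Sum>m<k. ns m) = a \<and> a \<le> i \<and>
     - R \<le> u + c * real (Suc k) - (\<Sum>m<i. x m) \<and> u + c * real (Suc k) - (\<Sum>m<i. x m) < c \<and>
     (\<forall>i'\<in>{a..<i}. c \<le> u + c * real (Suc k) - (\<Sum>m<i'. x m))"

text \<open>The constraint C on the count of period k is kept apart because
  \<open>first_deficit\<close> reads only the counts before k, so the two are independent.\<close>

definition deficit_event :: "real \<Rightarrow> real \<Rightarrow> nat \<times> nat \<times> nat \<Rightarrow> nat set \<Rightarrow> 'a set" where
  "deficit_event R u = (\<lambda>(k, i, a) C. {\<omega>\<in>space M. first_deficit R u k i a (\<lambda>m. increment N 1 m \<omega>) (\<lambda>m. X m \<omega>)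
     \<and> increment N 1 k \<omega> \<in> C})"

lemma first_deficit_measurable:
  "Measurable.pred (count_sequences \<Otimes>\<^sub>M real_sequences) (\<lambda>z. first_deficit R u k i a (fst z) (snd z))"
proof -
  have comp: "(\<lambda>z. fst z m) \<in> measurable (count_sequences \<Otimes>\<^sub>M real_sequences) (count_space UNIV)" for m
    by (rule measurable_compose[OF measurable_fst measurable_component_singleton]) simp
  have [measurable]: "(\<lambda>z. \<Sum>m<j. fst z m) \<in> measurable (count_sequences \<Otimes>\<^sub>M real_sequences) (count_space UNIV)" for j
    by (rule measurable_nat_sum[OF comp])
  have [measurable]: "(\<lambda>z. \<Sum>m<(\<Sum>m<j. fst z m). snd z m) \<in> borel_measurable (count_sequences \<Otimes>\<^sub>M real_sequences)" for j
    by (rule measurable_random_sum) simp_all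
  have [measurable]: "(\<lambda>z. \<Sum>m<j. snd z m) \<in> borel_measurable (count_sequences \<Otimes>\<^sub>M real_sequences)" for j
    by (rule measurable_random_sum) simp_all
  show ?thesis unfolding first_deficit_def by measurable
qed

lemma deficit_event_sets: "deficit_event R u q C \<in> sets M"
proof -
  obtain k i a where q: "q = (k, i, a)" by (cases q)
  have [measurable]: "(\<lambda>\<omega>. (\<lambda>m. increment N 1 m \<omega>, \<lambda>m. X m \<omega>)) \<in> measurable M (count_sequences \<Otimes>\<^sub>M real_sequences)"
    by (intro measurable_Pair increments_measurable claims_sequence_measurable) simp
  have [measurable]: "Measurable.pred M (\<lambda>\<omega>. first_deficit R u k i a (\<lambda>m. increment N 1 m \<omega>) (\<lambda>m. X m \<omega>))"
    using measurable_compose[OF _ first_deficit_measurable, of "\<lambda>\<omega>. (\<lambda>m. increment N 1 m \<omega>, \<lambda>m. X m \<omega>)" M] by simp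
  have [measurable]: "increment N 1 k \<in> measurable M (count_space UNIV)" by (rule increment_measurable) simp
  show ?thesis unfolding deficit_event_def q by simp
qed

lemma emeasure_deficit_event:
  assumes dec: "decoupled 1"
  shows "emeasure M (deficit_event R u (k, i, a) C)
    = emeasure M (deficit_event R u (k, i, a) UNIV) * emeasure (poisson_law l) C"
proof -
  interpret C: poisson_compound D "l * 1" by (rule poisson_compound_step) simp
  let ?f = "\<lambda>\<omega>. (\<lambda>m. increment N 1 m \<omega>, \<lambda>m. X m \<omega>)"
  let ?P = "count_sequences \<Otimes>\<^sub>M real_sequences"
  have f: "?f \<in> measurable M ?P"
    by (intro measurable_Pair increments_measurable claims_sequence_measurable) simp
  have law: "distr M ?P ?f = C.PN \<Otimes>\<^sub>M C.PX" by (rule joint_law[OF _ dec]) simp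
  have sets_eq: "sets (C.PN \<Otimes>\<^sub>M C.PX) = sets ?P"
    by (intro sets_pair_measure_cong C.sets_PN C.sets_PX)
  have eq: "emeasure M (deficit_event R u (k, i, a) C') =
      emeasure (C.PN \<Otimes>\<^sub>M C.PX) {z\<in>space (C.PN \<Otimes>\<^sub>M C.PX). first_deficit R u k i a (fst z) (snd z) \<and> fst z k \<in> C'}" for C'
  proof -
    let ?E = "{z\<in>space ?P. first_deficit R u k i a (fst z) (snd z) \<and> fst z k \<in> C'}"
    have [measurable]: "(\<lambda>z. fst z k) \<in> measurable ?P (count_space UNIV)"
      by (rule measurable_compose[OF measurable_fst measurable_component_singleton]) simp
    note [measurable] = first_deficit_measurable
    have E: "?E \<in> sets ?P" by measurable
    have "emeasure M (deficit_event R u (k, i, a) C') = emeasure M (?f -` ?E \<inter> space M)"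
    proof (rule arg_cong[where f="emeasure M"])
      show "deficit_event R u (k, i, a) C' = ?f -` ?E \<inter> space M"
        using measurable_space[OF f] by (auto simp: deficit_event_def)
    qed
    also have "\<dots> = emeasure (distr M ?P ?f) ?E" by (rule emeasure_distr[OF f E, symmetric])
    finally show ?thesis using sets_eq_imp_space_eq[OF sets_eq] by (simp add: law)
  qed
  have "emeasure (C.PN \<Otimes>\<^sub>M C.PX) {z\<in>space (C.PN \<Otimes>\<^sub>M C.PX). first_deficit R u k i a (fst z) (snd z) \<and> fst z k \<in> C}
    = emeasure (C.PN \<Otimes>\<^sub>M C.PX) {z\<in>space (C.PN \<Otimes>\<^sub>M C.PX). first_deficit R u k i a (fst z) (snd z)}
      * emeasure (poisson_law (l * 1)) C"
  proof (rule C.emeasure_next_count[OF first_deficit_measurable])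
    fix ns ns' :: "nat \<Rightarrow> nat" and x
    assume "\<And>m. m < k \<Longrightarrow> ns m = ns' m"
    then have "(\<Sum>m<j. ns m) = (\<Sum>m<j. ns' m)" if "j \<le> k" for j
      using that by (intro sum.cong) auto
    then show "first_deficit R u k i a ns x = first_deficit R u k i a ns' x"
      by (simp add: first_deficit_def)
  qed
  then show ?thesis by (simp add: eq)
qed

text \<open>k + 1 is the first integer time with surplus below c. It exists, since at the first
  integer time at or after ruin less than c of premium has been added to a negative surplus. i is
  the first claim number, counted from the start of period k, that brings the level below c; so
  period k has at least i - a claims.\<close>

lemma small_deficit_subset_events:
  assumes u: "c \<le> u" and R: "0 \<le> R"
    and \<omega>: "\<omega> \<in> small_deficit R u" and pos: "\<forall>i. 0 \<le> X i \<omega>"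
  shows "\<exists>k i a. \<omega> \<in> deficit_event R u (k, i, a) {i - a..}"
proof -
  define S where "S i = (\<Sum>m<i. X m \<omega>)" for i
  have S_mono: "S i \<le> S j" if "i \<le> j" for i j
    unfolding S_def using pos that by (intro sum_mono2) auto
  have \<omega>M: "\<omega> \<in> space M" and ruin: "\<omega> \<in> ruined u" and R': "- R \<le> surplus_at_ruin u \<omega>"
    using \<omega> by (auto simp: small_deficit_def ruined_def)
  have u0: "0 \<le> u" using u c_pos by simp
  obtain T where T: "0 \<le> T" "surplus_at_ruin u \<omega> = U u T \<omega>" and before: "\<And>s. 0 \<le> s \<Longrightarrow> s < T \<Longrightarrow> 0 \<le> U u s \<omega>"
    and "\<And>e. 0 < e \<Longrightarrow> \<exists>s\<ge>T. s < T + e \<and> U u s \<omega> < 0"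
    using ruin_time_obtain[OF u0 ruin] by blast
  have UT: "U u T \<omega> < 0" "- R \<le> U u T \<omega>" using first_passage(1)[OF u0 ruin] R' T by auto
  have N_mono: "N s \<omega> \<le> N t \<omega>" if "0 \<le> s" "s \<le> t" for s t
    using counting \<omega>M that by (simp add: counting_process_def)
  have U_eq: "U u t \<omega> = u + c * t - S (N t \<omega>)" for t by (simp add: surplus_def S_def)
  have Nsum: "(\<Sum>m<j. increment N 1 m \<omega>) = N (real j) \<omega>" for j
    using sum_increment[OF \<omega>M, of 1 j] by simp
  obtain j where j: "T \<le> real j" "real j < T + 1"
    using grid_point[OF T(1), of 0] by (auto simp: mesh_0)
  have Uj: "U u (real j) \<omega> < c"
  proof -
    have "S (N T \<omega>) \<le> S (N (real j) \<omega>)" using T j by (intro S_mono N_mono)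
    moreover have "c * real j < c * (T + 1)" using j c_pos by simp
    ultimately show ?thesis using UT by (simp add: U_eq algebra_simps)
  qed
  define j0 where "j0 = (LEAST j. U u (real j) \<omega> < c)"
  have j0: "U u (real j0) \<omega> < c" "j0 \<le> j"
    unfolding j0_def by (rule LeastI[of _ j], rule Uj) (rule Least_le, rule Uj)
  have pre: "c \<le> U u (real j') \<omega>" if "j' < j0" for j'
    using not_less_Least[of j' "\<lambda>j. U u (real j) \<omega> < c"] that by (simp add: j0_def)
  have "j0 \<noteq> 0" using j0(1) U_0[OF \<omega>M, of u] u by (intro notI) simp
  then obtain k where k: "j0 = Suc k" using not0_implies_Suc by blast
  define a where "a = N (real k) \<omega>"
  define L where "L i = u + c * real (Suc k) - S i" for i
  have L_anti: "L i' \<le> L i" if "i \<le> i'" for i i' using S_mono[OF that] by (simp add: L_def)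
  define P where "P i \<longleftrightarrow> a \<le> i \<and> L i < c" for i
  define i where "i = (LEAST i. P i)"
  have PN1: "P (N (real (Suc k)) \<omega>)"
  proof -
    have "a \<le> N (real (Suc k)) \<omega>" unfolding a_def by (rule N_mono) auto
    then show ?thesis using j0 by (simp add: P_def L_def U_eq k)
  qed
  have Pi: "P i" unfolding i_def by (rule LeastI[of P, OF PN1])
  have iN: "i \<le> N (real (Suc k)) \<omega>" unfolding i_def by (rule Least_le[of P, OF PN1])
  have i_min: "c \<le> L i'" if "a \<le> i'" "i' < i" for i'
    using not_less_Least[of i' P] that by (auto simp: i_def P_def)
  \<comment> \<open>If k + 1 precedes the last integer time j found above, it lies before T, where
    the surplus is nonnegative, and the level after i claims is no lower. Otherwise T lies in period
    k: the claims up to T already bring the level below c, so i is at most their number, and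
    crediting the premium early only raises the level above U T >= - R.\<close>
  have LR: "- R \<le> L i"
  proof (cases "j0 < j")
    case True
    then have "real j0 + 1 \<le> real j" by linarith
    then have "real j0 < T" using j by linarith
    then have "0 \<le> U u (real j0) \<omega>" by (intro before) simp
    then have "0 \<le> L (N (real (Suc k)) \<omega>)" by (simp add: L_def U_eq k)
    also have "\<dots> \<le> L i" by (rule L_anti[OF iN])
    finally show ?thesis using R by simp
  next
    case False
    then have jk: "j = Suc k" using j0 k by simp
    have "P (N T \<omega>)"
    proof -
      have "real k < T" using j jk by simp
      then have "a \<le> N T \<omega>" unfolding a_def by (intro N_mono) auto
      moreover have "c * real (Suc k) < c * (T + 1)" using j jk c_pos by (intro mult_strict_left_mono) auto
      then have "L (N T \<omega>) < c" using UT unfolding L_def U_eq by (simp add: algebra_simps)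
      ultimately show ?thesis by (simp add: P_def)
    qed
    then have "i \<le> N T \<omega>" unfolding i_def by (rule Least_le)
    then have "L (N T \<omega>) \<le> L i" by (rule L_anti)
    moreover have "c * T \<le> c * real (Suc k)" using j jk c_pos by (intro mult_left_mono) auto
    then have "U u T \<omega> \<le> L (N T \<omega>)" unfolding L_def U_eq by simp
    ultimately show ?thesis using UT by linarith
  qed
  have "\<omega> \<in> deficit_event R u (k, i, a) {i - a..}"
    unfolding deficit_event_def first_deficit_def
  proof (simp only: prod.case mem_Collect_eq Nsum S_def[symmetric] L_def[symmetric], intro conjI ballI \<omega>M)
    fix j' assume "j' \<in> {..k}"
    then show "c \<le> u + c * real j' - S (N (real j') \<omega>)" using pre[of j'] k by (simp add: U_eq)
  next
    show "increment N 1 k \<omega> \<in> {i - a..}" using iN by (simp add: increment_def a_def diff_le_mono)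
  next
    fix i' assume "i' \<in> {a..<i}"
    then show "c \<le> L i'" using i_min by simp
  qed (use Pi LR in \<open>auto simp: P_def a_def\<close>)
  then show ?thesis by blast
qed

text \<open>With exactly i - a claims in period k, i is the total count at time k + 1, so the level
  in \<open>first_deficit\<close> is the surplus at that integer time. The path thus determines the
  triple, and these events are disjoint for different triples.\<close>

lemma deficit_event_skeleton:
  assumes \<omega>: "\<omega> \<in> deficit_event R u (k, i, a) {i - a}"
  shows "\<forall>j\<le>k. c \<le> U u (real j) \<omega>" "U u (real (Suc k)) \<omega> < c" "- R \<le> U u (real (Suc k)) \<omega>"
    "i = N (real (Suc k)) \<omega>" "a = N (real k) \<omega>" "\<omega> \<in> space M"
proof -
  show \<omega>M: "\<omega> \<in> space M" using \<omega> by (simp add: deficit_event_def)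
  have Nsum: "(\<Sum>m<j. increment N 1 m \<omega>) = N (real j) \<omega>" for j
    using sum_increment[OF \<omega>M, of 1 j] by simp
  have E: "first_deficit R u k i a (\<lambda>m. increment N 1 m \<omega>) (\<lambda>m. X m \<omega>)" and inc: "increment N 1 k \<omega> = i - a"
    using \<omega> by (simp_all add: deficit_event_def)
  show "\<forall>j\<le>k. c \<le> U u (real j) \<omega>" using E by (simp add: first_deficit_def Nsum surplus_def)
  show a: "a = N (real k) \<omega>" using E by (simp add: first_deficit_def Nsum)
  have "(\<Sum>m<Suc k. increment N 1 m \<omega>) = i"
    using E inc by (simp add: first_deficit_def)
  then show i: "i = N (real (Suc k)) \<omega>" unfolding Nsum by simp
  show "U u (real (Suc k)) \<omega> < c" "- R \<le> U u (real (Suc k)) \<omega>"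
    using E unfolding surplus_def i[symmetric] first_deficit_def by simp_all
qed

(* Given that period k has at least i - a claims, it has exactly that many with probability at least
   exp (- l); the skeleton then shows the same deficit at time k + 1, up to the premium c. *)
lemma small_deficit_le_skeleton:
  assumes dec: "decoupled 1" and u: "c \<le> u" and R: "0 \<le> R"
  shows "prob (small_deficit R u) \<le> exp l * prob (skeleton_hits {-(R + c)..<0} 0 (u - c))"
proof -
  define q where "q n = (fst (prod_decode n), prod_decode (snd (prod_decode n)))" for n
  have q_inj: "inj q"
  proof (rule injI)
    fix m n assume "q m = q n"
    then have "fst (prod_decode m) = fst (prod_decode n)" "snd (prod_decode m) = snd (prod_decode n)"
      using inj_prod_decode[of UNIV] by (auto simp: q_def inj_def)
    then show "m = n" using inj_prod_decode[of UNIV] by (metis injD prod_eq_iff)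
  qed
  have q_surj: "\<exists>n. q n = z" for z
  proof -
    have "q (prod_encode (fst z, prod_encode (snd z))) = z" by (simp add: q_def)
    then show ?thesis by blast
  qed
  define A where "A n = deficit_event R u (q n) {fst (snd (q n)) - snd (snd (q n))..}" for n
  define B where "B n = deficit_event R u (q n) {fst (snd (q n)) - snd (snd (q n))}" for n
  have AB: "emeasure M (A n) \<le> ennreal (exp l) * emeasure M (B n)" for n
  proof -
    interpret C: poisson_compound D l using poisson_compound_step[of 1] by simp
    obtain k i a where n: "q n = (k, i, a)" by (cases "q n")
    have "emeasure M (A n) = emeasure M (deficit_event R u (k, i, a) UNIV) * emeasure (poisson_law l) {i - a..}"
      unfolding A_def n fst_conv snd_conv by (rule emeasure_deficit_event[OF dec])
    also have "\<dots> \<le> emeasure M (deficit_event R u (k, i, a) UNIV) * (ennreal (exp l) * emeasure (poisson_law l) {i - a})"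
      by (intro mult_left_mono C.emeasure_poisson_atLeast_le) simp
    also have "\<dots> = ennreal (exp l) * emeasure M (B n)"
      unfolding B_def n fst_conv snd_conv emeasure_deficit_event[OF dec, of R u k i a "{i - a}"] by (simp add: mult_ac)
    finally show ?thesis .
  qed
  \<comment> \<open>The exact-count events must be disjoint so that the sum of their probabilities
    is the probability of their union; for the family A countable subadditivity suffices.\<close>
  have disj: "disjoint_family B"
    unfolding disjoint_family_on_def
  proof (intro ballI impI)
    fix m n :: nat assume "m \<noteq> n"
    show "B m \<inter> B n = {}"
    proof (rule ccontr)
      assume "B m \<inter> B n \<noteq> {}"
      then obtain \<omega> where \<omega>: "\<omega> \<in> B m" "\<omega> \<in> B n" by blast
      obtain k i a where m: "q m = (k, i, a)" by (cases "q m")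
      obtain k' i' a' where n: "q n = (k', i', a')" by (cases "q n")
      note 1 = deficit_event_skeleton[of \<omega> R u k i a, OF \<omega>(1)[unfolded B_def m fst_conv snd_conv]]
      note 2 = deficit_event_skeleton[of \<omega> R u k' i' a', OF \<omega>(2)[unfolded B_def n fst_conv snd_conv]]
      have "k = k'"
      proof (rule ccontr)
        assume "k \<noteq> k'"
        then consider "Suc k \<le> k'" | "Suc k' \<le> k" by linarith
        then show False
        proof cases
          assume "Suc k \<le> k'"
          then show False using 1(2) 2(1) by (metis not_le)
        next
          assume "Suc k' \<le> k"
          then show False using 2(2) 1(1) by (metis not_le)
        qed
      qed
      then have "q m = q n" using 1(4,5) 2(4,5) m n by simp
      then show False using q_inj \<open>m \<noteq> n\<close> by (auto dest: injD)
    qed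
  qed
  have Asets: "A n \<in> sets M" and Bsets: "B n \<in> sets M" for n
    unfolding A_def B_def by (rule deficit_event_sets)+
  have "emeasure M (small_deficit R u) \<le> emeasure M (\<Union>n. A n)"
  proof (rule emeasure_mono_AE)
    show "AE \<omega> in M. \<omega> \<in> small_deficit R u \<longrightarrow> \<omega> \<in> (\<Union>n. A n)"
      using AE_claims_nonneg
    proof eventually_elim
      case (elim \<omega>)
      show ?case
      proof
        assume "\<omega> \<in> small_deficit R u"
        then obtain k i a where "\<omega> \<in> deficit_event R u (k, i, a) {i - a..}"
          using small_deficit_subset_events[OF u R _ elim] by blast
        moreover obtain n where "q n = (k, i, a)" using q_surj by blast
        ultimately have "\<omega> \<in> A n" by (simp add: A_def)
        then show "\<omega> \<in> (\<Union>n. A n)" by blast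
      qed
    qed
  qed (use Asets in auto)
  also have "\<dots> \<le> (\<Sum>n. emeasure M (A n))"
    using Asets by (intro emeasure_subadditive_countably) auto
  also have "\<dots> \<le> (\<Sum>n. ennreal (exp l) * emeasure M (B n))"
    by (intro suminf_le AB) auto
  also have "\<dots> = ennreal (exp l) * emeasure M (\<Union>n. B n)"
    using Bsets disj by (subst ennreal_suminf_cmult) (simp add: suminf_emeasure image_subset_iff)
  also have "\<dots> \<le> ennreal (exp l) * emeasure M (skeleton_hits {-(R + c)..<0} 0 (u - c))"
  proof (intro mult_left_mono emeasure_mono skeleton_hits_sets subsetI)
    fix \<omega> assume "\<omega> \<in> (\<Union>n. B n)"
    then obtain n where n: "\<omega> \<in> B n" by blast
    obtain k i a where q: "q n = (k, i, a)" by (cases "q n")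
    note 1 = deficit_event_skeleton[of \<omega> R u k i a, OF n[unfolded B_def q fst_conv snd_conv]]
    have Uc: "U (u - c) t \<omega> = U u t \<omega> - c" for t by (simp add: surplus_def)
    show "\<omega> \<in> skeleton_hits {-(R + c)..<0} 0 (u - c)"
      using 1 by (auto simp: skeleton_hits_def mesh_0 Uc less_Suc_eq_le intro!: exI[of _ "Suc k"] simp del: of_nat_Suc)
  qed auto
  finally show ?thesis
    by (simp add: emeasure_eq_measure ennreal_mult[symmetric])
qed

text \<open>Lowering the start to u - c goes with widening the window of deficits to R + c, so the
  upper level in the overshoot estimate is u - c + (R + c) + K = u + R + K.\<close>

theorem small_deficit_prob:
  assumes dec: "decoupled 1" and u: "c \<le> u" and R: "0 \<le> R" "0 \<le> K"
  shows "(1 - skeleton_ruin K) * prob (small_deficit R u)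
    \<le> exp l * (skeleton_ruin (u - c) - skeleton_ruin (u + R + K))"
proof -
  interpret C: poisson_compound D "l * 1" by (rule poisson_compound_step) simp
  let ?A = "{-(R + c)..<0}"
  have A: "?A \<in> sets borel" "?A \<subseteq> {..<0}" by auto
  have Rc: "0 \<le> R + c" using R c_pos by simp
  have "(1 - skeleton_ruin K) * prob (skeleton_hits ?A 0 (u - c)) \<le> skeleton_ruin (u - c) - skeleton_ruin (u - c + (R + c) + K)"
  proof (rule LIMSEQ_le_const2)
    show "(\<lambda>n. (1 - skeleton_ruin K) * hit_prob (step_law 1) c ?A n (u - c))
      \<longlonglongrightarrow> (1 - skeleton_ruin K) * prob (skeleton_hits ?A 0 (u - c))"
      using prob_skeleton_hits[OF A, of 0 "u - c"] dec C.compound.hit_prob_LIMSEQ[OF A, of c "u - c"]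
      by (intro tendsto_intros) (simp add: mesh_0 step_law_def)
    show "\<exists>N. \<forall>n\<ge>N. (1 - skeleton_ruin K) * hit_prob (step_law 1) c ?A n (u - c)
      \<le> skeleton_ruin (u - c) - skeleton_ruin (u - c + (R + c) + K)"
      using C.compound.hit_prob_small_overshoot[OF Rc R(2), of c _ "u - c"]
      by (simp add: skeleton_ruin_eq[OF dec] step_law_def)
  qed
  moreover have "(1 - skeleton_ruin K) * prob (small_deficit R u)
      \<le> (1 - skeleton_ruin K) * (exp l * prob (skeleton_hits ?A 0 (u - c)))"
    using skeleton_ruin_bounds by (intro mult_left_mono small_deficit_le_skeleton[OF dec u R(1)]) simp
  ultimately have "(1 - skeleton_ruin K) * prob (small_deficit R u)
      \<le> exp l * (skeleton_ruin (u - c) - skeleton_ruin (u - c + (R + c) + K))"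
    by (smt (verit) exp_ge_zero mult.left_commute mult_left_mono)
  then show ?thesis by (simp add: algebra_simps)
qed

end

section \<open>The mixed model\<close>

lemma risk_paths_of_model:
  assumes "prob_space Q" "poisson_process Q l N" "iid_claims Q X D" "0 < c"
  shows "risk_paths Q N X c"
proof -
  interpret prob_space Q by fact
  show ?thesis
    using assms by unfold_locales (auto simp: poisson_process_def iid_claims_def indep_vars_def)
qed

lemma poisson_claims_of_model:
  assumes Q: "prob_space Q" and poisson: "poisson_process Q l N" and iid: "iid_claims Q X D"
    and c: "0 < c" and claims: "claim_size_law D" and rate: "0 \<le> l" "l * mean D < c"
  shows "poisson_claims Q N X c l D"
proof -
  interpret prob_space Q by fact
  interpret risk_paths Q N X c by (rule risk_paths_of_model[OF Q poisson iid c])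
  show ?thesis
  proof (intro poisson_claims.intro poisson_claims_axioms.intro Q risk_paths_axioms claims rate)
    have "distr Q real_sequences (\<lambda>\<omega>. \<lambda>i\<in>UNIV. X i \<omega>) = PiM UNIV (\<lambda>i. distr Q borel (X i))"
      using iid unfolding iid_claims_def by (subst (asm) indep_vars_iff_distr_eq_PiM) (auto intro: claims_measurable)
    then show "distr Q real_sequences (\<lambda>\<omega> i. X i \<omega>) = PiM UNIV (\<lambda>_. D)"
      using iid by (simp add: iid_claims_def restrict_def)
    fix h :: real assume h: "0 \<le> h"
    have inc_m: "increment N h k \<in> measurable Q (count_space UNIV)" for k
    proof -
      have [measurable]: "N (h * real j) \<in> measurable Q (count_space UNIV)" for j
        using h by (intro N_measurable) simp
      show ?thesis unfolding increment_def[abs_def] by measurable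
    qed
    have inc_law: "distr Q (count_space UNIV) (increment N h k) = poisson_law (l * h)" for k
    proof (rule measure_eqI_countable[where A=UNIV])
      fix j :: nat
      have eq: "h * real (Suc k) - h * real k = h" by (simp add: algebra_simps)
      have "emeasure (distr Q (count_space UNIV) (increment N h k)) {j} = emeasure Q (increment N h k -` {j} \<inter> space Q)"
        by (rule emeasure_distr[OF inc_m]) simp
      also have "increment N h k -` {j} \<inter> space Q = {\<omega>\<in>space Q. N (h * real (Suc k)) \<omega> - N (h * real k) \<omega> = j}"
        by (auto simp: increment_def)
      also have "prob \<dots> = exp (- (l * (h * real (Suc k) - h * real k))) * (l * (h * real (Suc k) - h * real k)) ^ j / fact j"
        using poisson h by (simp add: poisson_process_def mult_left_mono)
      then have "emeasure Q {\<omega>\<in>space Q. N (h * real (Suc k)) \<omega> - N (h * real k) \<omega> = j} = emeasure (poisson_law (l * h)) {j}"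
        unfolding eq using rate h by (simp add: emeasure_eq_measure emeasure_poisson_law)
      finally show "emeasure (distr Q (count_space UNIV) (increment N h k)) {j} = emeasure (poisson_law (l * h)) {j}" .
    qed (simp_all add: sets_poisson_law)
    have fin: "indep_vars (\<lambda>_. count_space UNIV) (increment N h) {..<n}" for n
    proof -
      have "mono (\<lambda>k. h * real k)" using h by (auto simp: mono_def mult_left_mono)
      then show ?thesis
        using poisson h unfolding poisson_process_def increment_def[abs_def]
        by (auto dest!: spec[of _ "\<lambda>k. h * real k"])
    qed
    have sub: "indep_sets F J" if J: "finite J" and F: "\<And>n. indep_sets F {..<n}" for F :: "nat \<Rightarrow> 'a set set" and J
    proof -
      obtain n where "J \<subseteq> {..<n}" using finite_nat_iff_bounded J by blast
      then show ?thesis using F indep_sets_mono_index by blast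
    qed
    have "indep_vars (\<lambda>_. count_space UNIV) (increment N h) UNIV"
      unfolding indep_vars_def2
      using fin inc_m sub
      by (subst indep_sets_finite_index_sets) (auto simp: indep_vars_def2)
    then have "distr Q count_sequences (\<lambda>\<omega>. \<lambda>k\<in>UNIV. increment N h k \<omega>) = PiM UNIV (\<lambda>k. distr Q (count_space UNIV) (increment N h k))"
      by (subst (asm) indep_vars_iff_distr_eq_PiM) (auto intro: inc_m)
    then show "distr Q count_sequences (\<lambda>\<omega> k. increment N h k \<omega>) = PiM UNIV (\<lambda>_. poisson_law (l * h))"
      by (simp add: inc_law restrict_def)
  qed
qed

(* Pitfall: indep_var forces both random sequences to have the same type, so the coercions inserted in
   independent_of_claims turn the claim number process into the real-valued sequence
   N 0, N 1, N 2, ... The hypothesis is thus independence of the claims from the counts at integer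
   times only. *)
lemma decoupled_of_model:
  assumes "poisson_claims Q N X c l D" and indep: "independent_of_claims Q N X"
  shows "poisson_claims.decoupled Q N X 1"
proof -
  interpret poisson_claims Q N X c l D by fact
  let ?S = "PiM {0..} (\<lambda>_::nat. count_space (UNIV::real set))"
  let ?Y = "\<lambda>\<omega> (k::nat). real ((\<lambda>t\<in>{0..}. N t \<omega>) (real k))"
  \<comment> \<open>Decodes the coerced counts: the floor recovers the natural number, and
    differences give the increments.\<close>
  let ?g = "\<lambda>(f::nat \<Rightarrow> real) k. nat \<lfloor>f (Suc k)\<rfloor> - nat \<lfloor>f k\<rfloor>"
  have Ym: "?Y \<in> measurable Q ?S" and prod: "distr Q ?S ?Y \<Otimes>\<^sub>M distr Q real_sequences (\<lambda>\<omega> i. X i \<omega>)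
      = distr Q (?S \<Otimes>\<^sub>M real_sequences) (\<lambda>\<omega>. (?Y \<omega>, \<lambda>i. X i \<omega>))"
    using indep unfolding independent_of_claims_def indep_var_distribution_eq by auto
  have g: "?g \<in> measurable ?S count_sequences"
  proof (rule measurable_PiM_single')
    fix k :: nat
    have [measurable]: "(\<lambda>f::nat \<Rightarrow> real. nat \<lfloor>f j\<rfloor>) \<in> measurable ?S (count_space UNIV)" for j
      by (rule measurable_compose[OF measurable_component_singleton[of j "{0..}" "\<lambda>_. count_space UNIV"]]) auto
    show "(\<lambda>f::nat \<Rightarrow> real. nat \<lfloor>f (Suc k)\<rfloor> - nat \<lfloor>f k\<rfloor>) \<in> measurable ?S (count_space UNIV)"
      by measurable
  qed auto
  have gY: "?g (?Y \<omega>) = (\<lambda>k. increment N 1 k \<omega>)" for \<omega>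
    by (auto simp: increment_def fun_eq_iff)
  have Xm: "(\<lambda>\<omega> i. X i \<omega>) \<in> measurable Q real_sequences" by (rule claims_sequence_measurable)
  have "distr Q count_sequences (\<lambda>\<omega> k. increment N 1 k \<omega>) \<Otimes>\<^sub>M distr Q real_sequences (\<lambda>\<omega> i. X i \<omega>)
      = distr (distr Q ?S ?Y) count_sequences ?g \<Otimes>\<^sub>M distr (distr Q real_sequences (\<lambda>\<omega> i. X i \<omega>)) real_sequences (\<lambda>x. x)"
  proof -
    have "distr (distr Q ?S ?Y) count_sequences ?g = distr Q count_sequences (\<lambda>\<omega> k. increment N 1 k \<omega>)"
      by (subst distr_distr[OF g Ym]) (simp only: comp_def gY)
    moreover have "distr (distr Q real_sequences (\<lambda>\<omega> i. X i \<omega>)) real_sequences (\<lambda>x. x) = distr Q real_sequences (\<lambda>\<omega> i. X i \<omega>)"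
      by (subst distr_distr[OF measurable_ident_sets[OF refl] Xm]) (simp only: comp_def)
    ultimately show ?thesis by (simp only:)
  qed
  also have "\<dots> = distr (distr Q ?S ?Y \<Otimes>\<^sub>M distr Q real_sequences (\<lambda>\<omega> i. X i \<omega>))
      (count_sequences \<Otimes>\<^sub>M real_sequences) (\<lambda>(f, x). (?g f, x))"
  proof (rule pair_measure_distr)
    show "?g \<in> measurable (distr Q ?S ?Y) count_sequences" using g by simp
    show "(\<lambda>x. x) \<in> measurable (distr Q real_sequences (\<lambda>\<omega> i. X i \<omega>)) real_sequences" by simp
    have p: "prob_space (distr Q real_sequences (\<lambda>\<omega> i. X i \<omega>))" by (rule prob_space_distr[OF Xm])
    show "sigma_finite_measure (distr (distr Q real_sequences (\<lambda>\<omega> i. X i \<omega>)) real_sequences (\<lambda>x. x))"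
      by (rule prob_space_imp_sigma_finite, rule prob_space.prob_space_distr[OF p]) simp
  qed
  also have "\<dots> = distr Q (count_sequences \<Otimes>\<^sub>M real_sequences) (\<lambda>\<omega>. (\<lambda>k. increment N 1 k \<omega>, \<lambda>i. X i \<omega>))"
  proof -
    have "(\<lambda>(f, x). (?g f, x)) \<in> measurable (?S \<Otimes>\<^sub>M real_sequences) (count_sequences \<Otimes>\<^sub>M real_sequences)"
      unfolding case_prod_unfold
      by (rule measurable_Pair[OF measurable_compose[OF measurable_fst g] measurable_snd])
    moreover have "(\<lambda>\<omega>. (?Y \<omega>, \<lambda>i. X i \<omega>)) \<in> measurable Q (?S \<Otimes>\<^sub>M real_sequences)"
      by (rule measurable_Pair[OF Ym Xm])
    ultimately show ?thesis
      unfolding prod by (subst distr_distr) (simp_all only: comp_def prod.case gY)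
  qed
  finally show ?thesis unfolding decoupled_def by (rule sym)
qed

text \<open>\<open>l0\<close> is an intensity in the set defining \<open>max_intensity\<close> that
  still satisfies the net profit condition; the strict bound on the infimum provides it. It bounds
  Lambda almost surely and keeps rho away from 1.\<close>

locale mixed_model =
  fixes M :: "'a measure" and \<Lambda> :: "'a \<Rightarrow> real" and K :: "real \<Rightarrow> 'a measure"
    and N :: "real \<Rightarrow> 'a \<Rightarrow> nat" and X :: "nat \<Rightarrow> 'a \<Rightarrow> real"
    and D :: "real measure" and c l0 :: real
  assumes model: "mixed_poisson_risk_model M \<Lambda> K N X D"
    and premium_pos: "0 < c"
    and l0: "0 \<le> l0" "cdf (distr M borel \<Lambda>) l0 = 1" "l0 * mean D < c"
    and subexp: "subexponential (ladder_law D)"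
begin

abbreviation G :: "real measure" where "G \<equiv> distr M borel \<Lambda>"

abbreviation tail :: "real \<Rightarrow> real" where "tail \<equiv> ccdf (ladder_law D)"

definition good :: "real \<Rightarrow> bool" where "good l \<longleftrightarrow> 0 \<le> l \<and> l \<le> l0"

text \<open>This is rho / (1 - rho) for rho = l mean D / c.\<close>

definition \<kappa> :: "real \<Rightarrow> real" where "\<kappa> l = l * mean D / (c - l * mean D)"

lemma claims: "claim_size_law D"
  using model by (simp add: mixed_poisson_risk_model_def)

lemma \<mu>_pos: "0 < mean D"
  by (rule mean_pos[OF claims])

sublocale prob_space M
  using model by (simp add: mixed_poisson_risk_model_def)

lemma \<Lambda>_measurable: "\<Lambda> \<in> borel_measurable M"
  using model by (simp add: mixed_poisson_risk_model_def)

sublocale G: real_distribution G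
  by (rule real_distribution_distr[OF \<Lambda>_measurable])

sublocale H: real_distribution "ladder_law D"
  using subexp by (simp add: subexponential_def)

lemma tail_pos: "0 < tail u"
  using subexp by (simp add: subexponential_def ccdf_def)

lemma K_measurable: "K \<in> measurable borel (prob_algebra M)"
  using model by (simp add: mixed_poisson_risk_model_def regular_conditional_probability_def)

lemma K_space: "sets (K l) = sets M" "prob_space (K l)" "space (K l) = space M"
proof -
  have "K l \<in> space (prob_algebra M)" using measurable_space[OF K_measurable] by simp
  then show "sets (K l) = sets M" "prob_space (K l)" by (simp_all add: space_prob_algebra)
  then show "space (K l) = space M" by (intro sets_eq_imp_space_eq)
qed

lemma AE_good: "AE l in G. good l"
proof -
  have "AE \<omega> in M. 0 \<le> \<Lambda> \<omega>" using model by (simp add: mixed_poisson_risk_model_def)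
  then have 1: "AE l in G. 0 \<le> l" by (subst AE_distr_iff[OF \<Lambda>_measurable]) simp_all
  have "G.prob {..l0} = 1" using l0 by (simp add: cdf_def)
  then have "AE l in G. l \<in> {..l0}" by (intro G.AE_prob_1)
  with 1 show ?thesis by eventually_elim (simp add: good_def)
qed

lemma good_net_profit: "good l \<Longrightarrow> l * mean D < c"
proof -
  assume "good l"
  then have "l * mean D \<le> l0 * mean D" using \<mu>_pos by (intro mult_right_mono) (auto simp: good_def)
  then show ?thesis using l0(3) by linarith
qed

lemma poisson_claims_K: "good l \<Longrightarrow> poisson_claims (K l) N X c l D"
  using model good_net_profit[of l] premium_pos
  by (intro poisson_claims_of_model K_space) (auto simp: mixed_poisson_risk_model_def good_def)

lemma decoupled_K: "good l \<Longrightarrow> poisson_claims.decoupled (K l) N X 1"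
  using model
  by (intro decoupled_of_model[OF poisson_claims_K]) (auto simp: mixed_poisson_risk_model_def good_def)

lemma good_0: "good 0"
  using l0 by (simp add: good_def)

text \<open>The assumptions concern paths and measurability, hence only the space and the
  sigma-algebra, which M shares with every K l. They are read off at intensity 0.\<close>

sublocale P: risk_paths M N X c
proof -
  interpret R: risk_paths "K 0" N X c
    using poisson_claims_K[OF good_0] by (simp add: poisson_claims_def)
  have m: "measurable (K 0) A = measurable M A" for A :: "'z measure"
    by (rule measurable_cong_sets[OF K_space(1) refl])
  show "risk_paths M N X c"
    using R.counting R.claims_measurable R.c_pos
    by unfold_locales (simp_all add: counting_process_def m K_space)
qed

lemma mixture: "A \<in> sets M \<Longrightarrow> measure M A = (LINT l|G. measure (K l) A)"
proof -
  assume A: "A \<in> sets M"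
  have "\<forall>A\<in>sets M. \<forall>B\<in>sets borel. measure M {\<omega>\<in>A. \<Lambda> \<omega> \<in> B} = (LINT l:B|G. measure (K l) A)"
    using model by (simp add: mixed_poisson_risk_model_def regular_conditional_probability_def)
  from bspec[OF bspec[OF this A], of UNIV]
  have "measure M {\<omega>\<in>A. \<Lambda> \<omega> \<in> UNIV} = (LINT l:UNIV|G. measure (K l) A)" by simp
  then show ?thesis by (simp add: set_lebesgue_integral_def)
qed

lemma measure_K_measurable: "A \<in> sets M \<Longrightarrow> (\<lambda>l. measure (K l) A) \<in> borel_measurable borel"
  by (rule measurable_compose[OF K_measurable measurable_measure_prob_algebra])

lemma integrable_measure_K: "A \<in> sets M \<Longrightarrow> integrable G (\<lambda>l. measure (K l) A)"
  using prob_space.prob_le_1[OF K_space(2)] measure_K_measurable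
  by (intro G.integrable_const_bound[where B=1]) auto

section \<open>Skeleton ruin, conditionally on the intensity and mixed\<close>

definition sk :: "real \<Rightarrow> real \<Rightarrow> real" where
  "sk l u = measure (K l) (P.skeleton_hits {..<0} 0 u)"

definition sk_mix :: "real \<Rightarrow> real" where
  "sk_mix u = prob (P.skeleton_hits {..<0} 0 u)"

definition ruin_mix :: "real \<Rightarrow> real" where
  "ruin_mix u = prob (P.ruined u)"

lemma skel_sets: "P.skeleton_hits {..<0} 0 u \<in> sets M"
  by (rule P.skeleton_hits_sets) simp

lemma
  assumes l: "good l"
  shows sk_eq: "poisson_claims.skeleton_ruin (K l) N X c u = sk l u"
    and ruined_eq: "risk_paths.ruined (K l) N X c u = P.ruined u"
    and small_deficit_eq: "risk_paths.small_deficit (K l) N X c R u = P.small_deficit R u"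
proof -
  interpret L: poisson_claims "K l" N X c l D by (rule poisson_claims_K[OF l])
  show "L.skeleton_ruin u = sk l u"
    by (simp add: L.skeleton_ruin_def sk_def L.skeleton_hits_def P.skeleton_hits_def K_space)
  show r: "L.ruined u = P.ruined u" by (simp add: L.ruined_def P.ruined_def K_space)
  show "L.small_deficit R u = P.small_deficit R u"
    by (simp add: L.small_deficit_def P.small_deficit_def r L.surplus_at_ruin_def P.surplus_at_ruin_def)
qed

lemma sk_le_ruin: "good l \<Longrightarrow> sk l u \<le> measure (K l) (P.ruined u)"
proof -
  assume l: "good l"
  interpret L: poisson_claims "K l" N X c l D by (rule poisson_claims_K[OF l])
  show ?thesis using L.skeleton_ruin_le[of u] by (simp add: L.ruin_prob_def sk_eq[OF l] ruined_eq[OF l])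
qed

lemma ruin_le_sk: "good l \<Longrightarrow> measure (K l) (P.ruined (u + c)) \<le> sk l u"
proof -
  assume l: "good l"
  interpret L: poisson_claims "K l" N X c l D by (rule poisson_claims_K[OF l])
  show ?thesis using L.ruin_prob_le_skeleton[of u] by (simp add: L.ruin_prob_def sk_eq[OF l] ruined_eq[OF l])
qed

lemma small_deficit_K:
  assumes l: "good l" and "c \<le> u" "0 \<le> R" "0 \<le> k"
  shows "(1 - sk l k) * measure (K l) (P.small_deficit R u) \<le> exp l * (sk l (u - c) - sk l (u + R + k))"
proof -
  interpret L: poisson_claims "K l" N X c l D by (rule poisson_claims_K[OF l])
  show ?thesis
    using L.small_deficit_prob[OF decoupled_K[OF l] assms(2-4)]
    by (simp add: sk_eq[OF l] small_deficit_eq[OF l])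
qed

lemma \<kappa>_mono: "0 \<le> l \<Longrightarrow> good l' \<Longrightarrow> l \<le> l' \<Longrightarrow> 0 \<le> \<kappa> l \<and> \<kappa> l \<le> \<kappa> l'"
proof -
  assume l: "0 \<le> l" "good l'" "l \<le> l'"
  have le: "l * mean D \<le> l' * mean D" using l \<mu>_pos by (intro mult_right_mono) auto
  have mono: "0 \<le> x / (c - x) \<and> x / (c - x) \<le> y / (c - y)" if "0 \<le> x" "x \<le> y" "y < c" for x y
    using that by (intro conjI divide_nonneg_nonneg frac_le) auto
  show ?thesis
    unfolding \<kappa>_def
    by (rule mono[OF mult_nonneg_nonneg[OF l(1) less_imp_le[OF \<mu>_pos]] le good_net_profit[OF l(2)]])
qed

lemma \<kappa>_bounds: "good l \<Longrightarrow> 0 \<le> \<kappa> l \<and> \<kappa> l \<le> \<kappa> l0"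
  using l0 by (intro \<kappa>_mono) (auto simp: good_def)

lemma \<kappa>_measurable [measurable]: "\<kappa> \<in> borel_measurable borel"
  unfolding \<kappa>_def[abs_def] by measurable

lemma integrable_\<kappa>: "integrable G \<kappa>"
proof (rule G.integrable_const_bound[where B="\<kappa> l0"])
  show "AE l in G. norm (\<kappa> l) \<le> \<kappa> l0" using AE_good by eventually_elim (use \<kappa>_bounds in auto)
qed simp

lemma tail_shift: "((\<lambda>u. tail (u + b) / tail u) \<longlongrightarrow> 1) at_top"
proof (cases "b \<le> 0")
  case True
  then show ?thesis using subexponential_long_tailed[OF subexp, of "- b"] by simp
next
  case False
  have sh: "filterlim (\<lambda>u. u + b) at_top at_top"
    using filterlim_tendsto_add_at_top[OF tendsto_const[of b] filterlim_ident] by (simp add: add.commute)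
  have "((\<lambda>u. tail (u + b - b) / tail (u + b)) \<longlongrightarrow> 1) at_top"
    using False by (intro filterlim_compose[OF subexponential_long_tailed[OF subexp] sh]) simp
  then have "((\<lambda>u. inverse (tail u / tail (u + b))) \<longlongrightarrow> inverse 1) at_top"
    by (intro tendsto_inverse) simp_all
  then show ?thesis by simp
qed

text \<open>The skeleton probability lies between psi (u + c) and psi u for a solution psi of the
  renewal equation. Half of eta pays for the asymptotics of psi, the other half for replacing tail
  (u + c) by tail u, which is possible since F_I is long-tailed. The threshold is common to all good
  l because rho <= rho1 for each of them.\<close>

lemma sk_uniform:
  assumes \<eta>: "0 < \<eta>"
  shows "\<exists>A. \<forall>u\<ge>A. \<forall>l. good l \<longrightarrow> \<bar>sk l u - \<kappa> l * tail u\<bar> \<le> \<eta> * tail u"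
proof -
  define \<rho>1 where "\<rho>1 = l0 * mean D / c"
  have \<rho>1: "0 \<le> \<rho>1" "\<rho>1 < 1" using l0 \<mu>_pos premium_pos by (simp_all add: \<rho>1_def)
  define e where "e = \<eta> / (2 * (\<kappa> l0 + 1))"
  have \<kappa>0: "0 \<le> \<kappa> l0" using \<kappa>_bounds[OF good_0] by linarith
  then have e: "0 < e" "\<kappa> l0 * e \<le> \<eta> / 2" using \<eta> by (auto simp: e_def field_simps)
  have "\<forall>\<^sub>F u in at_top. 1 - e < tail (u + c) / tail u"
    using order_tendstoD(1)[OF tail_shift] e by auto
  then obtain A1 where A1: "\<And>u. A1 \<le> u \<Longrightarrow> 1 - e < tail (u + c) / tail u"
    by (auto simp: eventually_at_top_linorder)
  obtain A2 where "0 \<le> A2" and A2: "\<forall>\<rho> \<psi>. 0 \<le> \<rho> \<longrightarrow> \<rho> \<le> \<rho>1 \<longrightarrow> \<psi> \<in> borel_measurable borel \<longrightarrow>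
     (\<forall>u. 0 \<le> \<psi> u \<and> \<psi> u \<le> 1) \<longrightarrow> (\<forall>u<0. \<psi> u = 1) \<longrightarrow>
     (\<forall>u\<ge>0. \<psi> u = \<rho> * (LINT y|ladder_law D. \<psi> (u - y))) \<longrightarrow>
     (\<forall>u\<ge>A2. \<bar>\<psi> u - \<rho> / (1 - \<rho>) * tail u\<bar> \<le> \<eta> / 2 * tail u)"
    using subexponential_renewal_asymptotics[OF subexp \<rho>1 half_gt_zero[OF \<eta>]] by (elim exE conjE) (rule that)
  have "\<bar>sk l u - \<kappa> l * tail u\<bar> \<le> \<eta> * tail u" if u: "max A1 A2 \<le> u" and l: "good l" for u l
  proof -
    interpret L: poisson_claims "K l" N X c l D by (rule poisson_claims_K[OF l])
    obtain \<psi> where \<psi>: "unit_valued \<psi>" "\<And>u. u < 0 \<Longrightarrow> \<psi> u = 1"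
      "\<And>u. 0 \<le> u \<Longrightarrow> \<psi> u = l * mean D / c * (LINT y|ladder_law D. \<psi> (u - y))"
      and up: "\<And>u. L.skeleton_ruin u \<le> \<psi> u" and lo: "\<And>u. \<psi> (u + c) \<le> L.skeleton_ruin u"
      using L.skeleton_ruin_sandwich[OF decoupled_K[OF l]] by blast
    define \<rho> where "\<rho> = l * mean D / c"
    have \<rho>: "0 \<le> \<rho>" "\<rho> \<le> \<rho>1"
      using l \<mu>_pos premium_pos by (auto simp: \<rho>_def \<rho>1_def good_def intro!: divide_right_mono mult_right_mono)
    have \<kappa>\<rho>: "\<rho> / (1 - \<rho>) = \<kappa> l"
      using premium_pos good_net_profit[OF l] by (simp add: \<rho>_def \<kappa>_def field_simps)
    have est: "\<bar>\<psi> v - \<kappa> l * tail v\<bar> \<le> \<eta> / 2 * tail v" if "A2 \<le> v" for v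
      unfolding \<kappa>\<rho>[symmetric]
    proof (rule A2[THEN spec[of _ \<rho>], THEN spec[of _ \<psi>], rule_format, OF \<rho> unit_valuedD(1)[OF \<psi>(1)] _ _ _ that])
      show "0 \<le> \<psi> u \<and> \<psi> u \<le> 1" for u using unit_valuedD[OF \<psi>(1)] by simp
      show "\<psi> u = 1" if "u < 0" for u by (rule \<psi>(2)[OF that])
      show "\<psi> u = \<rho> * (LINT y|ladder_law D. \<psi> (u - y))" if "0 \<le> u" for u
        unfolding \<rho>_def by (rule \<psi>(3)[OF that])
    qed
    have "\<psi> u \<le> \<kappa> l * tail u + \<eta> / 2 * tail u" using abs_le_D1[OF est[of u]] u by simp
    moreover have "\<eta> / 2 * tail u \<le> \<eta> * tail u" using \<eta> tail_pos[of u] by simp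
    moreover have "sk l u \<le> \<psi> u" using up[of u] by (simp add: sk_eq[OF l])
    ultimately have 1: "sk l u - \<kappa> l * tail u \<le> \<eta> * tail u" by linarith
    have "\<kappa> l * tail (u + c) - \<eta> / 2 * tail (u + c) \<le> sk l u"
    proof -
      have "A2 \<le> u + c" using u premium_pos by simp
      from abs_le_D2[OF est[OF this]] have "\<kappa> l * tail (u + c) - \<eta> / 2 * tail (u + c) \<le> \<psi> (u + c)" by linarith
      then show ?thesis using lo[of u] by (simp add: sk_eq[OF l])
    qed
    moreover have "tail (u + c) \<le> tail u" using premium_pos by (intro H.ccdf_antimono) simp
    then have "\<eta> / 2 * tail (u + c) \<le> \<eta> / 2 * tail u" using \<eta> by (intro mult_left_mono) auto
    moreover have "\<kappa> l * (tail u - tail (u + c)) \<le> \<eta> / 2 * tail u"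
    proof -
      have "tail u - tail (u + c) \<le> e * tail u"
        using A1[of u] u tail_pos[of u] by (simp add: field_simps)
      then have "\<kappa> l * (tail u - tail (u + c)) \<le> \<kappa> l0 * (e * tail u)"
        using \<kappa>_bounds[OF l] \<kappa>0 \<open>tail (u + c) \<le> tail u\<close> by (intro mult_mono) auto
      also have "\<dots> \<le> \<eta> / 2 * tail u" using mult_right_mono[OF e(2), of "tail u"] tail_pos[of u] by (simp add: mult.assoc)
      finally show ?thesis .
    qed
    ultimately have "- (\<eta> * tail u) \<le> sk l u - \<kappa> l * tail u" by (simp add: algebra_simps)
    with 1 show ?thesis by (simp add: abs_le_iff)
  qed
  then show ?thesis by blast
qed

definition \<kappa>_mix :: real where "\<kappa>_mix = (LINT l|G. \<kappa> l)"

lemma sk_mix_eq: "sk_mix u = (LINT l|G. sk l u)"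
  unfolding sk_mix_def sk_def by (rule mixture[OF skel_sets])

lemma integrable_sk: "integrable G (\<lambda>l. sk l u)"
  unfolding sk_def by (rule integrable_measure_K[OF skel_sets])

lemma sk_mix_tendsto: "((\<lambda>u. sk_mix u / tail u) \<longlongrightarrow> \<kappa>_mix) at_top"
proof (rule tendstoI)
  fix e :: real assume e: "0 < e"
  obtain A where A: "\<And>u l. A \<le> u \<Longrightarrow> good l \<Longrightarrow> \<bar>sk l u - \<kappa> l * tail u\<bar> \<le> e / 2 * tail u"
    using sk_uniform[of "e / 2"] e by auto
  show "\<forall>\<^sub>F u in at_top. dist (sk_mix u / tail u) \<kappa>_mix < e"
    using eventually_ge_at_top[of A]
  proof eventually_elim
    case (elim u)
    note u = this
    have i: "integrable G (\<lambda>l. sk l u - \<kappa> l * tail u)"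
      using integrable_sk integrable_\<kappa> by auto
    have eq: "sk_mix u - \<kappa>_mix * tail u = (LINT l|G. sk l u - \<kappa> l * tail u)"
      using integrable_sk integrable_\<kappa> by (simp add: sk_mix_eq \<kappa>_mix_def)
    have "\<bar>sk_mix u - \<kappa>_mix * tail u\<bar> \<le> (LINT l|G. \<bar>sk l u - \<kappa> l * tail u\<bar>)"
      unfolding eq by (rule integral_abs_bound)
    also have "\<dots> \<le> (LINT l|G. e / 2 * tail u)"
    proof (rule integral_mono_AE)
      show "AE l in G. \<bar>sk l u - \<kappa> l * tail u\<bar> \<le> e / 2 * tail u"
        using AE_good
      proof eventually_elim
        case (elim l)
        show ?case by (rule A[OF u elim])
      qed
      show "integrable G (\<lambda>l. \<bar>sk l u - \<kappa> l * tail u\<bar>)" by (rule integrable_abs[OF i])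
      show "integrable G (\<lambda>l. e / 2 * tail u)" by (rule G.integrable_const)
    qed
    also have "\<dots> = e / 2 * tail u" by (simp add: G.prob_space[unfolded G.space_eq_univ])
    finally have "\<bar>sk_mix u - \<kappa>_mix * tail u\<bar> / tail u \<le> e / 2"
      using tail_pos[of u] by (simp add: divide_le_eq)
    moreover have "sk_mix u / tail u - \<kappa>_mix = (sk_mix u - \<kappa>_mix * tail u) / tail u"
      using tail_pos[of u] by (simp add: field_simps)
    ultimately have "\<bar>sk_mix u / tail u - \<kappa>_mix\<bar> \<le> e / 2"
      using tail_pos[of u] by (simp only: abs_divide abs_of_pos)
    then show ?case unfolding dist_real_def using e by linarith
  qed
qed

lemma sk_mix_shift_tendsto: "((\<lambda>u. sk_mix (u + b) / tail u) \<longlongrightarrow> \<kappa>_mix) at_top"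
proof -
  have sh: "filterlim (\<lambda>u. u + b) at_top at_top"
    using filterlim_tendsto_add_at_top[OF tendsto_const[of b] filterlim_ident] by (simp add: add.commute)
  have "((\<lambda>u. sk_mix (u + b) / tail (u + b) * (tail (u + b) / tail u)) \<longlongrightarrow> \<kappa>_mix * 1) at_top"
    by (intro tendsto_mult filterlim_compose[OF sk_mix_tendsto sh] tail_shift)
  then show ?thesis using tail_pos by (simp add: less_imp_neq[THEN not_sym])
qed

lemma sk_mix_le_ruin_mix: "sk_mix u \<le> ruin_mix u"
  unfolding sk_mix_eq ruin_mix_def mixture[OF P.ruined_sets]
proof (rule integral_mono_AE)
  show "AE l in G. sk l u \<le> measure (K l) (P.ruined u)"
    using AE_good by eventually_elim (rule sk_le_ruin)
qed (intro integrable_sk integrable_measure_K P.ruined_sets)+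

lemma ruin_mix_le_sk_mix: "ruin_mix (u + c) \<le> sk_mix u"
  unfolding sk_mix_eq ruin_mix_def mixture[OF P.ruined_sets]
proof (rule integral_mono_AE)
  show "AE l in G. measure (K l) (P.ruined (u + c)) \<le> sk l u"
    using AE_good by eventually_elim (rule ruin_le_sk)
qed (intro integrable_sk integrable_measure_K P.ruined_sets)+

lemma ruin_mix_tendsto: "((\<lambda>u. ruin_mix u / tail u) \<longlongrightarrow> \<kappa>_mix) at_top"
proof (rule tendsto_sandwich[OF _ _ sk_mix_tendsto sk_mix_shift_tendsto[of "- c"]])
  show "\<forall>\<^sub>F u in at_top. sk_mix u / tail u \<le> ruin_mix u / tail u"
    using tail_pos sk_mix_le_ruin_mix by (intro always_eventually allI divide_right_mono) (auto intro: less_imp_le)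
  show "\<forall>\<^sub>F u in at_top. ruin_mix u / tail u \<le> sk_mix (u + - c) / tail u"
    using tail_pos ruin_mix_le_sk_mix[of "u - c" for u]
    by (intro always_eventually allI divide_right_mono) (auto intro: less_imp_le)
qed

text \<open>Choose k so large that skeleton ruin from k has probability at most 1/2 for all good l.
  Then \<open>small_deficit_K\<close> bounds small deficits by a constant times sk l (u - c) - sk l
  (u + R + k); after mixing, both terms divided by tail u tend to \<open>\<kappa>_mix\<close>, so
  the difference is o of the tail.\<close>

lemma small_deficit_tendsto:
  assumes R: "0 \<le> R"
  shows "((\<lambda>u. prob (P.small_deficit R u) / tail u) \<longlongrightarrow> 0) at_top"
proof -
  obtain A where A: "\<And>u l. A \<le> u \<Longrightarrow> good l \<Longrightarrow> \<bar>sk l u - \<kappa> l * tail u\<bar> \<le> 1 * tail u"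
    using sk_uniform[of 1] by auto
  have "(tail \<longlongrightarrow> 1 - 1) at_top"
    unfolding ccdf_def[abs_def] by (intro tendsto_intros H.cdf_lim_at_top_prob)
  then have "\<forall>\<^sub>F u in at_top. tail u < 1 / (2 * (\<kappa> l0 + 1))"
    using \<kappa>_bounds[OF good_0] by (intro order_tendstoD(2)) auto
  then have "\<forall>\<^sub>F u in at_top. tail u < 1 / (2 * (\<kappa> l0 + 1)) \<and> A \<le> u \<and> 0 \<le> u"
    using eventually_ge_at_top[of A] eventually_ge_at_top[of 0] by eventually_elim simp
  then obtain k where k: "tail k < 1 / (2 * (\<kappa> l0 + 1))" "A \<le> k" "0 \<le> k"
    by (auto dest!: eventually_happens)
  have half: "sk l k \<le> 1 / 2" if l: "good l" for l
  proof -
    have "sk l k \<le> (\<kappa> l + 1) * tail k" using A[OF k(2) l] by (simp add: algebra_simps abs_le_iff)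
    also have "\<dots> \<le> (\<kappa> l0 + 1) * tail k" using \<kappa>_bounds[OF l] tail_pos[of k] by (intro mult_right_mono) auto
    also have "\<dots> \<le> 1 / 2" using k(1) \<kappa>_bounds[OF good_0] by (simp add: field_simps)
    finally show ?thesis .
  qed
  have bound: "prob (P.small_deficit R u) \<le> 2 * exp l0 * (sk_mix (u + - c) - sk_mix (u + (R + k)))" if u: "c \<le> u" for u
  proof -
    have u0: "0 \<le> u" using u premium_pos by simp
    have "prob (P.small_deficit R u) = (LINT l|G. measure (K l) (P.small_deficit R u))"
      by (rule mixture[OF P.small_deficit_sets[OF u0]])
    also have "\<dots> \<le> (LINT l|G. 2 * exp l0 * (sk l (u - c) - sk l (u + R + k)))"
    proof (rule integral_mono_AE)
      show "AE l in G. measure (K l) (P.small_deficit R u) \<le> 2 * exp l0 * (sk l (u - c) - sk l (u + R + k))"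
        using AE_good
      proof eventually_elim
        case (elim l)
        define d where "d = sk l (u - c) - sk l (u + R + k)"
        have m0: "0 \<le> measure (K l) (P.small_deficit R u)" by simp
        have "1 / 2 * measure (K l) (P.small_deficit R u) \<le> (1 - sk l k) * measure (K l) (P.small_deficit R u)"
          using half[OF elim] by (intro mult_right_mono) auto
        also have "\<dots> \<le> exp l * d" unfolding d_def by (rule small_deficit_K[OF elim u R k(3)])
        finally have le: "1 / 2 * measure (K l) (P.small_deficit R u) \<le> exp l * d" .
        \<comment> \<open>The estimate itself forces d >= 0, which allows exp l to be raised to exp
          l0.\<close>
        then have "0 \<le> exp l * d" using m0 by linarith
        then have "0 \<le> d" by (simp add: zero_le_mult_iff)
        then have "exp l * d \<le> exp l0 * d" using elim by (intro mult_right_mono) (auto simp: good_def)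
        then show ?case using le by (simp add: d_def)
      qed
    qed (intro integrable_measure_K P.small_deficit_sets u0 integrable_mult_right Bochner_Integration.integrable_diff integrable_sk)+
    also have "\<dots> = 2 * exp l0 * (sk_mix (u + - c) - sk_mix (u + (R + k)))"
      using integrable_sk by (simp add: sk_mix_eq add.assoc)
    finally show ?thesis .
  qed
  have lim: "((\<lambda>u. 2 * exp l0 * (sk_mix (u + - c) / tail u - sk_mix (u + (R + k)) / tail u)) \<longlongrightarrow> 2 * exp l0 * (\<kappa>_mix - \<kappa>_mix)) at_top"
    by (intro tendsto_intros sk_mix_shift_tendsto)
  show ?thesis
  proof (rule tendsto_sandwich[OF _ _ tendsto_const])
    show "((\<lambda>u. 2 * exp l0 * (sk_mix (u + - c) / tail u - sk_mix (u + (R + k)) / tail u)) \<longlongrightarrow> 0) at_top"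
      using lim by simp
    show "\<forall>\<^sub>F u in at_top. 0 \<le> prob (P.small_deficit R u) / tail u"
      using tail_pos by (intro always_eventually allI divide_nonneg_pos) auto
    show "\<forall>\<^sub>F u in at_top. prob (P.small_deficit R u) / tail u
        \<le> 2 * exp l0 * (sk_mix (u + - c) / tail u - sk_mix (u + (R + k)) / tail u)"
      using eventually_ge_at_top[of c]
    proof eventually_elim
      case (elim u)
      have "prob (P.small_deficit R u) / tail u \<le> 2 * exp l0 * (sk_mix (u + - c) - sk_mix (u + (R + k))) / tail u"
        using tail_pos[of u] by (intro divide_right_mono bound[OF elim]) auto
      also have "\<dots> = 2 * exp l0 * (sk_mix (u + - c) / tail u - sk_mix (u + (R + k)) / tail u)"
        by (simp only: diff_divide_distrib times_divide_eq_right[symmetric])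
      finally show ?case .
    qed
  qed
qed

section \<open>Classical and modified ruin probabilities of the mixed model\<close>

lemma psi_cl_eq:
  assumes u: "0 \<le> u"
  shows "psi_cl M \<Lambda> K N X D c u = ruin_mix u"
proof -
  have re: "ruin_event (K l) c N X u = P.ruined u" for l
    using P.ruin_event_eq[OF u] by (simp add: ruin_event_def K_space)
  have "psi_cl M \<Lambda> K N X D c u = (LINT l|G. measure (K l) (P.ruined u))"
    unfolding psi_cl_def psi_cl_fixed_def set_lebesgue_integral_def re
  proof (rule integral_cong_AE)
    note [measurable] = measure_K_measurable[OF P.ruined_sets]
    show "(\<lambda>l. indicator {0..} l *\<^sub>R (if c \<le> l * mean D then 1 else measure (K l) (P.ruined u))) \<in> borel_measurable G"
      by measurable
    show "(\<lambda>l. measure (K l) (P.ruined u)) \<in> borel_measurable G" by measurable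
    \<comment> \<open>The convention for c <= l mean D and the restriction to l >= 0 change the
      integrand only outside the good intensities, on a null set.\<close>
    show "AE l in G. indicator {0..} l *\<^sub>R (if c \<le> l * mean D then 1 else measure (K l) (P.ruined u)) = measure (K l) (P.ruined u)"
      using AE_good by eventually_elim (use good_net_profit in \<open>auto simp: good_def not_le[symmetric]\<close>)
  qed
  then show ?thesis by (simp add: ruin_mix_def mixture[OF P.ruined_sets])
qed

lemma \<kappa>_mix_eq: "\<kappa>_mix = (LINT \<omega>|M. \<Lambda> \<omega> * mean D / (c - \<Lambda> \<omega> * mean D))"
  unfolding \<kappa>_mix_def by (subst integral_distr[OF \<Lambda>_measurable]) (simp_all add: \<kappa>_def)

lemma \<kappa>_mix_nonneg: "0 \<le> \<kappa>_mix"
  unfolding \<kappa>_mix_def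
proof (rule integral_nonneg_AE)
  show "AE l in G. 0 \<le> \<kappa> l" using AE_good by eventually_elim (use \<kappa>_bounds in auto)
qed

text \<open>A vanishing integral of the nonnegative kappa means Lambda = 0 almost surely, and at
  rate 0 the renewal equation gives 0 on [0, infinity). This serves the degenerate case, where
  equivalence to the zero function means being eventually 0.\<close>

lemma ruin_mix_zero:
  assumes "\<kappa>_mix = 0" and u: "c \<le> u"
  shows "ruin_mix u = 0"
proof -
  have "AE l in G. \<kappa> l = 0"
  proof (subst integral_nonneg_eq_0_iff_AE[symmetric])
    show "AE l in G. 0 \<le> \<kappa> l" using AE_good by eventually_elim (use \<kappa>_bounds in auto)
  qed (use assms integrable_\<kappa> in \<open>simp_all add: \<kappa>_mix_def\<close>)
  then have l0: "AE l in G. l = 0"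
    using AE_good
  proof eventually_elim
    case (elim l)
    then show ?case using good_net_profit[of l] \<mu>_pos by (auto simp: \<kappa>_def)
  qed
  have sk0: "sk 0 v = 0" if v: "0 \<le> v" for v
  proof -
    interpret L: poisson_claims "K 0" N X c 0 D by (rule poisson_claims_K[OF good_0])
    obtain \<psi> where "unit_valued \<psi>" "\<And>u. u < 0 \<Longrightarrow> \<psi> u = 1"
      and \<psi>: "\<And>u. 0 \<le> u \<Longrightarrow> \<psi> u = 0 * mean D / c * (LINT y|ladder_law D. \<psi> (u - y))"
      and up: "\<And>u. L.skeleton_ruin u \<le> \<psi> u" and "\<And>u. \<psi> (u + c) \<le> L.skeleton_ruin u"
      using L.skeleton_ruin_sandwich[OF decoupled_K[OF good_0]] by blast
    have "\<psi> v = 0" using \<psi>[OF v] by simp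
    then have "L.skeleton_ruin v \<le> 0" using up[of v] by simp
    then show ?thesis using L.skeleton_ruin_bounds[of v] by (simp add: sk_eq[OF good_0])
  qed
  have "ruin_mix u \<le> sk_mix (u - c)" using ruin_mix_le_sk_mix[of "u - c"] by simp
  also have "sk_mix (u - c) = (LINT l|G. 0)"
    unfolding sk_mix_eq
  proof (rule integral_cong_AE)
    show "AE l in G. sk l (u - c) = 0" using l0 by eventually_elim (use sk0 u in auto)
  qed (use integrable_sk[of "u - c"] in auto)
  finally show ?thesis by (simp add: ruin_mix_def measure_le_0_iff)
qed

text \<open>psi u is the expectation of psi at the surplus at ruin, over the ruin event. Replacing
  psi by 1 there costs at most e where the deficit exceeds R and at most 1 on
  \<open>small_deficit\<close>.\<close>

lemma modified_ruin_bounds: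
  assumes mrp: "modified_ruin_probability M N X c \<psi>" and u: "0 \<le> u"
    and R: "\<And>y. y < - R \<Longrightarrow> 1 - e \<le> \<psi> y" and e: "0 \<le> e"
  shows "\<psi> u \<le> ruin_mix u" "ruin_mix u - \<psi> u \<le> e * ruin_mix u + prob (P.small_deficit R u)" "0 \<le> \<psi> u"
proof -
  have [measurable]: "\<psi> \<in> borel_measurable borel" and \<psi>01: "\<And>y. 0 \<le> \<psi> y" "\<And>y. \<psi> y \<le> 1"
    and eq: "\<psi> u = (LINT y:{..<0}|surplus_at_ruin_law M c N X u. \<psi> y)"
    using mrp u by (auto simp: modified_ruin_probability_def)
  show "0 \<le> \<psi> u" by (rule \<psi>01)
  let ?R = "P.ruined u"
  let ?V = "P.surplus_at_ruin u"
  note Vm = P.surplus_at_ruin_measurable[OF u]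
  have law: "surplus_at_ruin_law M c N X u = distr (restrict_space M ?R) borel ?V"
    unfolding surplus_at_ruin_law_def P.ruin_event_eq[OF u] P.surplus_at_ruin_def[abs_def] ..
  have \<Omega>: "?R \<inter> space M \<in> sets M" using P.ruined_sets by auto
  have "\<psi> u = (LINT y|distr (restrict_space M ?R) borel ?V. indicator {..<0} y *\<^sub>R \<psi> y)"
    by (subst eq) (simp add: law set_lebesgue_integral_def)
  also have "\<dots> = (LINT \<omega>|restrict_space M ?R. indicator {..<0} (?V \<omega>) *\<^sub>R \<psi> (?V \<omega>))"
    by (rule integral_distr[OF Vm]) measurable
  also have "\<dots> = (LINT \<omega>|M. indicator ?R \<omega> *\<^sub>R (indicator {..<0} (?V \<omega>) *\<^sub>R \<psi> (?V \<omega>)))"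
    by (rule integral_restrict_space[OF \<Omega>])
  \<comment> \<open>The restriction to negative arguments disappears because the surplus at ruin is
    negative.\<close>
  also have "\<dots> = (LINT \<omega>|M. indicator ?R \<omega> * \<psi> (?V \<omega>))"
    using P.first_passage(1)[OF u]
    by (intro Bochner_Integration.integral_cong) (auto split: split_indicator)
  finally have \<psi>u: "\<psi> u = (LINT \<omega>|M. indicator ?R \<omega> * \<psi> (?V \<omega>))" .
  have "(\<lambda>\<omega>. \<psi> (?V \<omega>)) \<in> borel_measurable (restrict_space M ?R)"
    by (rule measurable_compose[OF Vm]) measurable
  then have meas: "(\<lambda>\<omega>. indicator ?R \<omega> * \<psi> (?V \<omega>)) \<in> borel_measurable M"
    by (simp add: borel_measurable_restrict_space_iff[OF \<Omega>])
  have int1: "integrable M (\<lambda>\<omega>. indicator ?R \<omega> * \<psi> (?V \<omega>))"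
    using meas \<psi>01 by (intro integrable_const_bound[where B=1]) (auto split: split_indicator)
  have int2: "integrable M (indicator ?R :: 'a \<Rightarrow> real)"
    using P.ruined_sets by (intro integrable_real_indicator) (auto simp: emeasure_eq_measure)
  have int3: "integrable M (indicator (P.small_deficit R u) :: 'a \<Rightarrow> real)"
    using P.small_deficit_sets[OF u] by (intro integrable_real_indicator) (auto simp: emeasure_eq_measure)
  have Rm: "(LINT \<omega>|M. indicator ?R \<omega>) = ruin_mix u"
    using P.ruined_sets by (simp add: ruin_mix_def \<Omega> Int_absorb2 sets.sets_into_space)
  have Sm: "(LINT \<omega>|M. indicator (P.small_deficit R u) \<omega>) = prob (P.small_deficit R u)"
    using P.small_deficit_sets[OF u] by (simp add: Int_absorb2 sets.sets_into_space)
  show "\<psi> u \<le> ruin_mix u"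
    unfolding \<psi>u Rm[symmetric] using int1 int2 \<psi>01
    by (intro integral_mono) (auto split: split_indicator)
  have "ruin_mix u - \<psi> u = (LINT \<omega>|M. indicator ?R \<omega> - indicator ?R \<omega> * \<psi> (?V \<omega>))"
    unfolding \<psi>u Rm[symmetric] by (rule Bochner_Integration.integral_diff[OF int2 int1, symmetric])
  also have "\<dots> \<le> (LINT \<omega>|M. e * indicator ?R \<omega> + indicator (P.small_deficit R u) \<omega>)"
  proof (rule integral_mono)
    fix \<omega>
    show "indicator ?R \<omega> - indicator ?R \<omega> * \<psi> (?V \<omega>) \<le> e * indicator ?R \<omega> + indicator (P.small_deficit R u) \<omega>"
      using R[of "?V \<omega>"] \<psi>01(1)[of "?V \<omega>"] e
      by (auto simp: P.small_deficit_def not_le split: split_indicator)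
  qed (use int1 int2 int3 in auto)
  also have "\<dots> = e * ruin_mix u + prob (P.small_deficit R u)"
    unfolding Bochner_Integration.integral_add[OF integrable_mult_right[OF int2] int3] integral_mult_right_zero Rm Sm ..
  finally show "ruin_mix u - \<psi> u \<le> e * ruin_mix u + prob (P.small_deficit R u)" .
qed

lemma modified_ruin_tendsto:
  assumes mrp: "modified_ruin_probability M N X c \<psi>" and lim: "(\<psi> \<longlongrightarrow> 1) at_bot"
  shows "((\<lambda>u. \<psi> u / tail u) \<longlongrightarrow> \<kappa>_mix) at_top"
proof -
  have "((\<lambda>u. (ruin_mix u - \<psi> u) / tail u) \<longlongrightarrow> 0) at_top"
  proof (rule tendstoI)
    fix \<eta> :: real assume \<eta>: "0 < \<eta>"
    \<comment> \<open>Then e kappa_mix <= eta / 2; the summand 1 keeps the denominator positive when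
      kappa_mix = 0.\<close>
    define e where "e = \<eta> / (2 * (\<kappa>_mix + 1))"
    have e: "0 < e" using \<eta> \<kappa>_mix_nonneg by (simp add: e_def)
    have "\<forall>\<^sub>F y in at_bot. 1 - e < \<psi> y" using order_tendstoD(1)[OF lim] e by simp
    then obtain y0 where y0: "\<And>y. y \<le> y0 \<Longrightarrow> 1 - e < \<psi> y" by (auto simp: eventually_at_bot_linorder)
    define R where "R = max 0 (- y0)"
    have R: "0 \<le> R" and R1: "\<And>y. y < - R \<Longrightarrow> 1 - e \<le> \<psi> y"
      using y0 by (auto simp: R_def intro: less_imp_le)
    have "((\<lambda>u. e * (ruin_mix u / tail u) + prob (P.small_deficit R u) / tail u) \<longlongrightarrow> e * \<kappa>_mix + 0) at_top"
      by (intro tendsto_intros ruin_mix_tendsto small_deficit_tendsto R)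
    moreover have "e * \<kappa>_mix + 0 < \<eta>"
    proof -
      have "e * \<kappa>_mix \<le> e * (\<kappa>_mix + 1)" using e by (intro mult_left_mono) auto
      also have "\<dots> = \<eta> / 2" using \<kappa>_mix_nonneg by (simp add: e_def field_simps)
      finally show ?thesis using \<eta> by simp
    qed
    ultimately have "\<forall>\<^sub>F u in at_top. e * (ruin_mix u / tail u) + prob (P.small_deficit R u) / tail u < \<eta>"
      by (rule order_tendstoD(2))
    then show "\<forall>\<^sub>F u in at_top. dist ((ruin_mix u - \<psi> u) / tail u) 0 < \<eta>"
      using eventually_ge_at_top[of 0]
    proof eventually_elim
      case (elim u)
      note b = modified_ruin_bounds[OF mrp elim(2) R1 less_imp_le[OF e]]
      have "(ruin_mix u - \<psi> u) / tail u \<le> (e * ruin_mix u + prob (P.small_deficit R u)) / tail u"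
        using b(2) tail_pos[of u] by (intro divide_right_mono) auto
      also have "\<dots> < \<eta>" using elim(1) by (simp add: add_divide_distrib)
      finally show ?case using b(1) tail_pos[of u] by (simp add: dist_real_def abs_div_pos)
    qed
  qed
  from tendsto_diff[OF ruin_mix_tendsto this]
  show ?thesis by (simp add: diff_divide_distrib)
qed

end

theorem theorem3p1:
  fixes M :: "'a measure" and \<Lambda> :: "'a \<Rightarrow> real" and K :: "real \<Rightarrow> 'a measure"
    and N :: "real \<Rightarrow> 'a \<Rightarrow> nat" and X :: "nat \<Rightarrow> 'a \<Rightarrow> real"
    and D :: "real measure" and c :: real and \<psi> :: "real \<Rightarrow> real"
  assumes "mixed_poisson_risk_model M \<Lambda> K N X D"
    and "0 < c"
    and "modified_ruin_probability M N X c \<psi>"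
    and "max_intensity (distr M borel \<Lambda>) < ereal (c / mean D)"
    and "subexponential (interval_measure (integrated_tail D))"
    and "(\<psi> \<longlongrightarrow> 1) at_bot"
  shows "\<psi> \<sim>[at_top] psi_cl M \<Lambda> K N X D c \<and>
    psi_cl M \<Lambda> K N X D c \<sim>[at_top]
      (\<lambda>u. (LINT \<omega>|M. \<Lambda> \<omega> * mean D / (c - \<Lambda> \<omega> * mean D)) * (1 - integrated_tail D u))"
proof -
  have claims: "claim_size_law D" using assms(1) by (simp add: mixed_poisson_risk_model_def)
  have \<mu>: "0 < mean D" by (rule mean_pos[OF claims])
  interpret D: positive_step D
  proof (intro positive_step.intro nonneg_step.intro nonneg_step_axioms.intro positive_step_axioms.intro \<mu>)
    show "real_distribution D" "integrable D (\<lambda>s. s)" using claims by (simp_all add: claim_size_law_def)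
    have "AE x in D. 0 < x" using claims by (simp add: claim_size_law_def)
    then show "AE s in D. 0 \<le> s" by eventually_elim simp
  qed
  obtain l0 where l0: "0 \<le> l0" "cdf (distr M borel \<Lambda>) l0 = 1" "ereal l0 < ereal (c / mean D)"
    using assms(4) unfolding max_intensity_def Inf_less_iff by auto
  then have "l0 * mean D < c" using \<mu> by (simp add: field_simps)
  then interpret mixed_model M \<Lambda> K N X D c l0
    using assms(1,2,5) l0 by unfold_locales (simp_all add: D.interval_measure_integrated_tail)
  have tail_eq: "1 - integrated_tail D u = tail u" for u
    by (simp add: ccdf_def D.cdf_ladder_law)
  let ?cl = "psi_cl M \<Lambda> K N X D c"
  have cl: "\<forall>\<^sub>F u in at_top. ?cl u = ruin_mix u"
    using eventually_ge_at_top[of 0] by eventually_elim (rule psi_cl_eq)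
  have goal: "\<psi> \<sim>[at_top] ?cl \<and> ?cl \<sim>[at_top] (\<lambda>u. \<kappa>_mix * tail u)"
  proof (cases "\<kappa>_mix = 0")
    \<comment> \<open>Dividing by the limit \<open>\<kappa>_mix\<close> is impossible here. Instead
      all functions involved vanish for u >= c, and eventually equal functions are equivalent even
      where they are 0.\<close>
    case True
    have z: "\<forall>\<^sub>F u in at_top. ?cl u = 0 \<and> \<psi> u = 0"
      using eventually_ge_at_top[of c]
    proof eventually_elim
      case (elim u)
      then have u: "0 \<le> u" using assms(2) by simp
      have "ruin_mix u = 0" by (rule ruin_mix_zero[OF True elim])
      moreover have "0 \<le> \<psi> u" "\<psi> u \<le> 1" for u using assms(3) by (auto simp: modified_ruin_probability_def)
      \<comment> \<open>With e = 1 the required lower bound on psi reads 0 <= psi y, so R = 0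
        qualifies.\<close>
      moreover have "\<psi> u \<le> ruin_mix u"
        using modified_ruin_bounds(1)[OF assms(3) u, of 0 1] \<open>\<And>u. 0 \<le> \<psi> u\<close> by simp
      ultimately show ?case using psi_cl_eq[OF u] by (simp add: order_antisym)
    qed
    have "\<psi> \<sim>[at_top] ?cl"
      using z by (intro asymp_equiv_refl_ev) (auto elim: eventually_mono)
    moreover have "?cl \<sim>[at_top] (\<lambda>u. \<kappa>_mix * tail u)"
      using z True by (intro asymp_equiv_refl_ev) (auto elim: eventually_mono)
    ultimately show ?thesis by blast
  next
    case False
    have lim_cl: "((\<lambda>u. ?cl u / tail u) \<longlongrightarrow> \<kappa>_mix) at_top"
      by (rule Lim_transform_eventually[OF ruin_mix_tendsto]) (use cl in eventually_elim, simp)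
    note lim_\<psi> = modified_ruin_tendsto[OF assms(3,6)]
    have "((\<lambda>u. (\<psi> u / tail u) / (?cl u / tail u)) \<longlongrightarrow> \<kappa>_mix / \<kappa>_mix) at_top"
      by (intro tendsto_divide lim_\<psi> lim_cl False)
    then have "((\<lambda>u. \<psi> u / ?cl u) \<longlongrightarrow> 1) at_top"
      using False tail_pos by (simp add: less_imp_neq[THEN not_sym])
    moreover have "((\<lambda>u. (?cl u / tail u) / \<kappa>_mix) \<longlongrightarrow> \<kappa>_mix / \<kappa>_mix) at_top"
      by (intro tendsto_divide lim_cl tendsto_const False)
    then have "((\<lambda>u. ?cl u / (\<kappa>_mix * tail u)) \<longlongrightarrow> 1) at_top"
      using False by (simp add: mult.commute)
    ultimately show ?thesis by (intro conjI asymp_equivI')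
  qed
  then show ?thesis by (simp add: tail_eq \<kappa>_mix_eq)
qed

end
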